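(* Let $k$ be a field and let $M$ be a regular matroid of rank $r$ with a standard ordering $e_1<\cdots<e_n$ of its ground set (i.e. $B=\{e_{n-r+1},\ldots,e_n\}$ is a basis), and suppose $\{e_n,e_{n-r}\}$ is a cocircuit of $M$. If $M\setminus e_n$ and $M/e_n$ have NBC bases in their induced standard orderings (the restriction of $e_1<\cdots<e_n$ to $e_1<\cdots<e_{n-1}$, with bases $\{e_{n-r},\ldots,e_{n-1}\}$ and $\{e_{n-r+1},\ldots,e_{n-1}\}$ respectively), then $M$ has an NBC basis in the ordering $e_1<\cdots<e_n$.
   Context: Let $N$ be a regular matroid of rank $s$ on $e_1<\cdots<e_m$ with $B=\{e_{m-s+1},\ldots,e_m\}$ a basis. For $e\notin B$, $\mathrm{ci}(B,e)$ is the unique circuit in $B\cup\{e\}$; for $b\in B$, $\mathrm{coc}(B,b)$ is the unique cocircuit in $(E\setminus B)\cup\{b\}$ containing $b$. Fix an admissible signed fundamental cocircuit incidence matrix $(a^*_{ji})$ (rows $\mathrm{coc}(B,e_j)$, $0/\pm1$ entries, being the restriction of a signing of the full cocircuit incidence matrix that together with some signing of the full circuit incidence matrix satisfies $\widetilde{\mathcal{A}}(\mathcal{C})\widetilde{\mathcal{A}}(\mathcal{C}^* )^T=0$ over $k$). Let $\Theta^B=\{\theta_{e_j}=\sum_{e_i\in\mathrm{coc}(B,e_j)}a^*_{ji}x_i : e_j\in B\}$ and $k(\Delta_{\mathrm{BC}}(N))=k[\Delta_{\mathrm{BC}}(N)]/(\Theta^B)$, where $\Delta_{\mathrm{BC}}(N)$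 is the broken circuit complex (sets containing no $\overline{C}=C\setminus\{\min C\}$, $C$ a circuit) and $k[\Delta_{\mathrm{BC}}(N)]=k[x_1,\ldots,x_m]/\langle\prod_{e_i\in\overline{C}}x_i\rangle$. Label circuits so that $C_i=\mathrm{ci}(B,e_i)$ for $i\le m-s$, others $C_{m-s+1},\ldots$. Set $d_j=j$ for $j\le m-s$ and $d_j=\min\{i:e_i\in\mathrm{coc}(B,e_j)\}$ for $j>m-s$; $m_{C_i}=x_i^{|\overline{C}_i|}$ if $i\le m-s$, $m_{C_i}=\prod_{e_j\in\overline{C}_i}x_{d_j}$ otherwise. Let $L(N)$ be the set of monomials in $x_1,\ldots,x_{m-s}$ not divisible by any $m_C$. $N$ has an NBC basis in this ordering if the images of $L(N)$ form a $k$-basis of $k(\Delta_{\mathrm{BC}}(N))$. $M\setminus e$ is the deletion (independent sets of $M$ avoiding $e$) and $M/e$ the contraction (bases $B'$ with $B'\cup\{e\}$ a basis of $M$). *)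

theory Defs
  imports "HOL-Library.Poly_Mapping" "Jordan_Normal_Form.DL_Submatrix" "Jordan_Normal_Form.Determinant"
begin

section \<open>Matroids on the ground set {1..n} (element e_i is the natural number i)\<close>

definition matroid :: "nat set \<Rightarrow> (nat set \<Rightarrow> bool) \<Rightarrow> bool" where
  "matroid E indep \<longleftrightarrow> finite E \<and> indep {} \<and>
     (\<forall>X. indep X \<longrightarrow> X \<subseteq> E) \<and>
     (\<forall>X Y. indep Y \<and> X \<subseteq> Y \<longrightarrow> indep X) \<and>
     (\<forall>X Y. indep X \<and> indep Y \<and> card X < card Y \<longrightarrow> (\<exists>y\<in>Y - X. indep (insert y X)))"

definition is_basis :: "nat set \<Rightarrow> (nat set \<Rightarrow> bool) \<Rightarrow> nat set \<Rightarrow> bool" where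
  "is_basis E indep B \<longleftrightarrow> B \<subseteq> E \<and> indep B \<and> (\<forall>X. X \<subseteq> E \<and> indep X \<and> B \<subseteq> X \<longrightarrow> X = B)"

definition circuit :: "nat set \<Rightarrow> (nat set \<Rightarrow> bool) \<Rightarrow> nat set \<Rightarrow> bool" where
  "circuit E indep C \<longleftrightarrow> C \<subseteq> E \<and> \<not> indep C \<and> (\<forall>x\<in>C. indep (C - {x}))"

definition cocircuit :: "nat set \<Rightarrow> (nat set \<Rightarrow> bool) \<Rightarrow> nat set \<Rightarrow> bool" where
  "cocircuit E indep D \<longleftrightarrow> D \<subseteq> E \<and> (\<forall>B. is_basis E indep B \<longrightarrow> D \<inter> B \<noteq> {}) \<and>
     (\<forall>x\<in>D. \<exists>B. is_basis E indep B \<and> (D - {x}) \<inter> B = {})"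

definition ci :: "nat set \<Rightarrow> (nat set \<Rightarrow> bool) \<Rightarrow> nat set \<Rightarrow> nat \<Rightarrow> nat set" where
  "ci E indep B e = (THE C. circuit E indep C \<and> C \<subseteq> insert e B)"

definition coc :: "nat set \<Rightarrow> (nat set \<Rightarrow> bool) \<Rightarrow> nat set \<Rightarrow> nat \<Rightarrow> nat set" where
  "coc E indep B b = (THE D. cocircuit E indep D \<and> D \<subseteq> insert b (E - B) \<and> b \<in> D)"

definition deletion :: "(nat set \<Rightarrow> bool) \<Rightarrow> nat \<Rightarrow> nat set \<Rightarrow> bool" where
  "deletion indep e X \<longleftrightarrow> indep X \<and> e \<notin> X"

definition contraction :: "nat set \<Rightarrow> (nat set \<Rightarrow> bool) \<Rightarrow> nat \<Rightarrow> nat set \<Rightarrow> bool" where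
  "contraction E indep e X \<longleftrightarrow>
     (\<exists>B'. e \<notin> B' \<and> is_basis E indep (insert e B') \<and> X \<subseteq> B')"

definition totally_unimodular :: "real mat \<Rightarrow> bool" where
  "totally_unimodular A \<longleftrightarrow>
     (\<forall>I J. I \<subseteq> {..<dim_row A} \<and> J \<subseteq> {..<dim_col A} \<and> card I = card J \<longrightarrow>
        det (submatrix A I J) \<in> {-1, 0, 1})"

text \<open>The matroid on {1..n} given by \<open>indep\<close> is represented by the real matrix A whose
  column j-1 corresponds to element j.\<close>
definition represents :: "real mat \<Rightarrow> nat \<Rightarrow> (nat set \<Rightarrow> bool) \<Rightarrow> bool" where
  "represents A n indep \<longleftrightarrow> dim_col A = n \<and>
     (\<forall>X. indep X \<longleftrightarrow> X \<subseteq> {1..n} \<and>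
        (\<forall>c::nat \<Rightarrow> real. (\<forall>i<dim_row A. (\<Sum>j\<in>X. c j * A $$ (i, j - 1)) = 0) \<longrightarrow> (\<forall>j\<in>X. c j = 0)))"

definition regular_matroid :: "nat \<Rightarrow> (nat set \<Rightarrow> bool) \<Rightarrow> bool" where
  "regular_matroid n indep \<longleftrightarrow> matroid {1..n} indep \<and>
     (\<exists>A. totally_unimodular A \<and> represents A n indep)"

type_synonym 'a mpoly = "(nat \<Rightarrow>\<^sub>0 nat) \<Rightarrow>\<^sub>0 'a"

definition var :: "nat \<Rightarrow> 'a::comm_ring_1 mpoly" where
  "var i = Poly_Mapping.single (Poly_Mapping.single i 1) 1"

definition mono :: "(nat \<Rightarrow>\<^sub>0 nat) \<Rightarrow> 'a::comm_ring_1 mpoly" where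
  "mono \<mu> = Poly_Mapping.single \<mu> 1"

definition pvars :: "'a::zero mpoly \<Rightarrow> nat set" where
  "pvars p = \<Union> (Poly_Mapping.keys ` Poly_Mapping.keys p)"

definition gen_ideal :: "nat set \<Rightarrow> 'a::comm_ring_1 mpoly set \<Rightarrow> 'a mpoly set" where
  "gen_ideal V G = {p. \<exists>F c. finite F \<and> F \<subseteq> G \<and> (\<forall>g\<in>F. pvars (c g) \<subseteq> V) \<and> p = (\<Sum>g\<in>F. c g * g)}"

definition mono_dvd :: "(nat \<Rightarrow>\<^sub>0 nat) \<Rightarrow> (nat \<Rightarrow>\<^sub>0 nat) \<Rightarrow> bool" where
  "mono_dvd \<nu> \<mu> \<longleftrightarrow> (\<forall>i. Poly_Mapping.lookup \<nu> i \<le> Poly_Mapping.lookup \<mu> i)"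

section \<open>NBC bases (matroid N of rank s on e_1 < ... < e_m, B = {m-s+1..m})\<close>

definition bar :: "nat set \<Rightarrow> nat set" where
  "bar C = C - {Min C}"

text \<open>Admissible signed fundamental cocircuit incidence matrix: row j (for e_j \<in> B) is the
  restriction to coc(B,e_j) of a signing \<tau> of the full cocircuit incidence matrix such that,
  for some signing \<sigma> of the full circuit incidence matrix, \<sigma> \<tau>^T = 0 over k.\<close>
definition admissible :: "nat \<Rightarrow> nat \<Rightarrow> (nat set \<Rightarrow> bool) \<Rightarrow> (nat \<Rightarrow> nat \<Rightarrow> 'a::field) \<Rightarrow> bool" where
  "admissible m s indep astar \<longleftrightarrow>
     (\<exists>(\<sigma>::nat set \<Rightarrow> nat \<Rightarrow> 'a) (\<tau>::nat set \<Rightarrow> nat \<Rightarrow> 'a).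
        (\<forall>C. circuit {1..m} indep C \<longrightarrow>
           (\<forall>e. (e \<in> C \<longrightarrow> \<sigma> C e \<in> {1, -1}) \<and> (e \<notin> C \<longrightarrow> \<sigma> C e = 0))) \<and>
        (\<forall>D. cocircuit {1..m} indep D \<longrightarrow>
           (\<forall>e. (e \<in> D \<longrightarrow> \<tau> D e \<in> {1, -1}) \<and> (e \<notin> D \<longrightarrow> \<tau> D e = 0))) \<and>
        (\<forall>C D. circuit {1..m} indep C \<and> cocircuit {1..m} indep D \<longrightarrow>
           (\<Sum>e\<in>{1..m}. \<sigma> C e * \<tau> D e) = 0) \<and>
        (\<forall>j\<in>{m-s+1..m}. \<forall>i\<in>{1..m}. astar j i = \<tau> (coc {1..m} indep {m-s+1..m} j) i))"


definition d_idx :: "nat \<Rightarrow> nat \<Rightarrow> (nat set \<Rightarrow> bool) \<Rightarrow> nat \<Rightarrow> nat" where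
  "d_idx m s indep j = (if j \<le> m - s then j else Min (coc {1..m} indep {m-s+1..m} j))"

definition mC :: "nat \<Rightarrow> nat \<Rightarrow> (nat set \<Rightarrow> bool) \<Rightarrow> nat set \<Rightarrow> (nat \<Rightarrow>\<^sub>0 nat)" where
  "mC m s indep C =
     (if \<exists>i\<in>{1..m-s}. C = ci {1..m} indep {m-s+1..m} i
      then Poly_Mapping.single (THE i. i \<in> {1..m-s} \<and> C = ci {1..m} indep {m-s+1..m} i) (card (bar C))
      else (\<Sum>j\<in>bar C. Poly_Mapping.single (d_idx m s indep j) 1))"

definition LN :: "nat \<Rightarrow> nat \<Rightarrow> (nat set \<Rightarrow> bool) \<Rightarrow> (nat \<Rightarrow>\<^sub>0 nat) set" where
  "LN m s indep = {\<mu>. Poly_Mapping.keys \<mu> \<subseteq> {1..m-s} \<and>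
     (\<forall>C. circuit {1..m} indep C \<longrightarrow> \<not> mono_dvd (mC m s indep C) \<mu>)}"

text \<open>Stanley--Reisner generators of the broken circuit complex: \<Prod>_{e_i \<in> bar C} x_i.\<close>
definition SR_gens :: "nat \<Rightarrow> (nat set \<Rightarrow> bool) \<Rightarrow> 'a::comm_ring_1 mpoly set" where
  "SR_gens m indep = {mono (\<Sum>i\<in>bar C. Poly_Mapping.single i 1) | C. circuit {1..m} indep C}"

definition theta :: "nat \<Rightarrow> nat \<Rightarrow> (nat set \<Rightarrow> bool) \<Rightarrow> (nat \<Rightarrow> nat \<Rightarrow> 'a::comm_ring_1) \<Rightarrow> nat \<Rightarrow> 'a mpoly" where
  "theta m s indep astar j =
     (\<Sum>i\<in>coc {1..m} indep {m-s+1..m} j. Poly_Mapping.single (Poly_Mapping.single i 1) (astar j i))"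

text \<open>The ideal of k[x_1..x_m] whose quotient is k(\<Delta>_BC(N)) = k[\<Delta>_BC(N)]/(\<Theta>^B).\<close>
definition JN :: "nat \<Rightarrow> nat \<Rightarrow> (nat set \<Rightarrow> bool) \<Rightarrow> (nat \<Rightarrow> nat \<Rightarrow> 'a::comm_ring_1) \<Rightarrow> 'a mpoly set" where
  "JN m s indep astar = gen_ideal {1..m}
     (SR_gens m indep \<union> theta m s indep astar ` {m-s+1..m})"

text \<open>The images of L(N) form a k-basis of k[x_1..x_m]/J: they span, and are linearly independent.\<close>
definition NBC_basis_wrt :: "nat \<Rightarrow> nat \<Rightarrow> (nat set \<Rightarrow> bool) \<Rightarrow> (nat \<Rightarrow> nat \<Rightarrow> 'a::field) \<Rightarrow> bool" where
  "NBC_basis_wrt m s indep astar \<longleftrightarrow>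
     (\<forall>p::'a mpoly. pvars p \<subseteq> {1..m} \<longrightarrow>
        (\<exists>q. Poly_Mapping.keys q \<subseteq> LN m s indep \<and> p - q \<in> JN m s indep astar)) \<and>
     (\<forall>q::'a mpoly. Poly_Mapping.keys q \<subseteq> LN m s indep \<and> q \<in> JN m s indep astar \<longrightarrow> q = 0)"

text \<open>N (on e_1 < ... < e_m, rank s, B = {m-s+1..m}) has an NBC basis over k (field type 'a)
  for the (fixed, arbitrary) admissible signing.\<close>
definition has_NBC_basis :: "'a::field itself \<Rightarrow> nat \<Rightarrow> nat \<Rightarrow> (nat set \<Rightarrow> bool) \<Rightarrow> bool" where
  "has_NBC_basis (k::'a itself) m s indep \<longleftrightarrow>
     (\<forall>astar::nat \<Rightarrow> nat \<Rightarrow> 'a. admissible m s indep astar \<longrightarrow> NBC_basis_wrt m s indep astar)"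

end

theory Submission
  imports Defs
begin

text \<open>Let \<open>a = n - r\<close>. As \<open>e\<^sub>a\<close> and \<open>e\<^sub>n\<close> are in series, every
  circuit contains both or neither, and \<open>x\<^sub>n = \<plusminus>x\<^sub>a\<close> in \<open>k(\<Delta>(M))\<close>. Multiplication by \<open>x\<^sub>a\<close> yields a
  right exact sequence \<open>k(\<Delta>(M/e\<^sub>n)) \<rightarrow> k(\<Delta>(M)) \<rightarrow> k(\<Delta>(M\<setminus>e\<^sub>n)) \<rightarrow> 0\<close>, and \<open>L(M)\<close> is the disjoint union
  of \<open>L(M\<setminus>e\<^sub>n)\<close> and \<open>x\<^sub>a L(M/e\<^sub>n)\<close>, so \<open>L(M)\<close> spans. Independence is a count: if \<open>f\<close> is the number of
  bases without broken circuits, then \<open>f(M) \<ge> f(M\<setminus>e\<^sub>n) + f(M/e\<^sub>n)\<close>, each quotient is spanned by at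
  most \<open>f\<close> elements (deletion and contraction of the largest element), and no set of fewer than
  \<open>f\<close> monomials can span.\<close>

text \<open>Right exactness gives spanning only, and injectivity on the left is never proved
  directly. The count replaces it: the NBC bases of the minors give |L(M)| <= |L(del)| + |L(con)| <=
  f(del) + f(con) <= f(M), while every set of monomials spanning the quotient for M has at least
  f(M) elements. So L(M) is a spanning set of monomials of least size, and a nontrivial relation on
  it would allow one monomial to be dropped. The number f is computed in a vector space: the signing
  of the circuits determines the subspace W of vectors orthogonal to all signed circuits, which
  represents M over k. For the minors one keeps W, respectively its vectors that vanish at n, so the
  recursion for f and the upper bound are linear algebra in which no signs have to be tracked. The
  hypotheses on the minors quantify over their admissible matrices. They become applicable because
  one pair of signings of M induces signings of both minors.\<close>

lemma poly_mapping_induct_single [case_names single zero add]: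
  fixes p :: "'b \<Rightarrow>\<^sub>0 'c::comm_monoid_add"
  assumes single: "\<And>k c. k \<in> Poly_Mapping.keys p \<Longrightarrow> P (Poly_Mapping.single k c)"
    and zero: "P 0"
    and add: "\<And>p q. P p \<Longrightarrow> P q \<Longrightarrow> P (p + q)"
  shows "P p"
proof -
  have eq: "p = (\<Sum>k\<in>Poly_Mapping.keys p. Poly_Mapping.single k (Poly_Mapping.lookup p k))"
    by (rule poly_mapping_eqI)
      (auto simp: lookup_sum lookup_single when_def in_keys_iff sum.delta' cong: if_cong)
  have "P (\<Sum>k\<in>A. Poly_Mapping.single k (Poly_Mapping.lookup p k))"
    if "finite A" "A \<subseteq> Poly_Mapping.keys p" for A
    using that by (induction A) (auto intro: single zero add)
  from this[of "Poly_Mapping.keys p"] show ?thesis using eq by simp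
qed

lemma single_sum: "Poly_Mapping.single \<mu> (sum f A) = (\<Sum>x\<in>A. Poly_Mapping.single \<mu> (f x))"
  by (induction A rule: infinite_finite_induct) (auto simp: single_add)

subsection \<open>Variables of a polynomial\<close>

lemma pvars_subset_iff: "pvars p \<subseteq> V \<longleftrightarrow> (\<forall>\<mu>\<in>Poly_Mapping.keys p. Poly_Mapping.keys \<mu> \<subseteq> V)"
  by (auto simp: pvars_def)

lemma keys_add_nat: "Poly_Mapping.keys (\<mu> + \<nu> :: 'b \<Rightarrow>\<^sub>0 nat) = Poly_Mapping.keys \<mu> \<union> Poly_Mapping.keys \<nu>"
  by (auto simp: in_keys_iff lookup_add)

lemma pvars_add: "pvars p \<subseteq> V \<Longrightarrow> pvars q \<subseteq> V \<Longrightarrow> pvars (p + q) \<subseteq> V"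
  using keys_add[of p q] unfolding pvars_subset_iff by blast

lemma pvars_zero: "pvars 0 \<subseteq> V"
  by (simp add: pvars_def)

lemma pvars_one: "pvars 1 \<subseteq> V"
  by (simp add: pvars_def)

lemma pvars_uminus: "pvars p \<subseteq> V \<Longrightarrow> pvars (- p :: 'a::comm_ring_1 mpoly) \<subseteq> V"
  unfolding pvars_subset_iff by (simp add: in_keys_iff)

lemma pvars_mult:
  fixes p q :: "'a::comm_ring_1 mpoly"
  assumes "pvars p \<subseteq> V" "pvars q \<subseteq> V"
  shows "pvars (p * q) \<subseteq> V"
  unfolding pvars_subset_iff
proof
  fix \<mu> assume "\<mu> \<in> Poly_Mapping.keys (p * q)"
  then obtain a b where "\<mu> = a + b" "a \<in> Poly_Mapping.keys p" "b \<in> Poly_Mapping.keys q"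
    using keys_mult[of p q] by blast
  then show "Poly_Mapping.keys \<mu> \<subseteq> V"
    using assms by (auto simp: pvars_subset_iff keys_add_nat)
qed

lemma pvars_sum: "(\<And>x. x \<in> A \<Longrightarrow> pvars (f x) \<subseteq> V) \<Longrightarrow> pvars (sum f A) \<subseteq> V"
  by (induction A rule: infinite_finite_induct) (simp_all add: pvars_add pvars_zero)

lemma pvars_single: "Poly_Mapping.keys \<mu> \<subseteq> V \<Longrightarrow> pvars (Poly_Mapping.single \<mu> c) \<subseteq> V"
  by (simp add: pvars_def)

lemma pvars_mono_iff: "pvars (mono \<mu> :: 'a::comm_ring_1 mpoly) \<subseteq> V \<longleftrightarrow> Poly_Mapping.keys \<mu> \<subseteq> V"
  by (simp add: pvars_def mono_def)

lemma pvars_var: "i \<in> V \<Longrightarrow> pvars (var i :: 'a::comm_ring_1 mpoly) \<subseteq> V"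
  by (simp add: pvars_def var_def)

lemma mono_add: "mono (\<mu> + \<nu>) = mono \<mu> * (mono \<nu> :: 'a::comm_ring_1 mpoly)"
  by (simp add: mono_def mult_single)

lemma mono_single: "mono (Poly_Mapping.single i 1) = var i"
  by (simp add: mono_def var_def)

lemma single_eq_const_mult_mono:
  "Poly_Mapping.single \<mu> c = Poly_Mapping.single 0 c * (mono \<mu> :: 'a::comm_ring_1 mpoly)"
  by (simp add: mono_def mult_single)

subsection \<open>Ideals of \<open>k[V]\<close>\<close>

text \<open>Only closure under multiplication by polynomials in \<open>V\<close> is demanded, and
  \<open>J\<close> need not lie in k[V]. Hence an ideal for \<open>V\<close> is also one for every
  subset of \<open>V\<close> (\<open>ideal_in_subset\<close>), which lets an ideal for M be compared
  with ideals of its minors without restricting it first.\<close>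

definition ideal_in :: "nat set \<Rightarrow> 'a::comm_ring_1 mpoly set \<Rightarrow> bool" where
  "ideal_in V J \<longleftrightarrow> 0 \<in> J \<and> (\<forall>p\<in>J. \<forall>q\<in>J. p + q \<in> J) \<and>
     (\<forall>p\<in>J. \<forall>c. pvars c \<subseteq> V \<longrightarrow> c * p \<in> J)"

lemma ideal_in_zero: "ideal_in V J \<Longrightarrow> 0 \<in> J"
  and ideal_in_add: "ideal_in V J \<Longrightarrow> p \<in> J \<Longrightarrow> q \<in> J \<Longrightarrow> p + q \<in> J"
  and ideal_in_mult: "ideal_in V J \<Longrightarrow> p \<in> J \<Longrightarrow> pvars c \<subseteq> V \<Longrightarrow> c * p \<in> J"
  by (auto simp: ideal_in_def)

lemma ideal_in_mult_right: "ideal_in V J \<Longrightarrow> p \<in> J \<Longrightarrow> pvars c \<subseteq> V \<Longrightarrow> p * c \<in> J"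
  using ideal_in_mult[of V J p c] by (simp add: mult.commute)

lemma ideal_in_const_mult: "ideal_in V J \<Longrightarrow> p \<in> J \<Longrightarrow> Poly_Mapping.single 0 c * p \<in> J"
  by (rule ideal_in_mult) (simp_all add: pvars_single)

lemma ideal_in_uminus: "ideal_in V J \<Longrightarrow> p \<in> J \<Longrightarrow> - p \<in> J"
  using ideal_in_mult[of V J p "- 1"] pvars_uminus[OF pvars_one, of V] by simp

lemma ideal_in_diff: "ideal_in V J \<Longrightarrow> p \<in> J \<Longrightarrow> q \<in> J \<Longrightarrow> p - q \<in> J"
  using ideal_in_add[of V J p "- q"] ideal_in_uminus by fastforce

lemma ideal_in_sum: "ideal_in V J \<Longrightarrow> (\<And>x. x \<in> A \<Longrightarrow> f x \<in> J) \<Longrightarrow> sum f A \<in> J"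
  by (induction A rule: infinite_finite_induct) (auto simp: ideal_in_zero ideal_in_add)

lemma ideal_in_gen_ideal: "ideal_in V (gen_ideal V (G :: 'a::comm_ring_1 mpoly set))"
  unfolding ideal_in_def
proof (intro conjI ballI allI impI)
  show "0 \<in> gen_ideal V G"
    unfolding gen_ideal_def by (rule CollectI, rule exI[of _ "{}"]) auto
next
  fix p q assume "p \<in> gen_ideal V G" "q \<in> gen_ideal V G"
  then obtain F c F' c' where
    p: "finite F" "F \<subseteq> G" "\<forall>g\<in>F. pvars (c g) \<subseteq> V" "p = (\<Sum>g\<in>F. c g * g)" and
    q: "finite F'" "F' \<subseteq> G" "\<forall>g\<in>F'. pvars (c' g) \<subseteq> V" "q = (\<Sum>g\<in>F'. c' g * g)"
    unfolding gen_ideal_def by blast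
  let ?c = "\<lambda>g. (if g \<in> F then c g else 0) + (if g \<in> F' then c' g else 0)"
  have 1: "(\<Sum>g\<in>F \<union> F'. (if g \<in> F then c g else 0) * g) = p"
    using p(1) q(1) unfolding p(4) by (intro sum.mono_neutral_cong_right) auto
  have 2: "(\<Sum>g\<in>F \<union> F'. (if g \<in> F' then c' g else 0) * g) = q"
    using p(1) q(1) unfolding q(4) by (intro sum.mono_neutral_cong_right) auto
  have "p + q = (\<Sum>g\<in>F \<union> F'. ?c g * g)"
    by (simp only: distrib_right sum.distrib 1 2)
  moreover have "\<forall>g\<in>F \<union> F'. pvars (?c g) \<subseteq> V"
    using p(3) q(3) by (intro ballI pvars_add) (simp_all add: pvars_zero)
  ultimately show "p + q \<in> gen_ideal V G"
    using p(1,2) q(1,2) unfolding gen_ideal_def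
    by (intro CollectI exI[of _ "F \<union> F'"] exI[of _ ?c]) auto
next
  fix p c :: "'a mpoly" assume "p \<in> gen_ideal V G" and c: "pvars c \<subseteq> V"
  then obtain F d where
    p: "finite F" "F \<subseteq> G" "\<forall>g\<in>F. pvars (d g) \<subseteq> V" "p = (\<Sum>g\<in>F. d g * g)"
    unfolding gen_ideal_def by blast
  have "c * p = (\<Sum>g\<in>F. (c * d g) * g)"
    by (simp add: p(4) sum_distrib_left mult.assoc)
  moreover have "\<forall>g\<in>F. pvars (c * d g) \<subseteq> V"
    using p(3) c by (intro ballI pvars_mult) simp_all
  ultimately show "c * p \<in> gen_ideal V G"
    using p(1,2) unfolding gen_ideal_def by (intro CollectI exI[of _ F] exI[of _ "\<lambda>g. c * d g"]) auto
qed

lemma gen_ideal_contains: "g \<in> G \<Longrightarrow> g \<in> gen_ideal V G"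
  unfolding gen_ideal_def
  by (rule CollectI, rule exI[of _ "{g}"], rule exI[of _ "\<lambda>_. 1"]) (auto simp: pvars_def)

lemma gen_ideal_least: "ideal_in V J \<Longrightarrow> G \<subseteq> J \<Longrightarrow> gen_ideal V G \<subseteq> J"
  unfolding gen_ideal_def by (auto intro!: ideal_in_sum[of V J] ideal_in_mult[of V J])

lemma polynomial_split_variable:
  fixes p :: "'a::comm_ring_1 mpoly"
  assumes "pvars p \<subseteq> insert v V"
  obtains p' h where "pvars p' \<subseteq> V" "pvars h \<subseteq> insert v V" "p = p' + var v * h"
proof -
  have "\<exists>p' h. pvars p' \<subseteq> V \<and> pvars h \<subseteq> insert v V \<and> p = p' + var v * h"
  proof (induction p rule: poly_mapping_induct_single)
    case (single \<mu> c)
    have \<mu>: "Poly_Mapping.keys \<mu> \<subseteq> insert v V" using single assms by (auto simp: pvars_subset_iff)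
    show ?case
    proof (cases "Poly_Mapping.lookup \<mu> v = 0")
      case True
      then have "v \<notin> Poly_Mapping.keys \<mu>" by (simp add: in_keys_iff)
      then show ?thesis using \<mu>
        by (intro exI[of _ "Poly_Mapping.single \<mu> c"] exI[of _ 0]) (simp_all add: pvars_single pvars_zero subset_insert)
    next
      case False
      let ?\<nu> = "\<mu> - Poly_Mapping.single v 1"
      have "\<mu> = Poly_Mapping.single v 1 + ?\<nu>"
        using False by (intro poly_mapping_eqI) (auto simp: lookup_add lookup_minus lookup_single when_def)
      then have eq: "Poly_Mapping.single \<mu> c = var v * Poly_Mapping.single ?\<nu> c"
        by (metis mult_1 mult_single var_def)
      have "Poly_Mapping.keys ?\<nu> \<subseteq> Poly_Mapping.keys \<mu>"
        by (auto simp: in_keys_iff lookup_minus)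
      then show ?thesis using \<mu> eq
        by (intro exI[of _ 0] exI[of _ "Poly_Mapping.single ?\<nu> c"]) (simp_all add: pvars_single pvars_zero subset_insert)
    qed
  next
    case zero
    show ?case by (intro exI[of _ 0]) (simp add: pvars_zero)
  next
    case (add p q)
    then obtain p' h q' h' where "pvars p' \<subseteq> V" "pvars h \<subseteq> insert v V" "p = p' + var v * h"
      "pvars q' \<subseteq> V" "pvars h' \<subseteq> insert v V" "q = q' + var v * h'" by blast
    then show ?case
      by (intro exI[of _ "p' + q'"] exI[of _ "h + h'"]) (simp_all add: algebra_simps pvars_add)
  qed
  then show ?thesis using that by blast
qed

text \<open>Modulo \<open>J\<close> the variable \<open>v\<close> equals \<open>l\<close>, so its
  occurrences in a monomial can be replaced one at a time; the induction runs on the exponent of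
  \<open>v\<close>.\<close>

lemma eliminate_variable:
  fixes p :: "'a::comm_ring_1 mpoly"
  assumes J: "ideal_in (insert v V) J" and l: "pvars l \<subseteq> V" "var v - l \<in> J"
    and p: "pvars p \<subseteq> insert v V"
  shows "\<exists>p'. pvars p' \<subseteq> V \<and> p - p' \<in> J"
proof (induction p rule: poly_mapping_induct_single)
  case (single \<mu> c)
  have "\<exists>p'. pvars p' \<subseteq> V \<and> Poly_Mapping.single \<mu> c - p' \<in> J"
    if "Poly_Mapping.keys \<mu> \<subseteq> insert v V" "Poly_Mapping.lookup \<mu> v = d" for \<mu> d
    using that
  proof (induction d arbitrary: \<mu>)
    case 0
    then have "v \<notin> Poly_Mapping.keys \<mu>" by (simp add: in_keys_iff)
    then show ?case using 0 J
      by (intro exI[of _ "Poly_Mapping.single \<mu> c"]) (simp_all add: pvars_single ideal_in_zero subset_insert)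
  next
    case (Suc d)
    let ?\<nu> = "\<mu> - Poly_Mapping.single v 1"
    have "\<mu> = Poly_Mapping.single v 1 + ?\<nu>"
      using Suc.prems by (intro poly_mapping_eqI) (auto simp: lookup_add lookup_minus lookup_single when_def)
    then have eq: "Poly_Mapping.single \<mu> c = var v * Poly_Mapping.single ?\<nu> c"
      by (metis mult_1 mult_single var_def)
    have "Poly_Mapping.keys ?\<nu> \<subseteq> Poly_Mapping.keys \<mu>"
      by (auto simp: in_keys_iff lookup_minus)
    then have \<nu>: "Poly_Mapping.keys ?\<nu> \<subseteq> insert v V" using Suc.prems by blast
    moreover have "Poly_Mapping.lookup ?\<nu> v = d" using Suc.prems by (simp add: lookup_minus)
    ultimately obtain q where q: "pvars q \<subseteq> V" "Poly_Mapping.single ?\<nu> c - q \<in> J"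
      using Suc.IH by blast
    \<comment> \<open>With m the monomial divided by \<open>v\<close>, and \<open>q\<close> its
      reduction, v*m - l*q = (v - l)*m + l*(m - q), and both summands lie in
      \<open>J\<close>.\<close>
    have "(var v - l) * Poly_Mapping.single ?\<nu> c + l * (Poly_Mapping.single ?\<nu> c - q) \<in> J"
      using ideal_in_mult_right[OF J l(2) pvars_single[OF \<nu>]] ideal_in_mult[OF J q(2) subset_insertI2[OF l(1)]]
      by (rule ideal_in_add[OF J])
    also have "(var v - l) * Poly_Mapping.single ?\<nu> c + l * (Poly_Mapping.single ?\<nu> c - q)
      = Poly_Mapping.single \<mu> c - l * q" unfolding eq by (simp add: algebra_simps)
    finally show ?case using pvars_mult[OF l(1) q(1)] by blast
  qed
  then show ?case using single p by (auto simp: pvars_subset_iff)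
next
  case zero
  show ?case by (intro exI[of _ 0]) (simp add: pvars_zero ideal_in_zero[OF J])
next
  case (add p q)
  then obtain p' q' where "pvars p' \<subseteq> V" "p - p' \<in> J" "pvars q' \<subseteq> V" "q - q' \<in> J" by blast
  then show ?case
    using ideal_in_add[OF J, of "p - p'" "q - q'"]
    by (intro exI[of _ "p' + q'"]) (simp_all add: algebra_simps pvars_add)
qed

subsection \<open>Spanning sets modulo an ideal\<close>

text \<open>Scalars appear as constant polynomials \<open>single 0 c\<close>. The set
  \<open>S\<close> is meant to be finite, since a sum over an infinite set is 0.\<close>

definition spans_mod :: "nat set \<Rightarrow> 'a::comm_ring_1 mpoly set \<Rightarrow> 'a mpoly set \<Rightarrow> bool" where
  "spans_mod V S J \<longleftrightarrow>
     (\<forall>p. pvars p \<subseteq> V \<longrightarrow> (\<exists>c. p - (\<Sum>s\<in>S. Poly_Mapping.single 0 (c s) * s) \<in> J))"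

lemma const_combination_Un:
  fixes S T :: "'a::comm_ring_1 mpoly set"
  assumes "finite S" "finite T"
  shows "\<exists>e. (\<Sum>s\<in>S. Poly_Mapping.single 0 (c s) * s) + (\<Sum>s\<in>T. Poly_Mapping.single 0 (d s) * s)
     = (\<Sum>s\<in>S \<union> T. Poly_Mapping.single 0 (e s) * s)"
proof -
  let ?e1 = "\<lambda>s. if s \<in> S then c s else 0" and ?e2 = "\<lambda>s. if s \<in> T then d s else 0"
  have 1: "(\<Sum>s\<in>S \<union> T. Poly_Mapping.single 0 (?e1 s) * s) = (\<Sum>s\<in>S. Poly_Mapping.single 0 (c s) * s)"
    using assms by (intro sum.mono_neutral_cong_right) auto
  have 2: "(\<Sum>s\<in>S \<union> T. Poly_Mapping.single 0 (?e2 s) * s) = (\<Sum>s\<in>T. Poly_Mapping.single 0 (d s) * s)"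
    using assms by (intro sum.mono_neutral_cong_right) auto
  show ?thesis
    by (rule exI[of _ "\<lambda>s. ?e1 s + ?e2 s"])
      (simp only: single_add distrib_right sum.distrib 1 2)
qed

text \<open>Multiplication by \<open>y\<close> may identify elements of \<open>S\<close>, so the
  coefficients over each fibre have to be added.\<close>

lemma const_combination_image:
  fixes S :: "'a::comm_ring_1 mpoly set"
  assumes "finite S"
  shows "\<exists>e. y * (\<Sum>s\<in>S. Poly_Mapping.single 0 (c s) * s) = (\<Sum>s\<in>(*) y ` S. Poly_Mapping.single 0 (e s) * s)"
proof -
  let ?e = "\<lambda>t. \<Sum>s\<in>{s\<in>S. y * s = t}. c s"
  have "y * (\<Sum>s\<in>S. Poly_Mapping.single 0 (c s) * s) = (\<Sum>s\<in>S. Poly_Mapping.single 0 (c s) * (y * s))"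
    by (simp add: sum_distrib_left mult.left_commute)
  also have "\<dots> = (\<Sum>t\<in>(*) y ` S. \<Sum>s\<in>{s\<in>S. y * s = t}. Poly_Mapping.single 0 (c s) * (y * s))"
    using assms by (rule sum.image_gen)
  also have "\<dots> = (\<Sum>t\<in>(*) y ` S. Poly_Mapping.single 0 (?e t) * t)"
    by (rule sum.cong) (auto simp: single_sum sum_distrib_right)
  finally show ?thesis by (rule exI[of _ ?e])
qed

text \<open>The deletion--contraction step: \<open>J\<^sub>1\<close> plays the role of the ideal of the deletion and
  \<open>J\<^sub>2\<close> that of the contraction, so that \<open>k[V]/J\<^sub>2 \<rightarrow> k[insert v V]/J \<rightarrow> k[V]/J\<^sub>1 \<rightarrow> 0\<close> is right exact.\<close>

lemma spans_mod_extension: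
  fixes J :: "'a::comm_ring_1 mpoly set"
  assumes J: "ideal_in (insert v V) J" and y: "pvars y \<subseteq> insert v V"
    and l: "pvars l \<subseteq> V" "var v - l \<in> J"
    and J1: "\<And>p. p \<in> J1 \<Longrightarrow> \<exists>h. pvars h \<subseteq> insert v V \<and> p - y * h \<in> J"
    and J2: "\<And>p. p \<in> J2 \<Longrightarrow> y * p \<in> J"
    and S1: "finite S1" "spans_mod V S1 J1" and S2: "finite S2" "spans_mod V S2 J2"
  shows "spans_mod (insert v V) (S1 \<union> (*) y ` S2) J"
  unfolding spans_mod_def
proof (intro allI impI)
  fix p :: "'a mpoly" assume p: "pvars p \<subseteq> insert v V"
  obtain p1 where p1: "pvars p1 \<subseteq> V" "p - p1 \<in> J"
    using eliminate_variable[OF J l p] by blast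
  obtain c where c: "p1 - (\<Sum>s\<in>S1. Poly_Mapping.single 0 (c s) * s) \<in> J1"
    using S1 p1 unfolding spans_mod_def by blast
  obtain h where h: "pvars h \<subseteq> insert v V" "p1 - (\<Sum>s\<in>S1. Poly_Mapping.single 0 (c s) * s) - y * h \<in> J"
    using J1[OF c] by blast
  obtain h1 where h1: "pvars h1 \<subseteq> V" "h - h1 \<in> J"
    using eliminate_variable[OF J l h(1)] by blast
  obtain d where d: "h1 - (\<Sum>s\<in>S2. Poly_Mapping.single 0 (d s) * s) \<in> J2"
    using S2 h1 unfolding spans_mod_def by blast
  obtain d' where d': "y * (\<Sum>s\<in>S2. Poly_Mapping.single 0 (d s) * s)
      = (\<Sum>s\<in>(*) y ` S2. Poly_Mapping.single 0 (d' s) * s)"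
    using const_combination_image[OF S2(1)] by blast
  obtain e where e: "(\<Sum>s\<in>S1. Poly_Mapping.single 0 (c s) * s) + (\<Sum>s\<in>(*) y ` S2. Poly_Mapping.single 0 (d' s) * s)
      = (\<Sum>s\<in>S1 \<union> (*) y ` S2. Poly_Mapping.single 0 (e s) * s)"
    using const_combination_Un[OF S1(1) finite_imageI[OF S2(1)]] by blast
  \<comment> \<open>The telescoping sum retraces the reductions: eliminate \<open>v\<close> from
    \<open>p\<close>, reduce with \<open>S1\<close> up to a multiple \<open>y * h\<close>, eliminate
    \<open>v\<close> from \<open>h\<close>, reduce with \<open>S2\<close>.\<close>
  have "(p - p1) + (p1 - (\<Sum>s\<in>S1. Poly_Mapping.single 0 (c s) * s) - y * h)
      + y * (h - h1) + y * (h1 - (\<Sum>s\<in>S2. Poly_Mapping.single 0 (d s) * s)) \<in> J"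
    using p1(2) h(2) ideal_in_mult[OF J h1(2) y] J2[OF d] by (intro ideal_in_add[OF J])
  also have "(p - p1) + (p1 - (\<Sum>s\<in>S1. Poly_Mapping.single 0 (c s) * s) - y * h)
      + y * (h - h1) + y * (h1 - (\<Sum>s\<in>S2. Poly_Mapping.single 0 (d s) * s))
      = p - ((\<Sum>s\<in>S1. Poly_Mapping.single 0 (c s) * s) + y * (\<Sum>s\<in>S2. Poly_Mapping.single 0 (d s) * s))"
    by (simp add: algebra_simps)
  finally show "\<exists>e. p - (\<Sum>s\<in>S1 \<union> (*) y ` S2. Poly_Mapping.single 0 (e s) * s) \<in> J"
    unfolding d' e by blast
qed

text \<open>A homogeneous system with more unknowns than equations, over a domain: it is applied
  once to field coefficients and once to polynomial coefficients, so the elimination avoids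
  division.\<close>

lemma homogeneous_system_nontrivial:
  fixes c :: "'b \<Rightarrow> 'c \<Rightarrow> 'r::idom"
  assumes "finite S" "finite A" "card S < card A"
  shows "\<exists>a. (\<exists>x\<in>A. a x \<noteq> 0) \<and> (\<forall>s\<in>S. (\<Sum>x\<in>A. a x * c x s) = 0)"
  using assms
proof (induction S arbitrary: A c rule: finite_induct)
  case empty
  then show ?case by (intro exI[of _ "\<lambda>_. 1"]) (auto simp: card_gt_0_iff)
next
  case (insert s0 S)
  show ?case
  proof (cases "\<forall>x\<in>A. c x s0 = 0")
    case True
    have "card S < card A" using insert by auto
    from insert.IH[OF insert.prems(1) this] True show ?thesis by auto
  next
    case False
    then obtain x0 where x0: "x0 \<in> A" "c x0 s0 \<noteq> 0" by blast
    define A' where "A' = A - {x0}"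
    have A': "finite A'" "x0 \<notin> A'" "A = insert x0 A'" using x0 insert.prems by (auto simp: A'_def)
    then have "card S < card A'" using insert by simp
    \<comment> \<open>Cross-multiplication with the pivot \<open>c x0 s0\<close> eliminates the
      unknown \<open>x0\<close>. The new coefficients vanish identically at \<open>s = s0\<close>,
      so that equation is satisfied too.\<close>
    from insert.IH[OF A'(1) this, of "\<lambda>x s. c x0 s0 * c x s - c x s0 * c x0 s"]
    obtain b x1 where b: "x1 \<in> A'" "b x1 \<noteq> 0"
      "\<And>s. s \<in> S \<Longrightarrow> (\<Sum>x\<in>A'. b x * (c x0 s0 * c x s - c x s0 * c x0 s)) = 0" by blast
    define a where "a x = (if x = x0 then - (\<Sum>x\<in>A'. b x * c x s0) else b x * c x0 s0)" for x
    have a: "(\<Sum>x\<in>A. a x * c x s) = (\<Sum>x\<in>A'. b x * (c x0 s0 * c x s - c x s0 * c x0 s))" for s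
    proof -
      have "(\<Sum>x\<in>A. a x * c x s) = a x0 * c x0 s + (\<Sum>x\<in>A'. a x * c x s)"
        using A' by simp
      also have "(\<Sum>x\<in>A'. a x * c x s) = (\<Sum>x\<in>A'. b x * c x0 s0 * c x s)"
        using A'(2) by (intro sum.cong) (auto simp: a_def)
      also have "a x0 * c x0 s = - (\<Sum>x\<in>A'. b x * c x s0 * c x0 s)"
        by (simp add: a_def sum_distrib_right)
      finally show ?thesis by (simp add: sum_subtractf algebra_simps)
    qed
    have "a x1 \<noteq> 0" using b A'(2) x0 by (auto simp: a_def)
    moreover have "(\<Sum>x\<in>A. a x * c x s) = 0" if "s \<in> insert s0 S" for s
      using that b(3) unfolding a by (auto simp: mult.commute)
    ultimately show ?thesis using b(1) A'(3) by blast
  qed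
qed

text \<open>Write \<open>card S + 1\<close> monomials of \<open>L\<close> in terms of
  \<open>S\<close> modulo \<open>J\<close>. A nontrivial solution of the homogeneous system given by
  their coordinates is a nonzero polynomial supported on \<open>L\<close> that lies in
  \<open>J\<close>.\<close>

lemma card_independent_le_spanning:
  fixes J :: "'a::field mpoly set"
  assumes J: "ideal_in V J" and S: "finite S" "spans_mod V S J"
    and L: "\<And>\<mu>. \<mu> \<in> L \<Longrightarrow> Poly_Mapping.keys \<mu> \<subseteq> V"
    and indep: "\<And>q. Poly_Mapping.keys q \<subseteq> L \<Longrightarrow> q \<in> J \<Longrightarrow> q = 0"
  shows "finite L \<and> card L \<le> card S"
proof (rule ccontr)
  assume "\<not> (finite L \<and> card L \<le> card S)"
  then obtain A where A: "A \<subseteq> L" "finite A" "card A = Suc (card S)"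
    by (metis infinite_arbitrarily_large not_less_eq_eq obtain_subset_with_card_n)
  have "\<forall>\<mu>\<in>A. \<exists>c. mono \<mu> - (\<Sum>s\<in>S. Poly_Mapping.single 0 (c s) * s) \<in> J"
    using S(2) A(1) L unfolding spans_mod_def by (auto simp: pvars_mono_iff)
  from bchoice[OF this] obtain c where
    c: "\<And>\<mu>. \<mu> \<in> A \<Longrightarrow> mono \<mu> - (\<Sum>s\<in>S. Poly_Mapping.single 0 (c \<mu> s) * s) \<in> J"
    by blast
  obtain a \<mu>0 where a: "\<mu>0 \<in> A" "a \<mu>0 \<noteq> 0" "\<And>s. s \<in> S \<Longrightarrow> (\<Sum>\<mu>\<in>A. a \<mu> * c \<mu> s) = 0"
    using homogeneous_system_nontrivial[OF S(1) A(2), of c] A(3) by auto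
  define q where "q = (\<Sum>\<mu>\<in>A. Poly_Mapping.single \<mu> (a \<mu>))"
  have lookup_q: "Poly_Mapping.lookup q \<mu> = (if \<mu> \<in> A then a \<mu> else 0)" for \<mu>
    using A(2) by (auto simp: q_def lookup_sum lookup_single when_def sum.delta' cong: if_cong)
  have "(\<Sum>\<mu>\<in>A. Poly_Mapping.single 0 (a \<mu>) * (\<Sum>s\<in>S. Poly_Mapping.single 0 (c \<mu> s) * s))
      = (\<Sum>\<mu>\<in>A. \<Sum>s\<in>S. Poly_Mapping.single 0 (a \<mu> * c \<mu> s) * s)"
    by (simp add: sum_distrib_left mult_single mult.assoc[symmetric])
  also have "\<dots> = (\<Sum>s\<in>S. \<Sum>\<mu>\<in>A. Poly_Mapping.single 0 (a \<mu> * c \<mu> s) * s)"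
    by (rule sum.swap)
  also have "\<dots> = (\<Sum>s\<in>S. Poly_Mapping.single 0 (\<Sum>\<mu>\<in>A. a \<mu> * c \<mu> s) * s)"
    by (simp add: single_sum sum_distrib_right)
  also have "\<dots> = 0" by (simp add: a(3))
  finally have 0: "(\<Sum>\<mu>\<in>A. Poly_Mapping.single 0 (a \<mu>) * (\<Sum>s\<in>S. Poly_Mapping.single 0 (c \<mu> s) * s)) = 0" .
  have "(\<Sum>\<mu>\<in>A. Poly_Mapping.single 0 (a \<mu>) * (mono \<mu> - (\<Sum>s\<in>S. Poly_Mapping.single 0 (c \<mu> s) * s))) \<in> J"
    using c by (intro ideal_in_sum[OF J] ideal_in_const_mult[OF J])
  also have "(\<Sum>\<mu>\<in>A. Poly_Mapping.single 0 (a \<mu>) * (mono \<mu> - (\<Sum>s\<in>S. Poly_Mapping.single 0 (c \<mu> s) * s))) = q"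
    by (simp add: right_diff_distrib sum_subtractf 0 q_def single_eq_const_mult_mono[symmetric])
  finally have "q \<in> J" .
  moreover have "Poly_Mapping.keys q \<subseteq> L" using A(1) by (auto simp: in_keys_iff lookup_q split: if_splits)
  ultimately have "q = 0" using indep by blast
  then show False using lookup_q[of \<mu>0] a by simp
qed

text \<open>Connects \<open>spans_mod\<close> with the form in which \<open>NBC_basis_wrt\<close>
  expresses spanning, by a polynomial whose exponents lie in \<open>L\<close>.\<close>

lemma spans_mod_monomials_iff:
  fixes J :: "'a::comm_ring_1 mpoly set"
  assumes L: "finite L"
  shows "spans_mod V (mono ` L) J \<longleftrightarrow>
    (\<forall>p. pvars p \<subseteq> V \<longrightarrow> (\<exists>q. Poly_Mapping.keys q \<subseteq> L \<and> p - q \<in> J))"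
proof -
  have inj: "inj_on (mono :: _ \<Rightarrow> 'a mpoly) L"
  proof (rule inj_onI)
    fix \<mu> \<nu> assume "mono \<mu> = (mono \<nu> :: 'a mpoly)"
    then have "Poly_Mapping.keys (mono \<mu> :: 'a mpoly) = Poly_Mapping.keys (mono \<nu> :: 'a mpoly)" by simp
    then show "\<mu> = \<nu>" by (simp add: mono_def)
  qed
  have sum_eq: "(\<Sum>s\<in>mono ` L. Poly_Mapping.single 0 (c s) * s) = (\<Sum>\<mu>\<in>L. Poly_Mapping.single \<mu> (c (mono \<mu>)))"
    for c :: "'a mpoly \<Rightarrow> 'a"
    by (simp add: sum.reindex[OF inj] single_eq_const_mult_mono[symmetric])
  have lookup_sum_eq: "Poly_Mapping.lookup (\<Sum>\<mu>\<in>L. Poly_Mapping.single \<mu> (f \<mu>)) \<nu> = (if \<nu> \<in> L then f \<nu> else 0)"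
    for f :: "_ \<Rightarrow> 'a" and \<nu>
    unfolding lookup_sum lookup_single when_def using L by simp
  show ?thesis
  proof
    assume "spans_mod V (mono ` L) J"
    then have *: "\<forall>p. pvars p \<subseteq> V \<longrightarrow> (\<exists>c. p - (\<Sum>\<mu>\<in>L. Poly_Mapping.single \<mu> (c (mono \<mu> :: 'a mpoly))) \<in> J)"
      unfolding spans_mod_def sum_eq .
    show "\<forall>p. pvars p \<subseteq> V \<longrightarrow> (\<exists>q. Poly_Mapping.keys q \<subseteq> L \<and> p - q \<in> J)"
    proof (intro allI impI)
      fix p :: "'a mpoly" assume "pvars p \<subseteq> V"
      from *[rule_format, OF this]
      obtain c where c: "p - (\<Sum>\<mu>\<in>L. Poly_Mapping.single \<mu> (c (mono \<mu> :: 'a mpoly))) \<in> J" by (elim exE)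
      have "Poly_Mapping.keys (\<Sum>\<mu>\<in>L. Poly_Mapping.single \<mu> (c (mono \<mu>))) \<subseteq> L"
        by (auto simp: in_keys_iff lookup_sum_eq split: if_splits)
      then show "\<exists>q. Poly_Mapping.keys q \<subseteq> L \<and> p - q \<in> J" using c by blast
    qed
  next
    assume *: "\<forall>p. pvars p \<subseteq> V \<longrightarrow> (\<exists>q. Poly_Mapping.keys q \<subseteq> L \<and> p - q \<in> J)"
    show "spans_mod V (mono ` L) J" unfolding spans_mod_def sum_eq
    proof (intro allI impI)
      fix p :: "'a mpoly" assume "pvars p \<subseteq> V"
      then obtain q where q: "Poly_Mapping.keys q \<subseteq> L" "p - q \<in> J" using * by blast
      have "(\<Sum>\<mu>\<in>L. Poly_Mapping.single \<mu> (Poly_Mapping.lookup q (inv_into L mono (mono \<mu> :: 'a mpoly))))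
          = (\<Sum>\<mu>\<in>L. Poly_Mapping.single \<mu> (Poly_Mapping.lookup q \<mu>))"
        by (rule sum.cong) (simp_all add: inv_into_f_f[OF inj])
      also have "\<dots> = q"
      proof (rule poly_mapping_eqI)
        fix \<nu>
        show "Poly_Mapping.lookup (\<Sum>\<mu>\<in>L. Poly_Mapping.single \<mu> (Poly_Mapping.lookup q \<mu>)) \<nu> = Poly_Mapping.lookup q \<nu>"
          unfolding lookup_sum_eq using q(1) by (auto simp: in_keys_iff)
      qed
      finally show "\<exists>c. p - (\<Sum>\<mu>\<in>L. Poly_Mapping.single \<mu> (c (mono \<mu> :: 'a mpoly))) \<in> J"
        using q(2) by (intro exI[of _ "\<lambda>s. Poly_Mapping.lookup q (inv_into L mono s)"]) simp
    qed
  qed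
qed

text \<open>If a nonzero \<open>q\<close> in \<open>J\<close> is supported on \<open>L\<close>, a
  suitable multiple of \<open>q\<close> removes one fixed monomial of \<open>q\<close> from any
  representative, so \<open>L\<close> without it still spans. As this is again a set of monomials,
  minimality is required among sets of monomials only.\<close>

lemma minimal_spanning_monomials_independent:
  fixes J :: "'a::field mpoly set"
  assumes J: "ideal_in V J" and L: "finite L"
    and span: "\<And>p. pvars p \<subseteq> V \<Longrightarrow> \<exists>q. Poly_Mapping.keys q \<subseteq> L \<and> p - q \<in> J"
    and minimal: "\<And>K. finite K \<Longrightarrow> \<forall>p. pvars p \<subseteq> V \<longrightarrow> (\<exists>q. Poly_Mapping.keys q \<subseteq> K \<and> p - q \<in> J) \<Longrightarrow> card L \<le> card K"
    and q: "Poly_Mapping.keys q \<subseteq> L" "q \<in> J"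
  shows "q = 0"
proof (rule ccontr)
  assume "q \<noteq> 0"
  then obtain \<mu> where \<mu>: "\<mu> \<in> Poly_Mapping.keys q" by (metis ex_in_conv keys_eq_empty)
  then have \<mu>0: "Poly_Mapping.lookup q \<mu> \<noteq> 0" by (simp add: in_keys_iff)
  have "\<exists>r. Poly_Mapping.keys r \<subseteq> L - {\<mu>} \<and> p - r \<in> J" if p: "pvars p \<subseteq> V" for p
  proof -
    obtain r where r: "Poly_Mapping.keys r \<subseteq> L" "p - r \<in> J" using span[OF p] by blast
    define c where "c = Poly_Mapping.lookup r \<mu> / Poly_Mapping.lookup q \<mu>"
    define r' where "r' = r - Poly_Mapping.single 0 c * q"
    have lk: "Poly_Mapping.lookup r' \<nu> = Poly_Mapping.lookup r \<nu> - c * Poly_Mapping.lookup q \<nu>" for \<nu>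
    proof -
      have "Poly_Mapping.lookup (Poly_Mapping.single 0 c * q) \<nu> = c * Poly_Mapping.lookup q \<nu>"
        unfolding mult_map_scale_conv_mult[symmetric] by (simp add: map.rep_eq when_def)
      then show ?thesis by (simp add: r'_def lookup_minus)
    qed
    have "Poly_Mapping.keys r' \<subseteq> L - {\<mu>}"
    proof
      fix \<nu> assume "\<nu> \<in> Poly_Mapping.keys r'"
      then have nz: "Poly_Mapping.lookup r \<nu> - c * Poly_Mapping.lookup q \<nu> \<noteq> 0" by (simp add: in_keys_iff lk)
      then have "\<nu> \<noteq> \<mu>" using \<mu>0 by (auto simp: c_def)
      moreover have "\<nu> \<in> Poly_Mapping.keys r \<or> \<nu> \<in> Poly_Mapping.keys q"
        using nz by (auto simp: in_keys_iff)
      ultimately show "\<nu> \<in> L - {\<mu>}" using r(1) q(1) by blast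
    qed
    moreover have "p - r' = (p - r) + Poly_Mapping.single 0 c * q" by (simp add: r'_def)
    then have "p - r' \<in> J"
      by (simp only: ideal_in_add[OF J r(2) ideal_in_const_mult[OF J q(2)]])
    ultimately show ?thesis by blast
  qed
  then have "card L \<le> card (L - {\<mu>})" using L by (intro minimal) auto
  moreover have "card (L - {\<mu>}) < card L" using L \<mu> q(1) by (intro card_Diff1_less) auto
  ultimately show False by simp
qed

subsection \<open>Broken circuits of a represented matroid\<close>

text \<open>A subspace \<open>W\<close> of \<open>k\<^sup>E\<close> stands for the matroid in which \<open>X\<close> is independent iff
  the restriction \<open>W \<rightarrow> k\<^sup>X\<close> is surjective. In these terms deleting \<open>v\<close> means shrinking \<open>E\<close>, and
  contracting \<open>v\<close> means passing to \<open>{w \<in> W. w v = 0}\<close>.\<close>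

definition fun_subspace :: "(nat \<Rightarrow> 'a::field) set \<Rightarrow> bool" where
  "fun_subspace W \<longleftrightarrow> (\<lambda>_. 0) \<in> W \<and> (\<forall>u\<in>W. \<forall>w\<in>W. (\<lambda>i. u i + w i) \<in> W) \<and>
     (\<forall>c. \<forall>w\<in>W. (\<lambda>i. c * w i) \<in> W)"

definition indep_on :: "(nat \<Rightarrow> 'a::field) set \<Rightarrow> nat set \<Rightarrow> bool" where
  "indep_on W X \<longleftrightarrow> (\<forall>x\<in>X. \<exists>w\<in>W. w x = 1 \<and> (\<forall>y\<in>X - {x}. w y = 0))"

text \<open>\<open>X\<close> contains a broken circuit iff some \<open>i\<close> together with the elements of \<open>X\<close> above \<open>i\<close> is
  dependent, so circuits need not be mentioned.\<close>

definition nbc :: "nat set \<Rightarrow> (nat \<Rightarrow> 'a::field) set \<Rightarrow> nat set \<Rightarrow> bool" where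
  "nbc E W X \<longleftrightarrow> (\<forall>i\<in>E. indep_on W (insert i {j\<in>X. i < j}))"

text \<open>The last condition says that \<open>X\<close> spans \<open>E\<close>. Vectors of
  \<open>W\<close> may be nonzero outside \<open>E\<close>, since deletion keeps \<open>W\<close>
  and shrinks \<open>E\<close>; hence vanishing is tested on \<open>E\<close> only. Independence of
  \<open>X\<close> is part of \<open>nbc\<close> (see \<open>nbc_imp_indep_on\<close>).\<close>

definition nbc_bases :: "nat set \<Rightarrow> (nat \<Rightarrow> 'a::field) set \<Rightarrow> nat set set" where
  "nbc_bases E W = {X. X \<subseteq> E \<and> nbc E W X \<and>
     (\<forall>w\<in>W. (\<forall>x\<in>X. w x = 0) \<longrightarrow> (\<forall>x\<in>E. w x = 0))}"

definition linear_form :: "nat set \<Rightarrow> (nat \<Rightarrow> 'a::comm_ring_1) \<Rightarrow> 'a mpoly" where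
  "linear_form E w = (\<Sum>i\<in>E. Poly_Mapping.single (Poly_Mapping.single i 1) (w i))"

definition squarefree_exp :: "nat set \<Rightarrow> (nat \<Rightarrow>\<^sub>0 nat)" where
  "squarefree_exp X = (\<Sum>i\<in>X. Poly_Mapping.single i 1)"

lemma fun_subspace_zero: "fun_subspace W \<Longrightarrow> (\<lambda>_. 0) \<in> W"
  and fun_subspace_add: "fun_subspace W \<Longrightarrow> u \<in> W \<Longrightarrow> w \<in> W \<Longrightarrow> (\<lambda>i. u i + w i) \<in> W"
  and fun_subspace_scale: "fun_subspace W \<Longrightarrow> w \<in> W \<Longrightarrow> (\<lambda>i. c * w i) \<in> W"
  by (simp_all add: fun_subspace_def)

lemma fun_subspace_diff:
  "fun_subspace W \<Longrightarrow> u \<in> W \<Longrightarrow> w \<in> W \<Longrightarrow> (\<lambda>i. u i - c * w i) \<in> W"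
  using fun_subspace_add[OF _ _ fun_subspace_scale, of W u w "- c"] by simp

lemma fun_subspace_sum:
  assumes "fun_subspace W" "finite A" "\<And>x. x \<in> A \<Longrightarrow> u x \<in> W"
  shows "(\<lambda>i. \<Sum>x\<in>A. c x * u x i) \<in> W"
  using assms(2,3)
proof (induction A rule: finite_induct)
  case empty
  then show ?case using fun_subspace_zero[OF assms(1)] by simp
next
  case (insert a A)
  then have "(\<lambda>i. c a * u a i + (\<Sum>x\<in>A. c x * u x i)) \<in> W"
    by (intro fun_subspace_add[OF assms(1)] fun_subspace_scale[OF assms(1)]) auto
  then show ?case using insert by simp
qed

lemma lookup_squarefree_exp:
  "finite X \<Longrightarrow> Poly_Mapping.lookup (squarefree_exp X) i = (if i \<in> X then 1 else 0)"
  by (auto simp: squarefree_exp_def lookup_sum lookup_single when_def sum.delta' cong: if_cong)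

lemma keys_squarefree_exp: "finite X \<Longrightarrow> Poly_Mapping.keys (squarefree_exp X) = X"
  by (auto simp: in_keys_iff lookup_squarefree_exp split: if_splits)

lemma squarefree_exp_insert:
  "finite X \<Longrightarrow> v \<notin> X \<Longrightarrow> squarefree_exp (insert v X) = Poly_Mapping.single v 1 + squarefree_exp X"
  by (simp add: squarefree_exp_def)

lemma mono_squarefree_insert:
  assumes "finite X" "v \<notin> X"
  shows "mono (squarefree_exp (insert v X)) = var v * (mono (squarefree_exp X) :: 'a::comm_ring_1 mpoly)"
  unfolding squarefree_exp_insert[OF assms] mono_add mono_single ..

lemma single_single_eq: "Poly_Mapping.single (Poly_Mapping.single i 1) c = Poly_Mapping.single 0 c * (var i :: 'a::comm_ring_1 mpoly)"
  unfolding var_def mult_single by simp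

lemma linear_form_insert:
  assumes "finite E" "v \<notin> E"
  shows "linear_form (insert v E) w = Poly_Mapping.single 0 (w v) * var v + linear_form E w"
  unfolding linear_form_def sum.insert[OF assms] single_single_eq[of v] ..

lemma pvars_linear_form: "E \<subseteq> V \<Longrightarrow> pvars (linear_form E w) \<subseteq> V"
  unfolding linear_form_def by (intro pvars_sum pvars_single) auto

lemma linear_form_combination:
  "linear_form E (\<lambda>j. \<Sum>i\<in>A. c i * u i j) = (\<Sum>i\<in>A. Poly_Mapping.single 0 (c i) * linear_form E (u i))"
proof -
  have "(\<Sum>i\<in>A. Poly_Mapping.single 0 (c i) * linear_form E (u i))
      = (\<Sum>i\<in>A. \<Sum>j\<in>E. Poly_Mapping.single (Poly_Mapping.single j 1) (c i * u i j))"
    unfolding linear_form_def sum_distrib_left by (simp add: mult_single)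
  also have "\<dots> = (\<Sum>j\<in>E. \<Sum>i\<in>A. Poly_Mapping.single (Poly_Mapping.single j 1) (c i * u i j))"
    by (rule sum.swap)
  finally show ?thesis by (simp add: linear_form_def single_sum)
qed

lemma linear_form_cong: "(\<And>i. i \<in> E \<Longrightarrow> u i = w i) \<Longrightarrow> linear_form E u = linear_form E w"
  unfolding linear_form_def by (rule sum.cong) simp_all

lemma indep_on_subset: "indep_on W X \<Longrightarrow> Y \<subseteq> X \<Longrightarrow> indep_on W Y"
  unfolding indep_on_def
proof
  fix x assume *: "\<forall>x\<in>X. \<exists>w\<in>W. w x = 1 \<and> (\<forall>y\<in>X - {x}. w y = 0)" "Y \<subseteq> X" "x \<in> Y"
  then obtain w where "w \<in> W" "w x = 1" "\<forall>y\<in>X - {x}. w y = 0" by blast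
  then show "\<exists>w\<in>W. w x = 1 \<and> (\<forall>y\<in>Y - {x}. w y = 0)"
    using *(2) by (intro bexI[of _ w]) auto
qed

lemma indep_on_contract:
  assumes "indep_on W (insert v X)" "v \<notin> X"
  shows "indep_on {w\<in>W. w v = 0} X"
  unfolding indep_on_def
proof
  fix x assume x: "x \<in> X"
  then obtain w where "w \<in> W" "w x = 1" "\<forall>y\<in>insert v X - {x}. w y = 0"
    using assms(1) unfolding indep_on_def by blast
  then show "\<exists>w\<in>{w\<in>W. w v = 0}. w x = 1 \<and> (\<forall>y\<in>X - {x}. w y = 0)"
    using assms(2) x by (intro bexI[of _ w]) auto
qed

lemma indep_on_uncontract:
  assumes W: "fun_subspace W" and X: "finite X" "v \<notin> X" "indep_on {w\<in>W. w v = 0} X"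
    and w0: "w0 \<in> W" "w0 v = 1"
  shows "indep_on W (insert v X)"
  unfolding indep_on_def
proof
  fix x assume "x \<in> insert v X"
  have "\<forall>x\<in>X. \<exists>w. w \<in> W \<and> w v = 0 \<and> w x = 1 \<and> (\<forall>y\<in>X - {x}. w y = 0)"
    using X(3) unfolding indep_on_def by blast
  from bchoice[OF this] obtain u where
    u: "\<And>x. x \<in> X \<Longrightarrow> u x \<in> W" "\<And>x. x \<in> X \<Longrightarrow> u x v = 0" "\<And>x. x \<in> X \<Longrightarrow> u x x = 1"
      "\<And>x y. x \<in> X \<Longrightarrow> y \<in> X \<Longrightarrow> y \<noteq> x \<Longrightarrow> u x y = 0"
    by blast
  show "\<exists>w\<in>W. w x = 1 \<and> (\<forall>y\<in>insert v X - {x}. w y = 0)"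
  proof (cases "x = v")
    case False
    then have "x \<in> X" using \<open>x \<in> insert v X\<close> by auto
    then show ?thesis using u(1-3) u(4)[OF \<open>x \<in> X\<close>] by (intro bexI[of _ "u x"]) auto
  next
    case True
    \<comment> \<open>The dual vector at \<open>v\<close>: remove from \<open>w0\<close> its
      coordinates on \<open>X\<close>. All \<open>u y\<close> vanish at \<open>v\<close>, so the
      value 1 at \<open>v\<close> survives.\<close>
    let ?w = "\<lambda>i. w0 i - 1 * (\<Sum>y\<in>X. w0 y * u y i)"
    have "?w \<in> W" using fun_subspace_sum[OF W X(1), of u w0] u(1) by (intro fun_subspace_diff[OF W w0(1)]) auto
    moreover have "?w v = 1" using u(2) w0 by simp
    moreover have "?w y = 0" if "y \<in> X" for y
    proof -
      have "(\<Sum>z\<in>X. w0 z * u z y) = (\<Sum>z\<in>X. if z = y then w0 y else 0)"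
        using u(3,4) that by (intro sum.cong) auto
      then show ?thesis using that X(1) by simp
    qed
    ultimately show ?thesis using True X(2) by (intro bexI[of _ ?w]) auto
  qed
qed

lemma nbc_bases_finite: "finite E \<Longrightarrow> finite (nbc_bases E W)"
  by (rule finite_subset[of _ "Pow E"]) (auto simp: nbc_bases_def)

lemma inj_on_insert_nbc_bases: "v \<notin> E \<Longrightarrow> inj_on (insert v) (nbc_bases E W)"
proof (rule inj_onI)
  fix X Y assume v: "v \<notin> E" and XY: "X \<in> nbc_bases E W" "Y \<in> nbc_bases E W" "insert v X = insert v Y"
  then have "X \<subseteq> E" "Y \<subseteq> E" by (simp_all add: nbc_bases_def)
  then have "v \<notin> X" "v \<notin> Y" using v by auto
  then show "X = Y" using XY(3) by (simp add: insert_ident)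
qed

lemma nbc_above_insert:
  assumes "i \<in> E" "\<forall>x\<in>E. x < (v::nat)"
  shows "insert i {j\<in>insert v X. i < j} = insert v (insert i {j\<in>X. i < j})"
  using assms by auto

text \<open>Split by whether the basis contains \<open>v\<close>. Since \<open>v\<close> is the
  largest element, it lies above every \<open>i\<close> in \<open>E\<close>, so the condition at
  \<open>i\<close> for \<open>insert v X\<close> follows from the one for \<open>X\<close> after
  contraction. Bases of the deletion stay bases because \<open>v\<close> is not a coloop, and
  \<open>w0\<close> says that \<open>v\<close> is not a loop. Only the inequality is needed.\<close>

lemma card_nbc_bases_deletion_contraction:
  assumes W: "fun_subspace W" and E: "finite E" "\<forall>x\<in>E. x < v"
    and w0: "w0 \<in> W" "w0 v = 1"
    and not_coloop: "\<And>w. w \<in> W \<Longrightarrow> \<forall>x\<in>E. w x = 0 \<Longrightarrow> w v = 0"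
  shows "card (nbc_bases E W) + card (nbc_bases E {w\<in>W. w v = 0}) \<le> card (nbc_bases (insert v E) W)"
proof -
  have v: "v \<notin> E" using E by auto
  have iv: "indep_on W {v}" using w0 by (auto simp: indep_on_def)
  have 1: "nbc_bases E W \<subseteq> nbc_bases (insert v E) W"
  proof
    fix X assume X: "X \<in> nbc_bases E W"
    then have "X \<subseteq> E" by (simp add: nbc_bases_def)
    then have none: "{j \<in> X. v < j} = {}" using E(2) by fastforce
    have "nbc (insert v E) W X" unfolding nbc_def
    proof
      fix i assume "i \<in> insert v E"
      then consider "i = v" | "i \<in> E" by blast
      then show "indep_on W (insert i {j\<in>X. i < j})"
      proof cases
        case 1
        show ?thesis unfolding 1 none by (rule iv)
      next
        case 2
        then show ?thesis using X by (simp add: nbc_bases_def nbc_def)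
      qed
    qed
    moreover have "\<forall>x\<in>insert v E. w x = 0" if "w \<in> W" "\<forall>x\<in>X. w x = 0" for w
    proof -
      have "\<forall>x\<in>E. w x = 0" using X that by (simp add: nbc_bases_def)
      then show ?thesis using not_coloop[OF that(1)] by simp
    qed
    ultimately show "X \<in> nbc_bases (insert v E) W" using \<open>X \<subseteq> E\<close> by (simp add: nbc_bases_def subset_insertI2)
  qed
  have 2: "insert v ` nbc_bases E {w\<in>W. w v = 0} \<subseteq> nbc_bases (insert v E) W"
  proof
    fix Y assume "Y \<in> insert v ` nbc_bases E {w\<in>W. w v = 0}"
    then obtain X where X: "X \<in> nbc_bases E {w\<in>W. w v = 0}" and Y: "Y = insert v X" by blast
    then have XE: "X \<subseteq> E" by (simp add: nbc_bases_def)
    have "indep_on W (insert i {j\<in>Y. i < j})" if i: "i \<in> insert v E" for i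
    proof (cases "i = v")
      case True
      then have none: "{j\<in>Y. i < j} = {}" using E(2) XE unfolding Y by fastforce
      show ?thesis unfolding none unfolding True by (rule iv)
    next
      case False
      then have i: "i \<in> E" using i by auto
      have "indep_on W (insert v (insert i {j\<in>X. i < j}))"
        using i v XE finite_subset[OF XE E(1)] X E
        by (intro indep_on_uncontract[OF W _ _ _ w0]) (auto simp: nbc_bases_def nbc_def)
      then show ?thesis unfolding Y nbc_above_insert[OF i E(2)] .
    qed
    then have "nbc (insert v E) W Y" by (simp add: nbc_def)
    then show "Y \<in> nbc_bases (insert v E) W" using X XE unfolding nbc_bases_def Y by auto
  qed
  have sub: "X \<subseteq> E" if "X \<in> nbc_bases E U" for X U using that by (simp add: nbc_bases_def)
  have 3: "nbc_bases E W \<inter> insert v ` nbc_bases E {w\<in>W. w v = 0} = {}"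
    using v sub by blast
  have 4: "inj_on (insert v) (nbc_bases E {w\<in>W. w v = 0})"
    by (rule inj_on_insert_nbc_bases[OF v])
  have "card (nbc_bases E W) + card (nbc_bases E {w\<in>W. w v = 0})
      = card (nbc_bases E W \<union> insert v ` nbc_bases E {w\<in>W. w v = 0})"
    using card_Un_disjoint[OF nbc_bases_finite[OF E(1)] finite_imageI[OF nbc_bases_finite[OF E(1)]] 3]
    unfolding card_image[OF 4] by (rule sym)
  also have "\<dots> \<le> card (nbc_bases (insert v E) W)"
    using 1 2 E(1) by (intro card_mono nbc_bases_finite) auto
  finally show ?thesis .
qed

text \<open>A coloop can be added to every basis without creating a broken circuit, because
  \<open>w0\<close> corrects the value at \<open>v\<close> without disturbing the values on
  \<open>E\<close>.\<close>

lemma card_nbc_bases_coloop: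
  assumes W: "fun_subspace W" and E: "finite E" "\<forall>x\<in>E. x < v"
    and w0: "w0 \<in> W" "w0 v = 1" "\<forall>x\<in>E. w0 x = 0"
  shows "card (nbc_bases E W) \<le> card (nbc_bases (insert v E) W)"
proof -
  have v: "v \<notin> E" using E by auto
  have "insert v ` nbc_bases E W \<subseteq> nbc_bases (insert v E) W"
  proof
    fix Y assume "Y \<in> insert v ` nbc_bases E W"
    then obtain X where X: "X \<in> nbc_bases E W" and Y: "Y = insert v X" by blast
    then have XE: "X \<subseteq> E" by (simp add: nbc_bases_def)
    have "indep_on W (insert i {j\<in>Y. i < j})" if i: "i \<in> insert v E" for i
    proof (cases "i = v")
      case True
      then have "{j\<in>Y. i < j} = {}" using E(2) XE unfolding Y by fastforce
      then show ?thesis using w0 True by (auto simp: indep_on_def)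
    next
      case False
      then have i: "i \<in> E" using i by auto
      have Z: "insert i {j\<in>X. i < j} \<subseteq> E" using XE i by auto
      have "indep_on W (insert i {j\<in>X. i < j})" using X i by (auto simp: nbc_bases_def nbc_def)
      have "indep_on {w\<in>W. w v = 0} (insert i {j\<in>X. i < j})"
        unfolding indep_on_def
      proof
        fix x assume x: "x \<in> insert i {j\<in>X. i < j}"
        with \<open>indep_on W (insert i {j\<in>X. i < j})\<close>
        obtain w where w: "w \<in> W" "w x = 1" "\<forall>y\<in>insert i {j\<in>X. i < j} - {x}. w y = 0"
          unfolding indep_on_def by blast
        then show "\<exists>w\<in>{w\<in>W. w v = 0}. w x = 1 \<and> (\<forall>y\<in>insert i {j\<in>X. i < j} - {x}. w y = 0)"
          using fun_subspace_diff[OF W w(1) w0(1), of "w v"] w0(2,3) Z x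
          \<comment> \<open>Subtracting \<open>w v * w0\<close> makes the vector vanish at
            \<open>v\<close> and leaves it unchanged on \<open>E\<close>.\<close>
          by (intro bexI[of _ "\<lambda>i. w i - w v * w0 i"]) auto
      qed
      then have "indep_on W (insert v (insert i {j\<in>X. i < j}))"
        using Z v finite_subset[OF Z E(1)]
        by (intro indep_on_uncontract[OF W _ _ _ w0(1,2)]) auto
      then show ?thesis unfolding Y nbc_above_insert[OF i E(2)] .
    qed
    then have "nbc (insert v E) W Y" by (simp add: nbc_def)
    then show "Y \<in> nbc_bases (insert v E) W" using X XE unfolding nbc_bases_def Y by auto
  qed
  moreover have "inj_on (insert v) (nbc_bases E W)"
    by (rule inj_on_insert_nbc_bases[OF v])
  ultimately show ?thesis
    using card_mono[OF nbc_bases_finite[of "insert v E" W]] E(1) by (metis card_image finite_insert)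
qed

section \<open>Upper bound: the quotient is spanned by at most as many elements as there are bases
  without broken circuits\<close>

lemma ideal_in_subset: "ideal_in V J \<Longrightarrow> U \<subseteq> V \<Longrightarrow> ideal_in U J"
  unfolding ideal_in_def by blast

lemma ideal_in_colon: "ideal_in V J \<Longrightarrow> ideal_in V {p. y * p \<in> J}"
  unfolding ideal_in_def by (auto simp: distrib_left mult.left_commute)

lemma ideal_in_plus_principal:
  fixes J :: "'a::comm_ring_1 mpoly set"
  assumes J: "ideal_in V J"
  shows "ideal_in V {p. \<exists>h. pvars h \<subseteq> V \<and> p - y * h \<in> J}"
  unfolding ideal_in_def
proof (intro conjI ballI allI impI)
  show "0 \<in> {p. \<exists>h. pvars h \<subseteq> V \<and> p - y * h \<in> J}"
    using J by (intro CollectI exI[of _ 0]) (simp add: pvars_zero ideal_in_zero)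
next
  fix p q assume "p \<in> {p. \<exists>h. pvars h \<subseteq> V \<and> p - y * h \<in> J}" "q \<in> {p. \<exists>h. pvars h \<subseteq> V \<and> p - y * h \<in> J}"
  then obtain h h' where "pvars h \<subseteq> V" "p - y * h \<in> J" "pvars h' \<subseteq> V" "q - y * h' \<in> J" by blast
  then show "p + q \<in> {p. \<exists>h. pvars h \<subseteq> V \<and> p - y * h \<in> J}"
    using ideal_in_add[OF J, of "p - y * h" "q - y * h'"]
    by (intro CollectI exI[of _ "h + h'"]) (simp add: algebra_simps pvars_add)
next
  fix p c :: "'a mpoly" assume "p \<in> {p. \<exists>h. pvars h \<subseteq> V \<and> p - y * h \<in> J}" and c: "pvars c \<subseteq> V"
  then obtain h where "pvars h \<subseteq> V" "p - y * h \<in> J" by blast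
  then show "c * p \<in> {p. \<exists>h. pvars h \<subseteq> V \<and> p - y * h \<in> J}"
    using ideal_in_mult[OF J, of "p - y * h" c] c
    by (intro CollectI exI[of _ "c * h"]) (simp add: algebra_simps pvars_mult)
qed

text \<open>\<open>J\<close> is any ideal containing the relations, not the one they generate. The
  induction can therefore be applied directly to J + (x_v) and to the colon ideal (J : x_v), read as
  ideals for \<open>E\<close>, with no need to find generators for either.\<close>

lemma spanning_set_card_le_nbc_bases:
  fixes W :: "(nat \<Rightarrow> 'a::field) set"
  assumes "finite E" "fun_subspace W"
  shows "\<exists>S::'a mpoly set. finite S \<and> card S \<le> card (nbc_bases E W) \<and>
    (\<forall>J. ideal_in E J \<longrightarrow> (\<forall>X\<subseteq>E. \<not> nbc E W X \<longrightarrow> mono (squarefree_exp X) \<in> J) \<longrightarrow>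
       (\<forall>w\<in>W. linear_form E w \<in> J) \<longrightarrow> spans_mod E S J)"
  using assms
proof (induction E arbitrary: W rule: finite_linorder_max_induct)
  case empty
  have "nbc_bases {} W = {{}}" by (auto simp: nbc_bases_def nbc_def)
  moreover have "spans_mod {} {1} J" if J: "ideal_in {} J" for J :: "'a mpoly set"
    unfolding spans_mod_def
  proof (intro allI impI)
    fix p :: "'a mpoly" assume "pvars p \<subseteq> {}"
    then have "\<mu> = 0" if "\<mu> \<in> Poly_Mapping.keys p" for \<mu> using that by (auto simp: pvars_def)
    then have "p = Poly_Mapping.single 0 (Poly_Mapping.lookup p 0)"
      by (intro poly_mapping_eqI) (auto simp: lookup_single when_def in_keys_iff)
    then have "p - (\<Sum>s\<in>{1}. Poly_Mapping.single 0 (Poly_Mapping.lookup p 0) * s) = 0" by simp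
    then show "\<exists>c. p - (\<Sum>s\<in>{1}. Poly_Mapping.single 0 (c s) * s) \<in> J"
      using ideal_in_zero[OF J] by (intro exI[of _ "\<lambda>_. Poly_Mapping.lookup p 0"]) simp
  qed
  ultimately show ?case by (intro exI[of _ "{1}"]) auto
next
  case (insert v E)
  note W = \<open>fun_subspace W\<close> and E = \<open>finite E\<close> \<open>\<forall>x\<in>E. x < v\<close>
  have v: "v \<notin> E" using E by auto
  have W'': "fun_subspace {w\<in>W. w v = 0}" using W unfolding fun_subspace_def by auto
  have del: "\<not> nbc (insert v E) W X" if "\<not> nbc E W X" for X
    using that by (auto simp: nbc_def)
  have con: "\<not> nbc (insert v E) W (insert v X)" if X: "X \<subseteq> E" "\<not> nbc E {w\<in>W. w v = 0} X" for X
  proof -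
    obtain i where i: "i \<in> E" "\<not> indep_on {w\<in>W. w v = 0} (insert i {j\<in>X. i < j})"
      using X by (auto simp: nbc_def)
    have "v \<notin> insert i {j\<in>X. i < j}" using i v X by auto
    then have "\<not> indep_on W (insert v (insert i {j\<in>X. i < j}))"
      using indep_on_contract i by blast
    then show ?thesis using i nbc_above_insert[OF i(1) E(2)] unfolding nbc_def by (metis insertI2)
  qed
  obtain S1 :: "'a mpoly set" where S1: "finite S1" "card S1 \<le> card (nbc_bases E W)"
    "\<And>J. ideal_in E J \<Longrightarrow> \<forall>X\<subseteq>E. \<not> nbc E W X \<longrightarrow> mono (squarefree_exp X) \<in> J \<Longrightarrow>
       \<forall>w\<in>W. linear_form E w \<in> J \<Longrightarrow> spans_mod E S1 J"
    using insert.IH[OF W] by blast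
  consider (loop) "\<forall>w\<in>W. w v = 0" | (coloop) w0 where "w0 \<in> W" "w0 v = 1" "\<forall>x\<in>E. w0 x = 0"
    | (neither) w0 where "w0 \<in> W" "w0 v = 1" "\<And>w. w \<in> W \<Longrightarrow> \<forall>x\<in>E. w x = 0 \<Longrightarrow> w v = 0"
  proof -
    have "\<exists>w'\<in>W. w' v = 1 \<and> (\<forall>x. w x = 0 \<longrightarrow> w' x = 0)" if "w \<in> W" "w v \<noteq> 0" for w
    proof (rule bexI)
      show "(\<lambda>i. inverse (w v) * w i) \<in> W" using W that by (intro fun_subspace_scale)
    qed (use that in auto)
    then show ?thesis using that by (metis (no_types, lifting))
  qed
  then show ?case
  proof cases
    case loop
    \<comment> \<open>A loop has the empty broken circuit, whose monomial is 1. So \<open>J\<close>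
      contains every polynomial in these variables and the empty set spans.\<close>
    have "\<not> nbc (insert v E) W {}" using loop by (auto simp: nbc_def indep_on_def)
    moreover have "spans_mod (insert v E) {} J"
      if "ideal_in (insert v E) J" "mono (squarefree_exp {}) \<in> J" for J :: "'a mpoly set"
    proof -
      have "(1::'a mpoly) \<in> J" using that(2) by (simp add: squarefree_exp_def mono_def)
      then have "p \<in> J" if "pvars p \<subseteq> insert v E" for p
        using ideal_in_mult[OF \<open>ideal_in (insert v E) J\<close> _ that] by fastforce
      then show ?thesis by (simp add: spans_mod_def)
    qed
    ultimately show ?thesis by (intro exI[of _ "{}"]) auto
  next
    case coloop
    have "spans_mod (insert v E) S1 J"
      if J: "ideal_in (insert v E) J" "\<forall>X\<subseteq>insert v E. \<not> nbc (insert v E) W X \<longrightarrow> mono (squarefree_exp X) \<in> J"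
        "\<forall>w\<in>W. linear_form (insert v E) w \<in> J" for J :: "'a mpoly set"
    proof -
      \<comment> \<open>On \<open>insert v E\<close> the vector \<open>w0\<close> is the unit vector
        at \<open>v\<close>, so its linear form is \<open>var v\<close> itself.\<close>
      have "linear_form E w0 = 0" using coloop by (simp add: linear_form_def)
      then have x: "var v \<in> J" using J(3) coloop v E(1) linear_form_insert[of E v w0] by force
      have "linear_form E w \<in> J" if "w \<in> W" for w
      proof -
        have "linear_form (insert v E) w - Poly_Mapping.single 0 (w v) * var v \<in> J"
          using J(3) that x by (intro ideal_in_diff[OF J(1)] ideal_in_const_mult[OF J(1)]) auto
        then show ?thesis using v E(1) by (simp add: linear_form_insert)
      qed
      moreover have "\<forall>X\<subseteq>E. \<not> nbc E W X \<longrightarrow> mono (squarefree_exp X) \<in> J" using del J(2) by blast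
      ultimately have S: "spans_mod E S1 J"
        using S1(3) ideal_in_subset[OF J(1)] by blast
      show ?thesis unfolding spans_mod_def
      proof (intro allI impI)
        fix p :: "'a mpoly" assume "pvars p \<subseteq> insert v E"
        then obtain p' h where p: "pvars p' \<subseteq> E" "pvars h \<subseteq> insert v E" "p = p' + var v * h"
          using polynomial_split_variable by blast
        obtain c where "p' - (\<Sum>s\<in>S1. Poly_Mapping.single 0 (c s) * s) \<in> J"
          using S p(1) unfolding spans_mod_def by blast
        from ideal_in_add[OF J(1) this ideal_in_mult_right[OF J(1) x p(2)]]
        show "\<exists>c. p - (\<Sum>s\<in>S1. Poly_Mapping.single 0 (c s) * s) \<in> J"
          by (intro exI[of _ c]) (simp add: p(3) algebra_simps)
      qed
    qed
    moreover have "card S1 \<le> card (nbc_bases (insert v E) W)"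
      using S1(2) card_nbc_bases_coloop[OF W E coloop] by simp
    ultimately show ?thesis using S1(1) by blast
  next
    case neither
    obtain S2 :: "'a mpoly set" where S2: "finite S2" "card S2 \<le> card (nbc_bases E {w\<in>W. w v = 0})"
      "\<And>J. ideal_in E J \<Longrightarrow> \<forall>X\<subseteq>E. \<not> nbc E {w\<in>W. w v = 0} X \<longrightarrow> mono (squarefree_exp X) \<in> J \<Longrightarrow>
         \<forall>w\<in>{w\<in>W. w v = 0}. linear_form E w \<in> J \<Longrightarrow> spans_mod E S2 J"
      using insert.IH[OF W''] by blast
    have "spans_mod (insert v E) (S1 \<union> (*) (var v) ` S2) J"
      if J: "ideal_in (insert v E) J" "\<forall>X\<subseteq>insert v E. \<not> nbc (insert v E) W X \<longrightarrow> mono (squarefree_exp X) \<in> J"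
        "\<forall>w\<in>W. linear_form (insert v E) w \<in> J" for J :: "'a mpoly set"
    proof (rule spans_mod_extension[OF J(1) _ _ _ _ _ S1(1) _ S2(1)])
      show "pvars (var v :: 'a mpoly) \<subseteq> insert v E" by (rule pvars_var) simp
      \<comment> \<open>Since \<open>w0 v = 1\<close>, the linear form of \<open>w0\<close> can be
        solved for \<open>var v\<close>, which gives the \<open>l\<close> of the extension
        lemma.\<close>
      show "pvars (- linear_form E w0) \<subseteq> E" by (intro pvars_uminus pvars_linear_form) simp
      show "var v - (- linear_form E w0) \<in> J"
        using J(3) neither(1,2) v E(1) linear_form_insert[of E v w0] by force
      show "spans_mod E S1 {p. \<exists>h. pvars h \<subseteq> insert v E \<and> p - var v * h \<in> J}"
      proof (rule S1(3))
        show "ideal_in E {p. \<exists>h. pvars h \<subseteq> insert v E \<and> p - var v * h \<in> J}"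
          using ideal_in_subset[OF ideal_in_plus_principal[OF J(1)]] by blast
        show "\<forall>X\<subseteq>E. \<not> nbc E W X \<longrightarrow> mono (squarefree_exp X) \<in> {p. \<exists>h. pvars h \<subseteq> insert v E \<and> p - var v * h \<in> J}"
        proof (intro allI impI)
          fix X assume "X \<subseteq> E" "\<not> nbc E W X"
          then have "mono (squarefree_exp X) \<in> J" using del J(2) by blast
          then show "mono (squarefree_exp X) \<in> {p. \<exists>h. pvars h \<subseteq> insert v E \<and> p - var v * h \<in> J}"
            by (intro CollectI exI[of _ 0]) (simp add: pvars_zero)
        qed
        show "\<forall>w\<in>W. linear_form E w \<in> {p. \<exists>h. pvars h \<subseteq> insert v E \<and> p - var v * h \<in> J}"
        proof
          fix w assume w: "w \<in> W"
          have "linear_form E w - var v * (- Poly_Mapping.single 0 (w v)) = linear_form (insert v E) w"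
            using v E(1) by (simp add: linear_form_insert mult.commute)
          then have "linear_form E w - var v * (- Poly_Mapping.single 0 (w v)) \<in> J"
            using J(3) w by simp
          moreover have "pvars (- Poly_Mapping.single 0 (w v) :: 'a mpoly) \<subseteq> insert v E"
            by (intro pvars_uminus pvars_single) simp
          ultimately show "linear_form E w \<in> {p. \<exists>h. pvars h \<subseteq> insert v E \<and> p - var v * h \<in> J}"
            by blast
        qed
      qed
      show "spans_mod E S2 {p. var v * p \<in> J}"
      proof (rule S2(3))
        show "ideal_in E {p. var v * p \<in> J}"
          using ideal_in_subset[OF ideal_in_colon[OF J(1)]] by blast
        show "\<forall>X\<subseteq>E. \<not> nbc E {w\<in>W. w v = 0} X \<longrightarrow> mono (squarefree_exp X) \<in> {p. var v * p \<in> J}"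
        proof (intro allI impI)
          fix X assume X: "X \<subseteq> E" "\<not> nbc E {w\<in>W. w v = 0} X"
          have "mono (squarefree_exp (insert v X)) \<in> J" using con[OF X] J(2) X(1) by blast
          moreover have "finite X" "v \<notin> X" using X(1) E(1) v finite_subset by auto
          ultimately show "mono (squarefree_exp X) \<in> {p. var v * p \<in> J}"
            by (simp add: mono_squarefree_insert)
        qed
        show "\<forall>w\<in>{w\<in>W. w v = 0}. linear_form E w \<in> {p. var v * p \<in> J}"
        proof
          fix w assume w: "w \<in> {w\<in>W. w v = 0}"
          then have "linear_form E w \<in> J"
            using J(3) v E(1) linear_form_insert[of E v w] by auto
          then show "linear_form E w \<in> {p. var v * p \<in> J}"
            using ideal_in_mult[OF J(1) _ pvars_var] by blast
        qed
      qed
    qed auto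
    moreover have "card (S1 \<union> (*) (var v) ` S2) \<le> card (nbc_bases (insert v E) W)"
    proof -
      have "card (S1 \<union> (*) (var v) ` S2) \<le> card S1 + card S2"
        using card_Un_le[of S1 "(*) (var v) ` S2"] card_image_le[OF S2(1), of "(*) (var v)"] by linarith
      also have "\<dots> \<le> card (nbc_bases E W) + card (nbc_bases E {w\<in>W. w v = 0})"
        using S1(2) S2(2) by (rule add_mono)
      also have "\<dots> \<le> card (nbc_bases (insert v E) W)"
        using neither by (rule card_nbc_bases_deletion_contraction[OF W E])
      finally show ?thesis .
    qed
    ultimately show ?thesis using S1(1) S2(1) by (intro exI[of _ "S1 \<union> (*) (var v) ` S2"]) blast
  qed
qed

subsection \<open>Substitution and homogeneous components\<close>

definition mono_subst :: "(nat \<Rightarrow> 'a::comm_ring_1 mpoly) \<Rightarrow> (nat \<Rightarrow>\<^sub>0 nat) \<Rightarrow> 'a mpoly" where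
  "mono_subst v \<mu> = (\<Prod>i\<in>Poly_Mapping.keys \<mu>. v i ^ Poly_Mapping.lookup \<mu> i)"

definition poly_subst :: "(nat \<Rightarrow> 'a::comm_ring_1 mpoly) \<Rightarrow> 'a mpoly \<Rightarrow> 'a mpoly" where
  "poly_subst v p = (\<Sum>\<mu>\<in>Poly_Mapping.keys p. Poly_Mapping.single 0 (Poly_Mapping.lookup p \<mu>) * mono_subst v \<mu>)"

lemma mono_subst_superset:
  assumes "finite A" "Poly_Mapping.keys \<mu> \<subseteq> A"
  shows "mono_subst v \<mu> = (\<Prod>i\<in>A. v i ^ Poly_Mapping.lookup \<mu> i)"
  unfolding mono_subst_def using assms
  by (intro prod.mono_neutral_left) (auto simp: in_keys_iff)

lemma mono_subst_add: "mono_subst v (\<mu> + \<nu>) = mono_subst v \<mu> * mono_subst v \<nu>"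
proof -
  let ?A = "Poly_Mapping.keys \<mu> \<union> Poly_Mapping.keys \<nu>"
  have "mono_subst v (\<mu> + \<nu>) = (\<Prod>i\<in>?A. v i ^ Poly_Mapping.lookup (\<mu> + \<nu>) i)"
    by (rule mono_subst_superset) (auto simp: keys_add_nat)
  also have "\<dots> = (\<Prod>i\<in>?A. v i ^ Poly_Mapping.lookup \<mu> i) * (\<Prod>i\<in>?A. v i ^ Poly_Mapping.lookup \<nu> i)"
    by (simp add: lookup_add power_add prod.distrib)
  also have "\<dots> = mono_subst v \<mu> * mono_subst v \<nu>"
    by (simp add: mono_subst_superset[of ?A])
  finally show ?thesis .
qed

lemma poly_subst_superset:
  assumes "finite A" "Poly_Mapping.keys p \<subseteq> A"
  shows "poly_subst v p = (\<Sum>\<mu>\<in>A. Poly_Mapping.single 0 (Poly_Mapping.lookup p \<mu>) * mono_subst v \<mu>)"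
  unfolding poly_subst_def using assms
  by (intro sum.mono_neutral_left) (auto simp: in_keys_iff)

lemma poly_subst_zero: "poly_subst v 0 = 0"
  by (simp add: poly_subst_def)

lemma poly_subst_add: "poly_subst v (p + q) = poly_subst v p + poly_subst v q"
proof -
  let ?A = "Poly_Mapping.keys p \<union> Poly_Mapping.keys q"
  have "poly_subst v (p + q) = (\<Sum>\<mu>\<in>?A. Poly_Mapping.single 0 (Poly_Mapping.lookup (p + q) \<mu>) * mono_subst v \<mu>)"
    by (rule poly_subst_superset) (simp_all add: keys_add)
  also have "\<dots> = poly_subst v p + poly_subst v q"
    by (simp add: lookup_add single_add distrib_right sum.distrib poly_subst_superset[of ?A])
  finally show ?thesis .
qed

lemma poly_subst_sum: "poly_subst v (sum f A) = (\<Sum>x\<in>A. poly_subst v (f x))"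
  by (induction A rule: infinite_finite_induct) (simp_all add: poly_subst_zero poly_subst_add)

lemma poly_subst_single: "poly_subst v (Poly_Mapping.single \<mu> c) = Poly_Mapping.single 0 c * mono_subst v \<mu>"
  by (simp add: poly_subst_def)

lemma poly_subst_mult: "poly_subst v (p * q) = poly_subst v p * poly_subst v q"
proof (induction p rule: poly_mapping_induct_single)
  case (single \<mu> c)
  show ?case
  proof (induction q rule: poly_mapping_induct_single)
    case (single \<nu> d)
    have "poly_subst v (Poly_Mapping.single \<mu> c * Poly_Mapping.single \<nu> d)
        = Poly_Mapping.single 0 (c * d) * (mono_subst v \<mu> * mono_subst v \<nu>)"
      by (simp only: mult_single poly_subst_single mono_subst_add)
    also have "Poly_Mapping.single 0 (c * d) = Poly_Mapping.single 0 c * (Poly_Mapping.single 0 d :: 'a mpoly)"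
      by (simp add: mult_single)
    finally show ?case by (simp only: poly_subst_single mult_ac)
  qed (simp_all add: poly_subst_zero poly_subst_add distrib_left)
qed (simp_all add: poly_subst_zero poly_subst_add distrib_right)

lemma poly_subst_linear_form:
  "poly_subst v (linear_form E w) = (\<Sum>i\<in>E. Poly_Mapping.single 0 (w i) * v i)"
  by (simp add: linear_form_def poly_subst_sum poly_subst_single mono_subst_def)

lemma poly_subst_squarefree:
  "finite X \<Longrightarrow> poly_subst v (mono (squarefree_exp X)) = (\<Prod>i\<in>X. v i)"
  by (simp add: mono_def poly_subst_single mono_subst_def keys_squarefree_exp lookup_squarefree_exp)

definition mono_degree :: "(nat \<Rightarrow>\<^sub>0 nat) \<Rightarrow> nat" where
  "mono_degree \<mu> = (\<Sum>i\<in>Poly_Mapping.keys \<mu>. Poly_Mapping.lookup \<mu> i)"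

definition hom_part :: "nat \<Rightarrow> 'a::comm_ring_1 mpoly \<Rightarrow> 'a mpoly" where
  "hom_part d p = (\<Sum>\<mu>\<in>{\<mu>\<in>Poly_Mapping.keys p. mono_degree \<mu> = d}. Poly_Mapping.single \<mu> (Poly_Mapping.lookup p \<mu>))"

lemma mono_degree_add: "mono_degree (\<mu> + \<nu>) = mono_degree \<mu> + mono_degree \<nu>"
proof -
  let ?A = "Poly_Mapping.keys \<mu> \<union> Poly_Mapping.keys \<nu>"
  have *: "mono_degree \<kappa> = (\<Sum>i\<in>?A. Poly_Mapping.lookup \<kappa> i)" if "Poly_Mapping.keys \<kappa> \<subseteq> ?A" for \<kappa>
    unfolding mono_degree_def using that by (intro sum.mono_neutral_left) (auto simp: in_keys_iff)
  show ?thesis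
    by (subst (1 2 3) *) (auto simp: keys_add_nat lookup_add sum.distrib)
qed

lemma lookup_hom_part:
  "Poly_Mapping.lookup (hom_part d p) \<mu> = (if mono_degree \<mu> = d then Poly_Mapping.lookup p \<mu> else 0)"
  by (auto simp: hom_part_def lookup_sum lookup_single when_def in_keys_iff sum.delta' cong: if_cong)

lemma keys_hom_part: "Poly_Mapping.keys (hom_part d p) = {\<mu>\<in>Poly_Mapping.keys p. mono_degree \<mu> = d}"
  by (auto simp: in_keys_iff lookup_hom_part split: if_splits)

lemma hom_part_add: "hom_part d (p + q) = hom_part d p + hom_part d q"
  by (rule poly_mapping_eqI) (simp add: lookup_hom_part lookup_add)

lemma hom_part_zero: "hom_part d 0 = 0"
  by (simp add: hom_part_def)

lemma hom_part_sum: "hom_part d (sum f A) = (\<Sum>x\<in>A. hom_part d (f x))"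
  by (induction A rule: infinite_finite_induct) (simp_all add: hom_part_zero hom_part_add)

lemma hom_part_self: "(\<And>\<mu>. \<mu> \<in> Poly_Mapping.keys p \<Longrightarrow> mono_degree \<mu> = d) \<Longrightarrow> hom_part d p = p"
  by (rule poly_mapping_eqI) (metis in_keys_iff lookup_hom_part)

lemma hom_part_eq_zero: "(\<And>\<mu>. \<mu> \<in> Poly_Mapping.keys p \<Longrightarrow> mono_degree \<mu> \<noteq> d) \<Longrightarrow> hom_part d p = 0"
  by (rule poly_mapping_eqI) (metis in_keys_iff lookup_hom_part lookup_zero)

text \<open>Serves to pass to the degree \<open>d\<close> part of an ideal membership with
  homogeneous generators: the cofactor of a generator of degree 1 then has degree
  \<open>d - 1\<close>, which feeds the induction on the degree below.\<close>

lemma hom_part_mult: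
  fixes c g :: "'a::comm_ring_1 mpoly"
  assumes g: "\<And>\<nu>. \<nu> \<in> Poly_Mapping.keys g \<Longrightarrow> mono_degree \<nu> = e"
  shows "hom_part d (c * g) = (if e \<le> d then hom_part (d - e) c * g else 0)"
proof -
  have keys: "\<exists>\<nu>\<in>Poly_Mapping.keys b. mono_degree \<mu> = mono_degree \<nu> + e"
    if "\<mu> \<in> Poly_Mapping.keys (b * g)" for \<mu> b
  proof -
    obtain \<nu> \<kappa> where "\<mu> = \<nu> + \<kappa>" "\<nu> \<in> Poly_Mapping.keys b" "\<kappa> \<in> Poly_Mapping.keys g"
      using \<open>\<mu> \<in> Poly_Mapping.keys (b * g)\<close> keys_mult[of b g] by blast
    then show ?thesis using g by (auto simp: mono_degree_add)
  qed
  show ?thesis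
  proof (cases "e \<le> d")
    case True
    let ?r = "c - hom_part (d - e) c"
    have "hom_part d (?r * g) = 0"
    proof (rule hom_part_eq_zero)
      fix \<mu> assume "\<mu> \<in> Poly_Mapping.keys (?r * g)"
      then obtain \<nu> where \<nu>: "\<nu> \<in> Poly_Mapping.keys ?r" "mono_degree \<mu> = mono_degree \<nu> + e"
        using keys by blast
      then have "mono_degree \<nu> \<noteq> d - e" by (auto simp: in_keys_iff lookup_minus lookup_hom_part)
      then show "mono_degree \<mu> \<noteq> d" using \<nu>(2) by auto
    qed
    moreover have "hom_part d (hom_part (d - e) c * g) = hom_part (d - e) c * g"
    proof (rule hom_part_self)
      fix \<mu> assume "\<mu> \<in> Poly_Mapping.keys (hom_part (d - e) c * g)"
      then show "mono_degree \<mu> = d" using keys True by (fastforce simp: keys_hom_part)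
    qed
    moreover have "c * g = ?r * g + hom_part (d - e) c * g" by (simp add: left_diff_distrib)
    ultimately have "hom_part d (c * g) = hom_part (d - e) c * g" by (metis add_0 hom_part_add)
    then show ?thesis using True by simp
  next
    case False
    have "hom_part d (c * g) = 0" by (rule hom_part_eq_zero) (use keys False in fastforce)
    then show ?thesis using False by simp
  qed
qed

lemma mono_degree_linear_form:
  "\<mu> \<in> Poly_Mapping.keys (linear_form E w) \<Longrightarrow> mono_degree \<mu> = 1"
  unfolding linear_form_def using keys_sum
  by (fastforce simp: mono_degree_def split: if_splits)

lemma lookup_linear_form:
  "finite E \<Longrightarrow> i \<in> E \<Longrightarrow> Poly_Mapping.lookup (linear_form E w) (Poly_Mapping.single i 1) = w i"
proof -
  assume E: "finite E" "i \<in> E"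
  have inj: "Poly_Mapping.single j (1::nat) = Poly_Mapping.single i 1 \<longleftrightarrow> j = i" for j
    by (metis lookup_single_eq lookup_single_not_eq zero_neq_one)
  have "Poly_Mapping.lookup (linear_form E w) (Poly_Mapping.single i 1)
      = (\<Sum>j\<in>E. if j = i then w j else 0)"
    unfolding linear_form_def lookup_sum lookup_single when_def inj ..
  then show ?thesis using E by simp
qed

subsection \<open>A lower bound for spanning sets\<close>

text \<open>The defining condition at \<open>i = Min X\<close> is about all of
  \<open>X\<close>.\<close>

lemma nbc_imp_indep_on:
  assumes "finite X" "X \<subseteq> E" "nbc E W X"
  shows "indep_on W X"
proof (cases "X = {}")
  case False
  then have "Min X \<in> X" using assms by simp
  moreover have "insert (Min X) {j\<in>X. Min X < j} = X"
    using assms(1) \<open>Min X \<in> X\<close> by (auto simp: order_less_le)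
  ultimately show ?thesis using assms unfolding nbc_def by (metis subsetD)
qed (simp add: indep_on_def)

text \<open>Every basis \<open>Y\<close> without broken circuit yields the ring homomorphism \<open>x\<^sub>i \<mapsto> u\<^sub>i\<close> for
  \<open>i \<in> Y\<close> and \<open>x\<^sub>i \<mapsto> 0\<close> otherwise, where \<open>u\<close> is the basis of \<open>W\<close> dual to \<open>Y\<close>. It kills the
  broken circuit monomials and fixes every linear form in \<open>W\<close>. By induction on the degree,
  a set of monomials that spans the quotient generates the image of the product of these
  homomorphisms over the ring generated by \<open>W\<close>, and that image has rank \<open>card (nbc_bases E W)\<close>.\<close>

lemma card_nbc_bases_le_spanning:
  fixes W :: "(nat \<Rightarrow> 'a::field) set" and G :: "'a mpoly set"
  assumes E: "finite E" and W: "fun_subspace W" and L: "finite L"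
    and G: "\<And>g. g \<in> G \<Longrightarrow> (\<exists>X. finite X \<and> g = mono (squarefree_exp X) \<and> (\<forall>Y\<in>nbc_bases E W. \<not> X \<subseteq> Y)) \<or>
       (\<exists>w\<in>W. g = linear_form E w)"
    and span: "\<And>p. pvars p \<subseteq> E \<Longrightarrow> \<exists>q. Poly_Mapping.keys q \<subseteq> L \<and> p - q \<in> gen_ideal E G"
  shows "card (nbc_bases E W) \<le> card L"
proof -
  define F where "F = nbc_bases E W"
  have F: "finite F" using nbc_bases_finite[OF E] by (simp add: F_def)
  have FE: "Y \<subseteq> E" "finite Y" "nbc E W Y" if "Y \<in> F" for Y
    using that E finite_subset by (auto simp: F_def nbc_bases_def)
  have Fbase: "\<forall>x\<in>E. w x = 0" if "Y \<in> F" "w \<in> W" "\<forall>x\<in>Y. w x = 0" for Y w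
    using that by (auto simp: F_def nbc_bases_def)
  have "\<forall>Y\<in>F. \<forall>x\<in>Y. \<exists>w. w \<in> W \<and> w x = 1 \<and> (\<forall>y\<in>Y - {x}. w y = 0)"
    using nbc_imp_indep_on[OF FE(2,1,3)] unfolding indep_on_def by blast
  then have "\<forall>Y\<in>F. \<exists>u. \<forall>x\<in>Y. u x \<in> W \<and> u x x = 1 \<and> (\<forall>y\<in>Y - {x}. u x y = 0)"
    by (intro ballI bchoice) blast
  from bchoice[OF this] obtain u where u: "\<And>Y x. Y \<in> F \<Longrightarrow> x \<in> Y \<Longrightarrow> u Y x \<in> W"
    "\<And>Y x. Y \<in> F \<Longrightarrow> x \<in> Y \<Longrightarrow> u Y x x = 1"
    "\<And>Y x y. Y \<in> F \<Longrightarrow> x \<in> Y \<Longrightarrow> y \<in> Y \<Longrightarrow> y \<noteq> x \<Longrightarrow> u Y x y = 0" by blast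
  define v where "v Y i = (if i \<in> Y then linear_form E (u Y i) else 0)" for Y i
  define \<phi> where "\<phi> Y = poly_subst (v Y)" for Y
  have \<phi>_lin: "\<phi> Y (linear_form E w) = linear_form E w" if Y: "Y \<in> F" and w: "w \<in> W" for Y w
  proof -
    \<comment> \<open>The expansion of \<open>w\<close> in the basis dual to \<open>Y\<close>. It
      agrees with \<open>w\<close> on \<open>Y\<close>, hence on \<open>E\<close>, because
      \<open>Y\<close> spans.\<close>
    let ?w = "\<lambda>j. \<Sum>i\<in>Y. w i * u Y i j"
    have "\<phi> Y (linear_form E w) = (\<Sum>i\<in>Y. Poly_Mapping.single 0 (w i) * linear_form E (u Y i))"
      unfolding \<phi>_def poly_subst_linear_form v_def using E FE[OF Y]
      by (intro sum.mono_neutral_cong_right) auto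
    also have "\<dots> = linear_form E ?w" by (rule linear_form_combination[symmetric])
    also have "\<dots> = linear_form E w"
    proof (rule linear_form_cong)
      have "?w \<in> W" using u(1)[OF Y] FE(2)[OF Y] by (intro fun_subspace_sum[OF W])
      then have d: "(\<lambda>j. w j - 1 * ?w j) \<in> W" by (rule fun_subspace_diff[OF W w])
      have "w y - 1 * ?w y = 0" if "y \<in> Y" for y
      proof -
        have "?w y = (\<Sum>i\<in>Y. if i = y then w y else 0)"
          using u(2,3)[OF Y] that by (intro sum.cong) auto
        then show ?thesis using that FE(2)[OF Y] by simp
      qed
      then have *: "\<forall>x\<in>E. w x - 1 * ?w x = 0" using Fbase[OF Y d] by blast
      fix j assume "j \<in> E"
      with * show "?w j = w j" by simp
    qed
    finally show ?thesis .
  qed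
  \<comment> \<open>The coefficients \<open>c \<mu>\<close> are polynomials and the same for all
    \<open>Y\<close>: \<open>U\<close> is the preimage, under the product of the
    \<open>\<phi> Y\<close>, of the submodule generated by the images of \<open>L\<close> under
    diagonal scalars.\<close>
  define U where "U = {p. \<exists>c. \<forall>Y\<in>F. \<phi> Y p = (\<Sum>\<mu>\<in>L. c \<mu> * \<phi> Y (mono \<mu>))}"
  have U_kill: "p \<in> U" if "\<forall>Y\<in>F. \<phi> Y p = 0" for p
    unfolding U_def using that by (intro CollectI exI[of _ "\<lambda>_. 0"]) simp
  have U_add: "p + q \<in> U" if "p \<in> U" "q \<in> U" for p q
  proof -
    from that obtain c d where "\<forall>Y\<in>F. \<phi> Y p = (\<Sum>\<mu>\<in>L. c \<mu> * \<phi> Y (mono \<mu>))"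
      "\<forall>Y\<in>F. \<phi> Y q = (\<Sum>\<mu>\<in>L. d \<mu> * \<phi> Y (mono \<mu>))" unfolding U_def by blast
    then show ?thesis unfolding U_def
      by (intro CollectI exI[of _ "\<lambda>\<mu>. c \<mu> + d \<mu>"]) (simp add: \<phi>_def poly_subst_add distrib_right sum.distrib)
  qed
  have U_sum: "sum f A \<in> U" if "\<And>x. x \<in> A \<Longrightarrow> f x \<in> U" for f :: "_ \<Rightarrow> 'a mpoly" and A
    using that by (induction A rule: infinite_finite_induct) (auto intro: U_add U_kill simp: \<phi>_def poly_subst_zero)
  \<comment> \<open>A factor \<open>l\<close> preserves \<open>U\<close> when all
    \<open>\<phi> Y\<close> send it to one and the same \<open>m\<close>, for then it acts as a
    diagonal scalar. Constants and the linear forms of \<open>W\<close> are such factors.\<close>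
  have U_mult: "l * p \<in> U" if "p \<in> U" "\<forall>Y\<in>F. \<phi> Y l = m" for p l m
  proof -
    from that obtain c where "\<forall>Y\<in>F. \<phi> Y p = (\<Sum>\<mu>\<in>L. c \<mu> * \<phi> Y (mono \<mu>))" unfolding U_def by blast
    then have "\<forall>Y\<in>F. \<phi> Y (l * p) = (\<Sum>\<mu>\<in>L. (m * c \<mu>) * \<phi> Y (mono \<mu>))"
      using that(2) by (simp add: \<phi>_def poly_subst_mult sum_distrib_left mult.assoc)
    then show ?thesis unfolding U_def by (intro CollectI exI)
  qed
  have U_single: "Poly_Mapping.single \<mu> c \<in> U" if "mono \<mu> \<in> U" for \<mu> c
    unfolding single_eq_const_mult_mono[of \<mu>]
    by (rule U_mult[OF that, of _ "Poly_Mapping.single 0 c"]) (simp add: \<phi>_def poly_subst_single mono_subst_def)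
  have U_monos: "p \<in> U" if "\<And>\<mu>. \<mu> \<in> Poly_Mapping.keys p \<Longrightarrow> mono \<mu> \<in> U" for p
    by (induction p rule: poly_mapping_induct_single)
      (auto intro: U_single that U_add U_kill simp: \<phi>_def poly_subst_zero)
  have U_L: "mono \<mu> \<in> U" if "\<mu> \<in> L" for \<mu>
  proof -
    have "(\<Sum>\<nu>\<in>L. (if \<nu> = \<mu> then 1 else 0) * \<phi> Y (mono \<nu>)) = (\<Sum>\<nu>\<in>L. if \<nu> = \<mu> then \<phi> Y (mono \<mu>) else 0)" for Y
      by (rule sum.cong) auto
    then show ?thesis unfolding U_def using that L
      by (intro CollectI exI[of _ "\<lambda>\<nu>. if \<nu> = \<mu> then 1 else 0"]) simp
  qed
  have U_all: "mono \<mu> \<in> U" if "Poly_Mapping.keys \<mu> \<subseteq> E" "mono_degree \<mu> = d" for \<mu> d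
    using that
  proof (induction d arbitrary: \<mu> rule: less_induct)
    case (less d)
    have "pvars (mono \<mu> :: 'a mpoly) \<subseteq> E" using less.prems by (simp add: pvars_mono_iff)
    from span[OF this] obtain q G' c where q: "Poly_Mapping.keys q \<subseteq> L"
      and G': "finite G'" "G' \<subseteq> G" "\<forall>g\<in>G'. pvars (c g) \<subseteq> E" "mono \<mu> - q = (\<Sum>g\<in>G'. c g * g)"
      unfolding gen_ideal_def by blast
    \<comment> \<open>Compare the components of degree \<open>d\<close>. That of \<open>q\<close> is
      still supported on \<open>L\<close>; broken circuit monomials die under every
      \<open>\<phi> Y\<close>; a linear form contributes itself times a cofactor of degree
      \<open>d - 1\<close>, which lies in \<open>U\<close> by induction.\<close>
    have "mono \<mu> = q + (\<Sum>g\<in>G'. c g * g)" using G'(4) by (simp add: algebra_simps)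
    then have "hom_part d (mono \<mu>) = hom_part d q + (\<Sum>g\<in>G'. hom_part d (c g * g))"
      by (simp only: hom_part_add hom_part_sum)
    moreover have "hom_part d (mono \<mu>) = (mono \<mu> :: 'a mpoly)"
      using less.prems by (intro hom_part_self) (simp add: mono_def)
    ultimately have eq: "mono \<mu> = hom_part d q + (\<Sum>g\<in>G'. hom_part d (c g * g))" by simp
    have "hom_part d q \<in> U"
    proof (rule U_monos)
      fix \<nu> assume "\<nu> \<in> Poly_Mapping.keys (hom_part d q)"
      then have "\<nu> \<in> L" using q unfolding keys_hom_part by blast
      then show "mono \<nu> \<in> U" by (rule U_L)
    qed
    moreover have "hom_part d (c g * g) \<in> U" if g: "g \<in> G'" for g
    proof -
      have 0: "0 \<in> U" by (rule U_kill) (simp add: \<phi>_def poly_subst_zero)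
      have "g \<in> G" using g G'(2) by blast
      from G[OF this] consider (bad) X where "finite X" "g = mono (squarefree_exp X)" "\<forall>Y\<in>F. \<not> X \<subseteq> Y"
        | (lin) w where "w \<in> W" "g = linear_form E w" unfolding F_def by (elim disjE exE bexE conjE)
      then show ?thesis
      proof cases
        case bad
        have "p * g \<in> U" for p
        proof (rule U_kill, rule ballI)
          fix Y assume "Y \<in> F"
          then obtain i where "i \<in> X" "i \<notin> Y" using bad by blast
          then have "(\<Prod>i\<in>X. v Y i) = 0" using bad(1) by (auto simp: v_def)
          then show "\<phi> Y (p * g) = 0"
            by (simp add: \<phi>_def poly_subst_mult bad(2) poly_subst_squarefree[OF bad(1)])
        qed
        then show ?thesis
          using hom_part_mult[of g "mono_degree (squarefree_exp X)" d "c g"] 0 by (auto simp: bad(2) mono_def)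
      next
        case lin
        have hp: "hom_part d (c g * g) = (if 1 \<le> d then hom_part (d - 1) (c g) * g else 0)"
          by (rule hom_part_mult) (simp add: lin(2) mono_degree_linear_form)
        show ?thesis
        proof (cases d)
          case 0
          have "hom_part d (c g * g) = 0"
            using hp by (simp add: 0)
          then show ?thesis using \<open>0 \<in> U\<close> by simp
        next
          case (Suc e)
          have "hom_part d (c g * g) = g * hom_part e (c g)"
            using hp by (simp add: Suc mult.commute)
          moreover have "hom_part e (c g) \<in> U"
          proof (rule U_monos)
            fix \<nu> assume "\<nu> \<in> Poly_Mapping.keys (hom_part e (c g))"
            then show "mono \<nu> \<in> U" using G'(3) g Suc less.IH[of e \<nu>]
              by (simp add: keys_hom_part pvars_subset_iff)
          qed
          ultimately show ?thesis
            using U_mult[of _ g g] \<phi>_lin[OF _ lin(1)] lin(2) by simp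
        qed
      qed
    qed
    ultimately show ?case unfolding eq by (intro U_add U_sum)
  qed
  have "\<forall>Y\<in>F. \<exists>c. \<forall>Z\<in>F. \<phi> Z (mono (squarefree_exp Y)) = (\<Sum>\<mu>\<in>L. c \<mu> * \<phi> Z (mono \<mu>))"
    using U_all FE by (auto simp: keys_squarefree_exp U_def)
  from bchoice[OF this] obtain c where c: "\<And>Y Z. Y \<in> F \<Longrightarrow> Z \<in> F \<Longrightarrow>
      \<phi> Z (mono (squarefree_exp Y)) = (\<Sum>\<mu>\<in>L. c Y \<mu> * \<phi> Z (mono \<mu>))" by blast
  have off_diag: "\<phi> Z (mono (squarefree_exp Y)) = 0" if YF: "Y \<in> F" and ZF: "Z \<in> F" and ne: "Y \<noteq> Z" for Y Z
  proof -
    \<comment> \<open>If \<open>Y\<close> were properly contained in \<open>Z\<close>, the dual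
      vector of \<open>Z\<close> at some \<open>x\<close> outside \<open>Y\<close> would vanish on
      \<open>Y\<close>, hence on \<open>E\<close>, although its value at \<open>x\<close> is
      1.\<close>
    have "\<not> Y \<subseteq> Z"
    proof
      assume YZ: "Y \<subseteq> Z"
      then obtain x where x: "x \<in> Z" "x \<notin> Y" using ne by blast
      have "\<forall>y\<in>Y. u Z x y = 0" using x YZ u(3)[OF ZF x(1)] by blast
      then have "u Z x x = 0" using Fbase[OF YF u(1)[OF ZF x(1)]] x FE(1)[OF ZF] by blast
      then show False using u(2)[OF ZF x(1)] by simp
    qed
    then obtain i where "i \<in> Y" "i \<notin> Z" by blast
    then have "(\<Prod>i\<in>Y. v Z i) = 0" using FE(2)[OF YF] by (auto simp: v_def)
    then show ?thesis by (simp add: \<phi>_def poly_subst_squarefree[OF FE(2)[OF YF]])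
  qed
  have diag: "\<phi> Y (mono (squarefree_exp Y)) \<noteq> 0" if Y: "Y \<in> F" for Y
  proof -
    have "v Y i \<noteq> 0" if "i \<in> Y" for i
    proof -
      have "Poly_Mapping.lookup (v Y i) (Poly_Mapping.single i 1) = 1"
        using that u(2)[OF Y that] lookup_linear_form[OF E subsetD[OF FE(1)[OF Y] that], of "u Y i"] by (simp add: v_def)
      then show ?thesis by auto
    qed
    then show ?thesis using FE(2)[OF Y] by (simp add: \<phi>_def poly_subst_squarefree)
  qed
  show ?thesis
  proof (rule ccontr)
    assume "\<not> card (nbc_bases E W) \<le> card L"
    then have "card L < card F" by (simp add: F_def)
    \<comment> \<open>With too few monomials the rows \<open>c Y\<close> satisfy a relation with
      polynomial coefficients. In the component \<open>Z\<close> only the diagonal term of that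
      relation survives, and it is nonzero because polynomials form a domain.\<close>
    from homogeneous_system_nontrivial[OF L F this, of c]
    obtain a Z where a: "Z \<in> F" "a Z \<noteq> 0" "\<And>\<mu>. \<mu> \<in> L \<Longrightarrow> (\<Sum>Y\<in>F. a Y * c Y \<mu>) = 0" by blast
    have "(\<Sum>Y\<in>F. a Y * \<phi> Z (mono (squarefree_exp Y))) = (\<Sum>Y\<in>F. \<Sum>\<mu>\<in>L. a Y * c Y \<mu> * \<phi> Z (mono \<mu>))"
      using c a(1) by (intro sum.cong) (simp_all add: sum_distrib_left mult.assoc)
    also have "\<dots> = (\<Sum>\<mu>\<in>L. \<Sum>Y\<in>F. a Y * c Y \<mu> * \<phi> Z (mono \<mu>))" by (rule sum.swap)
    also have "\<dots> = (\<Sum>\<mu>\<in>L. (\<Sum>Y\<in>F. a Y * c Y \<mu>) * \<phi> Z (mono \<mu>))" by (simp add: sum_distrib_right)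
    also have "\<dots> = 0" using a(3) by simp
    finally have "(\<Sum>Y\<in>F. a Y * \<phi> Z (mono (squarefree_exp Y))) = 0" .
    moreover have "(\<Sum>Y\<in>F. a Y * \<phi> Z (mono (squarefree_exp Y)))
        = (\<Sum>Y\<in>F. if Y = Z then a Z * \<phi> Z (mono (squarefree_exp Z)) else 0)"
      using off_diag a(1) by (intro sum.cong) auto
    ultimately have "a Z * \<phi> Z (mono (squarefree_exp Z)) = 0" using F a(1) by simp
    then show False using a diag by simp
  qed
qed

subsection \<open>Matroids\<close>

lemma matroid_finite: "matroid E I \<Longrightarrow> finite E"
  and matroid_indep_empty: "matroid E I \<Longrightarrow> I {}"
  and matroid_indep_subset: "matroid E I \<Longrightarrow> I X \<Longrightarrow> X \<subseteq> E"
  and matroid_indep_mono: "matroid E I \<Longrightarrow> I Y \<Longrightarrow> X \<subseteq> Y \<Longrightarrow> I X"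
  and matroid_augment: "matroid E I \<Longrightarrow> I X \<Longrightarrow> I Y \<Longrightarrow> card X < card Y \<Longrightarrow> \<exists>y\<in>Y - X. I (insert y X)"
  unfolding matroid_def by blast+

lemma matroid_indep_finite: "matroid E I \<Longrightarrow> I X \<Longrightarrow> finite X"
  using matroid_finite matroid_indep_subset finite_subset by metis

lemma matroid_extend:
  assumes M: "matroid E I" and "I X" "I Y"
  shows "\<exists>Z. X \<subseteq> Z \<and> Z \<subseteq> X \<union> Y \<and> I Z \<and> card Y \<le> card Z"
  using assms(2)
proof (induction "card Y - card X" arbitrary: X rule: less_induct)
  case less
  show ?case
  proof (cases "card X < card Y")
    case True
    from matroid_augment[OF M less.prems \<open>I Y\<close> True]
    obtain y where y: "y \<in> Y" "y \<notin> X" "I (insert y X)" by blast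
    have "card (insert y X) = Suc (card X)"
      using y matroid_indep_finite[OF M less.prems] by simp
    then have "card Y - card (insert y X) < card Y - card X" using True by simp
    from less.hyps[OF this y(3)] obtain Z where
      "insert y X \<subseteq> Z" "Z \<subseteq> insert y X \<union> Y" "I Z" "card Y \<le> card Z" by blast
    then show ?thesis using y(1) by (intro exI[of _ Z]) auto
  next
    case False
    then show ?thesis using less.prems by (intro exI[of _ X]) auto
  qed
qed

lemma basis_indep: "is_basis E I B \<Longrightarrow> I B"
  and basis_subset: "is_basis E I B \<Longrightarrow> B \<subseteq> E"
  by (simp_all add: is_basis_def)

lemma basis_card_ge:
  assumes M: "matroid E I" and B: "is_basis E I B" and X: "I X"
  shows "card X \<le> card B"
proof (rule ccontr)
  assume "\<not> card X \<le> card B"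
  then obtain y where y: "y \<in> X - B" "I (insert y B)"
    using matroid_augment[OF M basis_indep[OF B] X] by auto
  then have "insert y B = B"
    using B matroid_indep_subset[OF M y(2)] unfolding is_basis_def by blast
  then show False using y by auto
qed

lemma basisI_card:
  assumes M: "matroid E I" and B: "is_basis E I B" and X: "I X" "card B \<le> card X"
  shows "is_basis E I X"
  unfolding is_basis_def
proof (intro conjI allI impI)
  show "X \<subseteq> E" "I X" using matroid_indep_subset[OF M] X by auto
  fix Z assume Z: "Z \<subseteq> E \<and> I Z \<and> X \<subseteq> Z"
  then have "card Z \<le> card X" using basis_card_ge[OF M B] X(2) le_trans by blast
  moreover have "finite Z" using Z matroid_indep_finite[OF M] by blast
  ultimately show "Z = X" using Z card_seteq by blast
qed

lemma basis_extend:
  assumes M: "matroid E I" and B: "is_basis E I B" and X: "I X"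
  shows "\<exists>Z. is_basis E I Z \<and> X \<subseteq> Z \<and> Z \<subseteq> X \<union> B"
  using matroid_extend[OF M X basis_indep[OF B]] basisI_card[OF M B] by blast

lemma card_basis:
  assumes "matroid E I" "is_basis E I A" "is_basis E I B"
  shows "card A = card B"
  using basis_card_ge[OF assms(1)] assms basis_indep by (meson le_antisym)

lemma circuit_subset: "circuit E I C \<Longrightarrow> C \<subseteq> E"
  and circuit_dep: "circuit E I C \<Longrightarrow> \<not> I C"
  and circuit_indep_Diff: "circuit E I C \<Longrightarrow> x \<in> C \<Longrightarrow> I (C - {x})"
  by (simp_all add: circuit_def)

lemma circuit_subset_dep: "matroid E I \<Longrightarrow> circuit E I C \<Longrightarrow> C \<subseteq> X \<Longrightarrow> \<not> I X"
  using matroid_indep_mono circuit_dep by metis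

lemma circuit_nonempty: "matroid E I \<Longrightarrow> circuit E I C \<Longrightarrow> C \<noteq> {}"
  using matroid_indep_empty circuit_dep by metis

lemma circuit_finite: "matroid E I \<Longrightarrow> circuit E I C \<Longrightarrow> finite C"
  using circuit_subset matroid_finite finite_subset by metis

lemma circuit_antichain:
  assumes M: "matroid E I" and "circuit E I C" "circuit E I D" "C \<subseteq> D"
  shows "C = D"
proof (rule ccontr)
  assume "C \<noteq> D"
  then obtain x where "x \<in> D" "C \<subseteq> D - {x}" using assms(4) by blast
  then show False using circuit_indep_Diff[OF assms(3)] circuit_subset_dep[OF M assms(2)] by blast
qed

lemma circuit_exists:
  assumes M: "matroid E I" and "X \<subseteq> E" "\<not> I X"
  shows "\<exists>C. C \<subseteq> X \<and> circuit E I C"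
proof -
  have "finite X" using assms matroid_finite finite_subset by metis
  then show ?thesis using assms(2,3)
  proof (induction X rule: finite_psubset_induct)
    case (psubset X)
    show ?case
    proof (cases "\<forall>x\<in>X. I (X - {x})")
      case True
      then show ?thesis using psubset.prems by (intro exI[of _ X]) (simp add: circuit_def)
    next
      case False
      then obtain x where x: "x \<in> X" "\<not> I (X - {x})" by blast
      then have "X - {x} \<subset> X" by blast
      from psubset.IH[OF this _ x(2)] psubset.prems(1) show ?thesis by blast
    qed
  qed
qed

text \<open>If \<open>b\<close> is in \<open>C\<close>, extend \<open>C - {b}\<close> to a basis by
  elements of \<open>B\<close>. It cannot contain \<open>b\<close>, so by cardinality it is
  \<open>B\<close> with \<open>b\<close> exchanged for \<open>e\<close>. Thus membership depends on
  \<open>B\<close> and \<open>e\<close> alone, which gives uniqueness of the fundamental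
  circuit.\<close>

lemma mem_fundamental_circuit:
  assumes M: "matroid E I" and B: "is_basis E I B" and e: "e \<notin> B"
    and C: "circuit E I C" "C \<subseteq> insert e B" and b: "b \<in> B"
  shows "b \<in> C \<longleftrightarrow> I (insert e (B - {b}))"
proof
  assume bC: "b \<in> C"
  obtain A where A: "is_basis E I A" "C - {b} \<subseteq> A" "A \<subseteq> C - {b} \<union> B"
    using basis_extend[OF M B circuit_indep_Diff[OF C(1) bC]] by blast
  have "b \<notin> A"
  proof
    assume "b \<in> A"
    then have "C \<subseteq> A" using A(2) by blast
    then show False using circuit_subset_dep[OF M C(1)] basis_indep[OF A(1)] by blast
  qed
  then have sub: "A \<subseteq> insert e (B - {b})" using A(3) C(2) by blast
  have fin: "finite B" using basis_indep[OF B] matroid_indep_finite[OF M] by blast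
  have "card (insert e (B - {b})) = card B"
    using b e fin by (simp add: card_Diff_singleton) (metis card_gt_0_iff Suc_pred empty_iff)
  then have "A = insert e (B - {b})"
    using sub fin card_basis[OF M A(1) B] by (intro card_subset_eq) auto
  then show "I (insert e (B - {b}))" using basis_indep[OF A(1)] by simp
next
  assume "I (insert e (B - {b}))"
  then show "b \<in> C" using circuit_subset_dep[OF M C(1), of "insert e (B - {b})"] C(2) by blast
qed

lemma mem_fundamental_circuit_self:
  assumes "matroid E I" "is_basis E I B" "circuit E I C" "C \<subseteq> insert e B"
  shows "e \<in> C"
  using circuit_subset_dep[OF assms(1,3), of B] basis_indep[OF assms(2)] assms(4) by blast

lemma ci_eqI:
  assumes M: "matroid E I" and B: "is_basis E I B" and e: "e \<notin> B"
    and C: "circuit E I C" "C \<subseteq> insert e B"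
  shows "ci E I B e = C"
  unfolding ci_def
proof (rule the_equality)
  show "circuit E I C \<and> C \<subseteq> insert e B" using C by simp
  fix D assume D: "circuit E I D \<and> D \<subseteq> insert e B"
  have "x \<in> D \<longleftrightarrow> x \<in> C" if "x \<in> insert e B" for x
    using that mem_fundamental_circuit[OF M B e C] mem_fundamental_circuit[OF M B e, of D] D
      mem_fundamental_circuit_self[OF M B C] mem_fundamental_circuit_self[OF M B, of D e] by blast
  then show "D = C" using C(2) D by blast
qed

lemma ci_circuit:
  assumes M: "matroid E I" and B: "is_basis E I B" and e: "e \<in> E" "e \<notin> B"
  shows "circuit E I (ci E I B e)" "ci E I B e \<subseteq> insert e B"
proof -
  have "\<not> I (insert e B)"
    using B e basis_subset[OF B] unfolding is_basis_def by blast
  then obtain C where C: "circuit E I C" "C \<subseteq> insert e B"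
    using circuit_exists[OF M, of "insert e B"] e basis_subset[OF B] by blast
  then show "circuit E I (ci E I B e)" "ci E I B e \<subseteq> insert e B" using ci_eqI[OF M B e(2)] by auto
qed

lemma mem_ci_self:
  assumes "matroid E I" "is_basis E I B" "e \<in> E" "e \<notin> B"
  shows "e \<in> ci E I B e"
  using mem_fundamental_circuit_self ci_circuit assms by metis

lemma mem_ci_iff:
  assumes "matroid E I" "is_basis E I B" "e \<in> E" "e \<notin> B" "b \<in> B"
  shows "b \<in> ci E I B e \<longleftrightarrow> I (insert e (B - {b}))"
  using mem_fundamental_circuit ci_circuit assms by metis

lemma cocircuit_subset: "cocircuit E I D \<Longrightarrow> D \<subseteq> E"
  and cocircuit_meets: "cocircuit E I D \<Longrightarrow> is_basis E I A \<Longrightarrow> D \<inter> A \<noteq> {}"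
  and cocircuit_minimal: "cocircuit E I D \<Longrightarrow> x \<in> D \<Longrightarrow> \<exists>A. is_basis E I A \<and> (D - {x}) \<inter> A = {}"
  by (simp_all add: cocircuit_def)

lemma cocircuit_antichain:
  assumes "cocircuit E I D" "cocircuit E I D'" "D \<subseteq> D'"
  shows "D = D'"
proof (rule ccontr)
  assume "D \<noteq> D'"
  then obtain x where x: "x \<in> D'" "D \<subseteq> D' - {x}" using assms(3) by blast
  then obtain A where "is_basis E I A" "(D' - {x}) \<inter> A = {}" using cocircuit_minimal[OF assms(2)] by blast
  then show False using cocircuit_meets[OF assms(1)] x by blast
qed

lemma basis_exchange_card:
  assumes M: "matroid E I" and B: "is_basis E I B" and b: "b \<in> B" "x \<notin> B - {b}"
    and "I (insert x (B - {b}))"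
  shows "is_basis E I (insert x (B - {b}))"
proof (rule basisI_card[OF M B assms(5)])
  have "finite B" using basis_indep[OF B] matroid_indep_finite[OF M] by blast
  then show "card B \<le> card (insert x (B - {b}))"
    using b by (metis card_insert_disjoint card_Suc_Diff1 finite_Diff order_refl)
qed

text \<open>The elements that can replace \<open>b\<close> in \<open>B\<close>, including
  \<open>b\<close>. Augmenting \<open>B - {b}\<close> from any basis finds such an element, and the
  exchanged bases show minimality.\<close>

lemma fundamental_cocircuit:
  assumes M: "matroid E I" and B: "is_basis E I B" and b: "b \<in> B"
  shows "cocircuit E I {x\<in>E. x \<notin> B - {b} \<and> I (insert x (B - {b}))}" (is "cocircuit E I ?D")
  unfolding cocircuit_def
proof (intro conjI allI impI ballI)
  show "?D \<subseteq> E" by blast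
next
  fix A assume A: "is_basis E I A"
  have fin: "finite B" using basis_indep[OF B] matroid_indep_finite[OF M] by blast
  have "card (B - {b}) < card B" using fin b by (rule card_Diff1_less)
  then have "card (B - {b}) < card A" using card_basis[OF M A B] by simp
  moreover have "I (B - {b})" using matroid_indep_mono[OF M basis_indep[OF B]] by blast
  ultimately obtain y where "y \<in> A - (B - {b})" "I (insert y (B - {b}))"
    using matroid_augment[OF M _ basis_indep[OF A]] by blast
  then show "?D \<inter> A \<noteq> {}" using basis_subset[OF A] by blast
next
  fix x assume x: "x \<in> ?D"
  then have "is_basis E I (insert x (B - {b}))" using basis_exchange_card[OF M B b] by blast
  moreover have "(?D - {x}) \<inter> insert x (B - {b}) = {}" by blast
  ultimately show "\<exists>A. is_basis E I A \<and> (?D - {x}) \<inter> A = {}" by blast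
qed

lemma coc_eqI:
  assumes M: "matroid E I" and B: "is_basis E I B" and b: "b \<in> B"
    and D: "cocircuit E I D" "D \<subseteq> insert b (E - B)" "b \<in> D"
  shows "coc E I B b = D"
proof -
  let ?D = "{x\<in>E. x \<notin> B - {b} \<and> I (insert x (B - {b}))}"
  have eq: "D' = ?D" if D': "cocircuit E I D'" "D' \<subseteq> insert b (E - B)" for D'
  proof (rule cocircuit_antichain[OF fundamental_cocircuit[OF M B b] D'(1), symmetric])
    show "?D \<subseteq> D'"
    proof
      fix x assume x: "x \<in> ?D"
      then have "D' \<inter> insert x (B - {b}) \<noteq> {}"
        using cocircuit_meets[OF D'(1)] basis_exchange_card[OF M B b] by blast
      then show "x \<in> D'" using D'(2) by blast
    qed
  qed
  show ?thesis unfolding coc_def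
  proof (rule the_equality)
    show "cocircuit E I D \<and> D \<subseteq> insert b (E - B) \<and> b \<in> D" using D by simp
    fix D' assume "cocircuit E I D' \<and> D' \<subseteq> insert b (E - B) \<and> b \<in> D'"
    then have "D' = ?D" by (intro eq) auto
    then show "D' = D" using eq[OF D(1,2)] by simp
  qed
qed

lemma coc_eq:
  assumes M: "matroid E I" and B: "is_basis E I B" and b: "b \<in> B"
  shows "coc E I B b = {x\<in>E. x \<notin> B - {b} \<and> I (insert x (B - {b}))}"
proof (rule coc_eqI[OF M B b fundamental_cocircuit[OF M B b]])
  show "{x\<in>E. x \<notin> B - {b} \<and> I (insert x (B - {b}))} \<subseteq> insert b (E - B)" by blast
  have "insert b (B - {b}) = B" using b by blast
  then show "b \<in> {x\<in>E. x \<notin> B - {b} \<and> I (insert x (B - {b}))}"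
    using basis_indep[OF B] basis_subset[OF B] b by auto
qed

lemma coc_cocircuit:
  assumes M: "matroid E I" and B: "is_basis E I B" and b: "b \<in> B"
  shows "cocircuit E I (coc E I B b)" "coc E I B b \<subseteq> insert b (E - B)" "b \<in> coc E I B b"
proof -
  show "cocircuit E I (coc E I B b)" unfolding coc_eq[OF assms] by (rule fundamental_cocircuit[OF assms])
  show "coc E I B b \<subseteq> insert b (E - B)" unfolding coc_eq[OF assms] by blast
  have "insert b (B - {b}) = B" using b by blast
  then show "b \<in> coc E I B b" unfolding coc_eq[OF assms]
    using basis_indep[OF B] basis_subset[OF B] b by auto
qed

lemma mem_coc_iff:
  assumes "matroid E I" "is_basis E I B" "b \<in> B" "x \<in> E" "x \<notin> B"
  shows "x \<in> coc E I B b \<longleftrightarrow> I (insert x (B - {b}))"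
  unfolding coc_eq[OF assms(1-3)] using assms(4,5) by blast

subsection \<open>Deletion and contraction\<close>

lemma matroid_deletion:
  assumes M: "matroid E I"
  shows "matroid (E - {e}) (deletion I e)"
  unfolding matroid_def deletion_def
proof (intro conjI allI impI; (elim conjE)?)
  show "finite (E - {e})" using matroid_finite[OF M] by simp
  show "I {}" by (rule matroid_indep_empty[OF M])
  show "X \<subseteq> E - {e}" if "I X" "e \<notin> X" for X
    using matroid_indep_subset[OF M that(1)] that(2) by blast
  show "I X" if "I Y" "X \<subseteq> Y" for X Y by (rule matroid_indep_mono[OF M that])
  show "\<exists>y\<in>Y - X. I (insert y X) \<and> e \<notin> insert y X"
    if *: "I X" "I Y" "card X < card Y" "e \<notin> X" "e \<notin> Y" for X Y
    using matroid_augment[OF M *(1-3)] *(4,5) by blast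
qed auto

text \<open>Passes from the description by bases to one by independent sets. If \<open>e\<close> is
  a loop, both sides are false.\<close>

lemma contraction_iff:
  assumes M: "matroid E I" and B: "is_basis E I B"
  shows "contraction E I e X \<longleftrightarrow> e \<notin> X \<and> I (insert e X)"
proof
  assume "contraction E I e X"
  then obtain A where A: "e \<notin> A" "is_basis E I (insert e A)" "X \<subseteq> A" unfolding contraction_def by blast
  then have "insert e X \<subseteq> insert e A" by blast
  then show "e \<notin> X \<and> I (insert e X)" using A matroid_indep_mono[OF M basis_indep[OF A(2)]] by blast
next
  assume X: "e \<notin> X \<and> I (insert e X)"
  then obtain Z where Z: "is_basis E I Z" "insert e X \<subseteq> Z" using basis_extend[OF M B] by blast
  then have "insert e (Z - {e}) = Z" by blast
  then show "contraction E I e X" unfolding contraction_def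
    using Z X by (intro exI[of _ "Z - {e}"]) auto
qed

lemma matroid_contraction:
  assumes M: "matroid E I" and B: "is_basis E I B" and e: "I {e}"
  shows "matroid (E - {e}) (contraction E I e)"
  unfolding matroid_def contraction_iff[OF M B]
proof (intro conjI allI impI; (elim conjE)?)
  show "finite (E - {e})" using matroid_finite[OF M] by simp
  show "I (insert e {})" using e by simp
  show "X \<subseteq> E - {e}" if "e \<notin> X" "I (insert e X)" for X
    using matroid_indep_subset[OF M that(2)] that(1) by blast
  show "I (insert e X)" if "I (insert e Y)" "X \<subseteq> Y" for X Y
    using matroid_indep_mono[OF M that(1), of "insert e X"] that(2) by blast
  show "\<exists>y\<in>Y - X. e \<notin> insert y X \<and> I (insert e (insert y X))"
    if *: "e \<notin> X" "I (insert e X)" "e \<notin> Y" "I (insert e Y)" "card X < card Y" for X Y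
  proof -
    have "finite X" "finite Y"
      using matroid_indep_finite[OF M *(2)] matroid_indep_finite[OF M *(4)] by auto
    then have "card (insert e X) < card (insert e Y)" using * by simp
    then obtain y where y: "y \<in> insert e Y - insert e X" "I (insert y (insert e X))"
      using matroid_augment[OF M *(2,4)] by blast
    then show ?thesis using *(1,3) by (intro bexI[of _ y]) (auto simp: insert_commute)
  qed
qed auto

text \<open>The basis \<open>A\<close> avoiding \<open>e\<close> shows that \<open>e\<close> is not
  a coloop, so deletion preserves the rank and the comparison is by cardinality.\<close>

lemma basis_deletion_iff:
  assumes M: "matroid E I" and A: "is_basis E I A" "e \<notin> A"
  shows "is_basis (E - {e}) (deletion I e) B \<longleftrightarrow> is_basis E I B \<and> e \<notin> B"
proof
  assume B: "is_basis (E - {e}) (deletion I e) B"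
  then have B': "I B" "e \<notin> B" using basis_indep[OF B] by (auto simp: deletion_def)
  have "deletion I e A" using A basis_indep by (auto simp: deletion_def)
  then have "card A \<le> card B" by (rule basis_card_ge[OF matroid_deletion[OF M] B])
  then show "is_basis E I B \<and> e \<notin> B" using basisI_card[OF M A(1)] B' by blast
next
  assume "is_basis E I B \<and> e \<notin> B"
  then show "is_basis (E - {e}) (deletion I e) B" unfolding is_basis_def deletion_def by blast
qed

lemma basis_contraction_iff:
  assumes M: "matroid E I" and A: "is_basis E I A"
  shows "is_basis (E - {e}) (contraction E I e) B \<longleftrightarrow> e \<notin> B \<and> is_basis E I (insert e B)"
proof
  assume B: "is_basis (E - {e}) (contraction E I e) B"
  then have B': "e \<notin> B" "I (insert e B)" using basis_indep[OF B] by (auto simp: contraction_iff[OF M A])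
  have "is_basis E I (insert e B)" unfolding is_basis_def
  proof (intro conjI allI impI)
    show "insert e B \<subseteq> E" "I (insert e B)" using B' matroid_indep_subset[OF M] by auto
    fix X assume X: "X \<subseteq> E \<and> I X \<and> insert e B \<subseteq> X"
    then have eX: "insert e (X - {e}) = X" by blast
    have "contraction E I e (X - {e})" unfolding contraction_iff[OF M A] using X eX by auto
    moreover have "X - {e} \<subseteq> E - {e}" "B \<subseteq> X - {e}" using X B'(1) by auto
    ultimately have "X - {e} = B" using B unfolding is_basis_def by metis
    then show "X = insert e B" using eX by simp
  qed
  then show "e \<notin> B \<and> is_basis E I (insert e B)" using B' by blast
next
  assume B: "e \<notin> B \<and> is_basis E I (insert e B)"
  show "is_basis (E - {e}) (contraction E I e) B" unfolding is_basis_def contraction_iff[OF M A]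
  proof (intro conjI allI impI)
    show "B \<subseteq> E - {e}" using B basis_subset by blast
    show "e \<notin> B" "I (insert e B)" using B basis_indep by auto
    fix X assume X: "X \<subseteq> E - {e} \<and> (e \<notin> X \<and> I (insert e X)) \<and> B \<subseteq> X"
    then have "insert e X \<subseteq> E \<and> I (insert e X) \<and> insert e B \<subseteq> insert e X"
      using matroid_indep_subset[OF M] by blast
    then have "insert e X = insert e B" using B unfolding is_basis_def by blast
    then show "X = B" using X B by (simp add: insert_ident)
  qed
qed

lemma circuit_deletion_iff: "circuit (E - {e}) (deletion I e) C \<longleftrightarrow> circuit E I C \<and> e \<notin> C"
  unfolding circuit_def deletion_def by blast

lemma circuit_contractionD:
  assumes M: "matroid E I" and A: "is_basis E I A" and e: "I {e}"
    and C: "circuit (E - {e}) (contraction E I e) C"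
  shows "e \<notin> C" "circuit E I C \<or> (I C \<and> circuit E I (insert e C))"
proof -
  show eC: "e \<notin> C" using circuit_subset[OF C] by blast
  have dep: "\<not> I (insert e C)" using circuit_dep[OF C] eC by (auto simp: contraction_iff[OF M A])
  have ind: "I (insert e (C - {x}))" if "x \<in> C" for x
    using circuit_indep_Diff[OF C that] by (auto simp: contraction_iff[OF M A])
  show "circuit E I C \<or> (I C \<and> circuit E I (insert e C))"
  proof (cases "I C")
    case False
    have "I (C - {x})" if "x \<in> C" for x
      using matroid_indep_mono[OF M ind[OF that]] by blast
    then show ?thesis using False circuit_subset[OF C] unfolding circuit_def by blast
  next
    case True
    have "I (insert e C - {x})" if "x \<in> insert e C" for x
    proof (cases "x = e")
      case True
      then show ?thesis using \<open>I C\<close> eC by simp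
    next
      case False
      then have "insert e C - {x} = insert e (C - {x})" by blast
      then show ?thesis using ind False that by simp
    qed
    moreover have "insert e C \<subseteq> E"
      using circuit_subset[OF C] matroid_indep_subset[OF M e] by blast
    ultimately show ?thesis using True dep unfolding circuit_def by blast
  qed
qed

text \<open>A cocircuit of the deletion meets all bases avoiding \<open>e\<close>. Either it meets
  the bases through \<open>e\<close> as well, or one of these misses it, and that basis witnesses
  the minimality of \<open>insert e D\<close> at \<open>e\<close>.\<close>

lemma cocircuit_deletionD:
  assumes M: "matroid E I" and A: "is_basis E I A" "e \<notin> A" and e: "e \<in> E"
    and D: "cocircuit (E - {e}) (deletion I e) D"
  shows "e \<notin> D" "cocircuit E I D \<or> cocircuit E I (insert e D)"
proof -
  note bases = basis_deletion_iff[OF M A]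
  show eD: "e \<notin> D" using cocircuit_subset[OF D] by blast
  have DE: "D \<subseteq> E" using cocircuit_subset[OF D] by blast
  have meets: "D \<inter> B \<noteq> {}" if "is_basis E I B" "e \<notin> B" for B
    using cocircuit_meets[OF D] that bases by blast
  have minimal: "\<exists>B. is_basis E I B \<and> e \<notin> B \<and> (D - {x}) \<inter> B = {}" if "x \<in> D" for x
    using cocircuit_minimal[OF D that] bases by blast
  show "cocircuit E I D \<or> cocircuit E I (insert e D)"
  proof (cases "\<forall>B. is_basis E I B \<longrightarrow> D \<inter> B \<noteq> {}")
    case True
    then show ?thesis using DE minimal unfolding cocircuit_def by blast
  next
    case False
    then obtain B where B: "is_basis E I B" "D \<inter> B = {}" by blast
    have "insert e D \<inter> B' \<noteq> {}" if "is_basis E I B'" for B' using meets[OF that] by blast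
    moreover have "\<exists>B. is_basis E I B \<and> (insert e D - {x}) \<inter> B = {}" if "x \<in> insert e D" for x
    proof (cases "x = e")
      case True
      then show ?thesis using B by blast
    next
      case False
      then have "x \<in> D" using that by blast
      from minimal[OF this] show ?thesis by blast
    qed
    moreover have "insert e D \<subseteq> E" using DE e by blast
    ultimately show ?thesis unfolding cocircuit_def by blast
  qed
qed

lemma cocircuit_contractionD:
  assumes M: "matroid E I" and A: "is_basis E I A" and e: "I {e}"
    and D: "cocircuit (E - {e}) (contraction E I e) D"
  shows "e \<notin> D" "cocircuit E I D"
proof -
  note bases = basis_contraction_iff[OF M A]
  show eD: "e \<notin> D" using cocircuit_subset[OF D] by blast
  show "cocircuit E I D" unfolding cocircuit_def
  proof (intro conjI allI impI ballI)
    show "D \<subseteq> E" using cocircuit_subset[OF D] by blast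
  next
    fix B assume B: "is_basis E I B"
    \<comment> \<open>Any basis can be exchanged into one through \<open>e\<close> using only its
      own elements. As \<open>D\<close> avoids \<open>e\<close>, meeting \<open>Z - {e}\<close>
      means meeting \<open>B\<close>.\<close>
    obtain Z where Z: "is_basis E I Z" "e \<in> Z" "Z \<subseteq> insert e B"
      using basis_extend[OF M B e] by auto
    have "insert e (Z - {e}) = Z" using Z(2) by blast
    then have "is_basis (E - {e}) (contraction E I e) (Z - {e})" using bases Z(1) by simp
    from cocircuit_meets[OF D this] show "D \<inter> B \<noteq> {}" using Z(3) by blast
  next
    fix x assume "x \<in> D"
    from cocircuit_minimal[OF D this] obtain B where
      "is_basis (E - {e}) (contraction E I e) B" "(D - {x}) \<inter> B = {}" by blast
    then have "is_basis E I (insert e B)" "(D - {x}) \<inter> insert e B = {}" using bases eD by auto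
    then show "\<exists>B. is_basis E I B \<and> (D - {x}) \<inter> B = {}" by blast
  qed
qed

subsection \<open>Signed circuit and cocircuit matrices\<close>

text \<open>The part of \<open>admissible\<close> that does not mention the matrix. A single pair of
  signings of M has to be transported to two minors with different fundamental cocircuits.\<close>

definition signing :: "nat \<Rightarrow> (nat set \<Rightarrow> bool) \<Rightarrow> (nat set \<Rightarrow> nat \<Rightarrow> 'a::field) \<Rightarrow> (nat set \<Rightarrow> nat \<Rightarrow> 'a) \<Rightarrow> bool" where
  "signing m I \<sigma> \<tau> \<longleftrightarrow>
     (\<forall>C. circuit {1..m} I C \<longrightarrow> (\<forall>e. (e \<in> C \<longrightarrow> \<sigma> C e \<in> {1, -1}) \<and> (e \<notin> C \<longrightarrow> \<sigma> C e = 0))) \<and>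
     (\<forall>D. cocircuit {1..m} I D \<longrightarrow> (\<forall>e. (e \<in> D \<longrightarrow> \<tau> D e \<in> {1, -1}) \<and> (e \<notin> D \<longrightarrow> \<tau> D e = 0))) \<and>
     (\<forall>C D. circuit {1..m} I C \<and> cocircuit {1..m} I D \<longrightarrow> (\<Sum>e\<in>{1..m}. \<sigma> C e * \<tau> D e) = 0)"

lemma admissible_iff:
  "admissible m s I a \<longleftrightarrow> (\<exists>\<sigma> \<tau>. signing m I \<sigma> \<tau> \<and>
     (\<forall>j\<in>{m-s+1..m}. \<forall>i\<in>{1..m}. a j i = \<tau> (coc {1..m} I {m-s+1..m} j) i))"
  unfolding admissible_def signing_def by simp

text \<open>The space W: the row space of a representation of the matroid over k, recovered from the
  signs. Coordinates outside \<open>{1..m}\<close> are unconstrained.\<close>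

definition circuit_orth :: "nat \<Rightarrow> (nat set \<Rightarrow> bool) \<Rightarrow> (nat set \<Rightarrow> nat \<Rightarrow> 'a::field) \<Rightarrow> (nat \<Rightarrow> 'a) set" where
  "circuit_orth m I \<sigma> = {w. \<forall>C. circuit {1..m} I C \<longrightarrow> (\<Sum>e\<in>{1..m}. \<sigma> C e * w e) = 0}"

lemma fun_subspace_circuit_orth: "fun_subspace (circuit_orth m I \<sigma>)"
  unfolding fun_subspace_def circuit_orth_def
  by (simp add: distrib_left sum.distrib mult.left_commute[of _ _ "_ :: 'a"] flip: sum_distrib_left)

context
  fixes m :: nat and I :: "nat set \<Rightarrow> bool" and \<sigma> \<tau> :: "nat set \<Rightarrow> nat \<Rightarrow> 'a::field"
  assumes sign: "signing m I \<sigma> \<tau>"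
begin

lemma circuit_sign: "circuit {1..m} I C \<Longrightarrow> e \<in> C \<Longrightarrow> \<sigma> C e \<noteq> 0"
  and circuit_sign_outside: "circuit {1..m} I C \<Longrightarrow> e \<notin> C \<Longrightarrow> \<sigma> C e = 0"
  and cocircuit_sign_square: "cocircuit {1..m} I D \<Longrightarrow> e \<in> D \<Longrightarrow> \<tau> D e * \<tau> D e = 1"
  and cocircuit_sign_outside: "cocircuit {1..m} I D \<Longrightarrow> e \<notin> D \<Longrightarrow> \<tau> D e = 0"
  and sign_orth: "circuit {1..m} I C \<Longrightarrow> cocircuit {1..m} I D \<Longrightarrow> (\<Sum>e\<in>{1..m}. \<sigma> C e * \<tau> D e) = 0"
  using sign unfolding signing_def by fastforce+

text \<open>A single common element would leave one nonzero term in the orthogonality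
  relation.\<close>

lemma circuit_cocircuit_inter:
  assumes C: "circuit {1..m} I C" and D: "cocircuit {1..m} I D"
  shows "C \<inter> D \<noteq> {x}"
proof
  assume x: "C \<inter> D = {x}"
  then have "x \<in> C" "x \<in> D" by auto
  have "\<sigma> C e * \<tau> D e = (if e = x then \<sigma> C x * \<tau> D x else 0)" for e
    using x circuit_sign_outside[OF C] cocircuit_sign_outside[OF D] by auto
  then have "(\<Sum>e\<in>{1..m}. \<sigma> C e * \<tau> D e) = (\<Sum>e\<in>{1..m}. if e = x then \<sigma> C x * \<tau> D x else 0)"
    by (intro sum.cong) auto
  also have "\<dots> = \<sigma> C x * \<tau> D x"
    using circuit_subset[OF C] \<open>x \<in> C\<close> by auto
  finally have "\<sigma> C x * \<tau> D x = 0" using sign_orth[OF C D] by simp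
  then show False using circuit_sign[OF C \<open>x \<in> C\<close>] cocircuit_sign_square[OF D \<open>x \<in> D\<close>] by auto
qed

lemma cocircuit_sign_orth: "cocircuit {1..m} I D \<Longrightarrow> \<tau> D \<in> circuit_orth m I \<sigma>"
  unfolding circuit_orth_def using sign_orth by simp

lemma indep_on_circuit_orth:
  assumes M: "matroid {1..m} I" and B: "is_basis {1..m} I B" and X: "I X"
  shows "indep_on (circuit_orth m I \<sigma>) X"
proof -
  obtain A where A: "is_basis {1..m} I A" "X \<subseteq> A" using basis_extend[OF M B X] by blast
  have "indep_on (circuit_orth m I \<sigma>) A" unfolding indep_on_def
  proof
    fix x assume x: "x \<in> A"
    let ?D = "coc {1..m} I A x"
    note D = coc_cocircuit[OF M A(1) x]
    \<comment> \<open>The signed fundamental cocircuit at \<open>x\<close> vanishes on the rest of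
      \<open>A\<close>. Its value at \<open>x\<close> is 1 or -1, so multiplying by that value
      normalizes it to 1.\<close>
    have "(\<lambda>i. \<tau> ?D x * \<tau> ?D i) \<in> circuit_orth m I \<sigma>"
      by (rule fun_subspace_scale[OF fun_subspace_circuit_orth cocircuit_sign_orth[OF D(1)]])
    moreover have "\<forall>y\<in>A - {x}. \<tau> ?D x * \<tau> ?D y = 0"
      using D(2) cocircuit_sign_outside[OF D(1)] by auto
    ultimately show "\<exists>w\<in>circuit_orth m I \<sigma>. w x = 1 \<and> (\<forall>y\<in>A - {x}. w y = 0)"
      using cocircuit_sign_square[OF D(1,3)] by (intro bexI[of _ "\<lambda>i. \<tau> ?D x * \<tau> ?D i"]) auto
  qed
  then show ?thesis using indep_on_subset A(2) by blast
qed

lemma circuit_not_indep_on: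
  assumes M: "matroid {1..m} I" and C: "circuit {1..m} I C"
  shows "\<not> indep_on (circuit_orth m I \<sigma>) C"
proof
  assume ind: "indep_on (circuit_orth m I \<sigma>) C"
  obtain x where x: "x \<in> C" using circuit_nonempty[OF M C] by blast
  then obtain w where w: "w \<in> circuit_orth m I \<sigma>" "w x = 1" "\<forall>y\<in>C - {x}. w y = 0"
    using ind unfolding indep_on_def by blast
  have "\<sigma> C e * w e = (if e = x then \<sigma> C x else 0)" for e
    using w(2,3) circuit_sign_outside[OF C] x by (cases "e \<in> C") auto
  then have "(\<Sum>e\<in>{1..m}. \<sigma> C e * w e) = (\<Sum>e\<in>{1..m}. if e = x then \<sigma> C x else 0)"
    by (intro sum.cong) auto
  also have "\<dots> = \<sigma> C x" using circuit_subset[OF C] x by auto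
  finally show False using w(1) C circuit_sign[OF C x] by (simp add: circuit_orth_def)
qed

text \<open>Orthogonality to the fundamental circuit of \<open>e\<close> leaves only the term at
  \<open>e\<close>.\<close>

lemma circuit_orth_zero_on_basis:
  assumes M: "matroid {1..m} I" and B: "is_basis {1..m} I B"
    and w: "w \<in> circuit_orth m I \<sigma>" "\<forall>b\<in>B. w b = 0" and e: "e \<in> {1..m}"
  shows "w e = 0"
proof (cases "e \<in> B")
  case False
  let ?C = "ci {1..m} I B e"
  note C = ci_circuit[OF M B e False]
  have "\<sigma> ?C i * w i = (if i = e then \<sigma> ?C e * w e else 0)" for i
    using w(2) C(2) circuit_sign_outside[OF C(1)] by (cases "i \<in> ?C") auto
  then have "(\<Sum>i\<in>{1..m}. \<sigma> ?C i * w i) = (\<Sum>i\<in>{1..m}. if i = e then \<sigma> ?C e * w e else 0)"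
    by (intro sum.cong) auto
  also have "\<dots> = \<sigma> ?C e * w e" using e by auto
  finally have "\<sigma> ?C e * w e = 0" using w(1) C(1) by (simp add: circuit_orth_def)
  then show ?thesis using circuit_sign[OF C(1) mem_ci_self[OF M B e False]] by simp
qed (use w in simp)

lemma theta_eq_linear_form:
  assumes M: "matroid {1..m} I" and B: "is_basis {1..m} I {m-s+1..m}"
    and a: "\<And>j i. j \<in> {m-s+1..m} \<Longrightarrow> i \<in> {1..m} \<Longrightarrow> a j i = \<tau> (coc {1..m} I {m-s+1..m} j) i"
    and j: "j \<in> {m-s+1..m}"
  shows "theta m s I a j = linear_form {1..m} (\<tau> (coc {1..m} I {m-s+1..m} j))"
  unfolding theta_def linear_form_def
proof (rule sum.mono_neutral_cong_left)
  note D = coc_cocircuit[OF M B j]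
  show "coc {1..m} I {m-s+1..m} j \<subseteq> {1..m}" by (rule cocircuit_subset[OF D(1)])
  then show "Poly_Mapping.single (Poly_Mapping.single i 1) (a j i)
    = Poly_Mapping.single (Poly_Mapping.single i 1) (\<tau> (coc {1..m} I {m-s+1..m} j) i)"
    if "i \<in> coc {1..m} I {m-s+1..m} j" for i
    using a[OF j] that by auto
  show "\<forall>i\<in>{1..m} - coc {1..m} I {m-s+1..m} j.
      Poly_Mapping.single (Poly_Mapping.single i 1) (\<tau> (coc {1..m} I {m-s+1..m} j) i) = 0"
    using cocircuit_sign_outside[OF D(1)] by simp
qed simp

text \<open>The fundamental cocircuits generate W on \<open>{1..m}\<close>: the combination with
  coefficients \<open>w j * ?t j j\<close>, where the sign \<open>?t j j\<close> is its own inverse,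
  agrees with \<open>w\<close> on the basis and hence everywhere on \<open>{1..m}\<close>.\<close>

lemma linear_form_in_JN:
  assumes M: "matroid {1..m} I" and B: "is_basis {1..m} I {m-s+1..m}"
    and a: "\<And>j i. j \<in> {m-s+1..m} \<Longrightarrow> i \<in> {1..m} \<Longrightarrow> a j i = \<tau> (coc {1..m} I {m-s+1..m} j) i"
    and w: "w \<in> circuit_orth m I \<sigma>"
  shows "linear_form {1..m} w \<in> JN m s I a"
proof -
  let ?B = "{m-s+1..m}"
  let ?t = "\<lambda>j. \<tau> (coc {1..m} I ?B j)"
  let ?w = "\<lambda>i. \<Sum>j\<in>?B. (w j * ?t j j) * ?t j i"
  note D = coc_cocircuit[OF M B]
  have t: "?t j \<in> circuit_orth m I \<sigma>" if "j \<in> ?B" for j by (rule cocircuit_sign_orth[OF D(1)[OF that]])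
  have "?w \<in> circuit_orth m I \<sigma>"
    by (rule fun_subspace_sum[OF fun_subspace_circuit_orth _ t]) simp
  then have diff: "(\<lambda>i. w i - 1 * ?w i) \<in> circuit_orth m I \<sigma>"
    by (rule fun_subspace_diff[OF fun_subspace_circuit_orth w])
  have "w b - 1 * ?w b = 0" if b: "b \<in> ?B" for b
  proof -
    have "(w j * ?t j j) * ?t j b = (if j = b then w b else 0)" if j: "j \<in> ?B" for j
    proof (cases "j = b")
      case True
      then show ?thesis using cocircuit_sign_square[OF D(1,3)[OF b]] by (simp add: mult.assoc)
    next
      case False
      then have "b \<notin> coc {1..m} I ?B j" using D(2)[OF j] b by auto
      then show ?thesis using False cocircuit_sign_outside[OF D(1)[OF j]] by simp
    qed
    then have "?w b = (\<Sum>j\<in>?B. if j = b then w b else 0)" by (rule sum.cong[OF refl])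
    then show ?thesis using b by simp
  qed
  then have eq: "w i = ?w i" if "i \<in> {1..m}" for i
    using circuit_orth_zero_on_basis[OF M B diff _ that] by simp
  have "linear_form {1..m} w = linear_form {1..m} ?w"
    by (rule linear_form_cong) (rule eq)
  also have "\<dots> = (\<Sum>j\<in>?B. Poly_Mapping.single 0 (w j * ?t j j) * theta m s I a j)"
    unfolding linear_form_combination
    by (rule sum.cong[OF refl]) (simp only: theta_eq_linear_form[OF M B a])
  also have "\<dots> \<in> JN m s I a"
    unfolding JN_def
  proof (rule ideal_in_sum[OF ideal_in_gen_ideal], rule ideal_in_const_mult[OF ideal_in_gen_ideal])
    fix j assume "j \<in> ?B"
    then show "theta m s I a j \<in> gen_ideal {1..m} (SR_gens m I \<union> theta m s I a ` ?B)"
      by (intro gen_ideal_contains) blast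
  qed
  finally show ?thesis .
qed

end

section \<open>Broken circuit monomials in the ideal, and a bound on the size of
  \<open>LN\<close>\<close>

lemma bar_subset: "bar C \<subseteq> C"
  by (auto simp: bar_def)

lemma SR_gens_eq: "SR_gens m I = {mono (squarefree_exp (bar C)) | C. circuit {1..m} I C}"
  by (simp add: SR_gens_def squarefree_exp_def)

lemma ideal_in_JN: "ideal_in {1..m} (JN m s I a)"
  unfolding JN_def by (rule ideal_in_gen_ideal)

lemma broken_circuit_in_JN: "circuit {1..m} I C \<Longrightarrow> mono (squarefree_exp (bar C)) \<in> JN m s I a"
  unfolding JN_def SR_gens_eq by (rule gen_ideal_contains) blast

lemma mono_squarefree_superset:
  fixes J :: "'a::comm_ring_1 mpoly set"
  assumes J: "ideal_in V J" and X: "finite X" "X \<subseteq> V" "Y \<subseteq> X" and Y: "mono (squarefree_exp Y) \<in> J"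
  shows "mono (squarefree_exp X) \<in> J"
proof -
  have "squarefree_exp X = squarefree_exp (X - Y) + squarefree_exp Y"
    unfolding squarefree_exp_def by (rule sum.subset_diff[OF X(3,1)])
  then have "mono (squarefree_exp X) = mono (squarefree_exp (X - Y)) * (mono (squarefree_exp Y) :: 'a mpoly)"
    by (simp only: mono_add)
  moreover have "pvars (mono (squarefree_exp (X - Y)) :: 'a mpoly) \<subseteq> V"
    using X by (auto simp: pvars_mono_iff keys_squarefree_exp)
  ultimately show ?thesis using ideal_in_mult[OF J Y] by simp
qed

text \<open>A violation at \<open>i\<close> yields a circuit inside \<open>i\<close> and the
  elements of \<open>X\<close> above \<open>i\<close>. If the circuit contains \<open>i\<close>,
  then \<open>i\<close> is its minimum, so in either case its broken circuit lies in
  \<open>X\<close>.\<close>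

lemma non_nbc_in_JN:
  assumes M: "matroid {1..m} I" and W: "\<And>Y. I Y \<Longrightarrow> indep_on W Y"
    and X: "X \<subseteq> {1..m}" "\<not> nbc {1..m} W X"
  shows "mono (squarefree_exp X) \<in> JN m s I a"
proof -
  obtain i where i: "i \<in> {1..m}" "\<not> indep_on W (insert i {j\<in>X. i < j})"
    using X(2) unfolding nbc_def by blast
  then have "\<not> I (insert i {j\<in>X. i < j})" using W by blast
  moreover have "insert i {j\<in>X. i < j} \<subseteq> {1..m}" using i(1) X(1) by blast
  ultimately obtain C where C: "C \<subseteq> insert i {j\<in>X. i < j}" "circuit {1..m} I C"
    using circuit_exists[OF M] by blast
  have "bar C \<subseteq> X"
  proof
    fix x assume x: "x \<in> bar C"
    show "x \<in> X"
    proof (rule ccontr)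
      assume "x \<notin> X"
      then have "x = i" using C(1) x unfolding bar_def by blast
      then have "i \<in> C" using x by (simp add: bar_def)
      moreover have "i \<le> y" if "y \<in> C" for y using C(1) that by auto
      ultimately have "Min C = i" using circuit_finite[OF M C(2)] by (intro Min_eqI) auto
      then show False using x \<open>x = i\<close> by (simp add: bar_def)
    qed
  qed
  then show ?thesis
    using mono_squarefree_superset[OF ideal_in_JN finite_subset[OF X(1)] X(1) _ broken_circuit_in_JN[OF C(2)]]
    by blast
qed

lemma broken_circuit_not_subset_nbc:
  assumes M: "matroid {1..m} I" and C: "circuit {1..m} I C" "\<not> indep_on W C"
    and Y: "Y \<in> nbc_bases {1..m} W"
  shows "\<not> bar C \<subseteq> Y"
proof
  assume sub: "bar C \<subseteq> Y"
  have fin: "finite C" "C \<noteq> {}" using circuit_finite[OF M C(1)] circuit_nonempty[OF M C(1)] .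
  have min: "Min C \<in> {1..m}" using Min_in[OF fin] circuit_subset[OF C(1)] by blast
  have "indep_on W (insert (Min C) {j\<in>Y. Min C < j})"
    using Y min unfolding nbc_bases_def nbc_def by blast
  moreover have "C \<subseteq> insert (Min C) {j\<in>Y. Min C < j}"
  proof
    fix x assume x: "x \<in> C"
    then have "Min C \<le> x" using fin by simp
    then show "x \<in> insert (Min C) {j\<in>Y. Min C < j}"
      using x sub unfolding bar_def by (cases "x = Min C") auto
  qed
  ultimately show False using indep_on_subset C(2) by blast
qed

lemma LN_keys: "\<mu> \<in> LN m s I \<Longrightarrow> Poly_Mapping.keys \<mu> \<subseteq> {1..m-s}"
  by (simp add: LN_def)

text \<open>To be used for the minors, where the independence half of the NBC property bounds
  \<open>LN\<close> by any spanning set. \<open>W\<close> may be any subspace with the stated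
  properties, so the spaces inherited from M will do.\<close>

lemma card_LN_le_nbc_bases:
  fixes a :: "nat \<Rightarrow> nat \<Rightarrow> 'a::field"
  assumes M: "matroid {1..m} I" and W: "fun_subspace W" "\<And>Y. I Y \<Longrightarrow> indep_on W Y"
    and lin: "\<And>w. w \<in> W \<Longrightarrow> linear_form {1..m} w \<in> JN m s I a"
    and nbc: "NBC_basis_wrt m s I a"
  shows "finite (LN m s I) \<and> card (LN m s I) \<le> card (nbc_bases {1..m} W)"
proof -
  obtain S :: "'a mpoly set" where S: "finite S" "card S \<le> card (nbc_bases {1..m} W)"
    "spans_mod {1..m} S (JN m s I a)"
    using spanning_set_card_le_nbc_bases[OF finite_atLeastAtMost W(1), of 1 m]
      ideal_in_JN[of m s I a] non_nbc_in_JN[OF M W(2)] lin by blast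
  have "{1..m-s} \<subseteq> {1..m}" by auto
  then have "finite (LN m s I) \<and> card (LN m s I) \<le> card S"
    using nbc LN_keys unfolding NBC_basis_wrt_def
    by (intro card_independent_le_spanning[OF ideal_in_JN S(1,3)]) blast+
  then show ?thesis using S(2) by simp
qed

subsection \<open>Signings of minors\<close>

text \<open>Circuits keep their signs. A cocircuit of the deletion takes the signs of the cocircuit
  of M that it comes from, with the coordinate at \<open>Suc m\<close> reset to 0 as a signing
  requires. Orthogonality survives since the circuits involved avoid \<open>Suc m\<close>.\<close>

lemma signing_deletion:
  assumes M: "matroid {1..Suc m} I" and A: "is_basis {1..Suc m} I A" "Suc m \<notin> A"
    and sign: "signing (Suc m) I \<sigma> \<tau>"
  shows "signing m (deletion I (Suc m)) \<sigma>
    (\<lambda>D. (\<tau> (if cocircuit {1..Suc m} I D then D else insert (Suc m) D))(Suc m := 0))"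
proof -
  have E: "{1..m} = {1..Suc m} - {Suc m}" by auto
  have circ: "circuit {1..Suc m} I C \<and> Suc m \<notin> C" if "circuit {1..m} (deletion I (Suc m)) C" for C
    using that unfolding E circuit_deletion_iff .
  have coc: "Suc m \<notin> D \<and> (cocircuit {1..Suc m} I D \<or> cocircuit {1..Suc m} I (insert (Suc m) D))"
    if "cocircuit {1..m} (deletion I (Suc m)) D" for D
    using cocircuit_deletionD[OF M A _ that[unfolded E]] by simp
  show ?thesis unfolding signing_def
  proof (intro conjI allI impI; (elim conjE)?)
    fix C e assume "circuit {1..m} (deletion I (Suc m)) C"
    then show "e \<in> C \<Longrightarrow> \<sigma> C e \<in> {1, -1}" "e \<notin> C \<Longrightarrow> \<sigma> C e = 0"
      using circ sign unfolding signing_def by blast+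
  next
    fix D e assume D: "cocircuit {1..m} (deletion I (Suc m)) D"
    define D' where "D' = (if cocircuit {1..Suc m} I D then D else insert (Suc m) D)"
    have D': "cocircuit {1..Suc m} I D'" "D' - {Suc m} = D" "Suc m \<notin> D" using coc[OF D] by (auto simp: D'_def)
    have sg: "(e \<in> D' \<longrightarrow> \<tau> D' e \<in> {1, -1}) \<and> (e \<notin> D' \<longrightarrow> \<tau> D' e = 0)"
      using D'(1) sign unfolding signing_def by blast
    show "((\<tau> (if cocircuit {1..Suc m} I D then D else insert (Suc m) D))(Suc m := 0)) e \<in> {1, -1}" if "e \<in> D"
      unfolding D'_def[symmetric] using sg D'(2,3) that by auto
    show "((\<tau> (if cocircuit {1..Suc m} I D then D else insert (Suc m) D))(Suc m := 0)) e = 0" if "e \<notin> D"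
      unfolding D'_def[symmetric] using sg D'(2,3) that by auto
  next
    fix C D assume C: "circuit {1..m} (deletion I (Suc m)) C" and D: "cocircuit {1..m} (deletion I (Suc m)) D"
    define D' where "D' = (if cocircuit {1..Suc m} I D then D else insert (Suc m) D)"
    have "cocircuit {1..Suc m} I D'" using coc[OF D] by (auto simp: D'_def)
    then have "(\<Sum>e\<in>{1..Suc m}. \<sigma> C e * \<tau> D' e) = 0" using sign circ[OF C] unfolding signing_def by blast
    moreover have "\<sigma> C (Suc m) = 0" using circ[OF C] sign unfolding signing_def by blast
    ultimately have 0: "(\<Sum>e\<in>{1..m}. \<sigma> C e * \<tau> D' e) = 0" by simp
    have "(\<Sum>e\<in>{1..m}. \<sigma> C e * ((\<tau> D')(Suc m := 0)) e) = (\<Sum>e\<in>{1..m}. \<sigma> C e * \<tau> D' e)"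
      by (rule sum.cong) auto
    then show "(\<Sum>e\<in>{1..m}. \<sigma> C e * ((\<tau> (if cocircuit {1..Suc m} I D then D else insert (Suc m) D))(Suc m := 0)) e) = 0"
      unfolding D'_def[symmetric] using 0 by simp
  qed
qed

lemma circuit_orth_deletion:
  assumes sign: "signing (Suc m) I \<sigma> \<tau>" and w: "w \<in> circuit_orth (Suc m) I \<sigma>"
  shows "w \<in> circuit_orth m (deletion I (Suc m)) \<sigma>"
  unfolding circuit_orth_def
proof (intro CollectI allI impI)
  have E: "{1..m} = {1..Suc m} - {Suc m}" by auto
  fix C assume "circuit {1..m} (deletion I (Suc m)) C"
  then have C: "circuit {1..Suc m} I C" "Suc m \<notin> C" unfolding E circuit_deletion_iff by auto
  have "\<sigma> C (Suc m) = 0" using C sign unfolding signing_def by blast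
  moreover have "(\<Sum>e\<in>{1..Suc m}. \<sigma> C e * w e) = 0" using w C(1) unfolding circuit_orth_def by blast
  ultimately show "(\<Sum>e\<in>{1..m}. \<sigma> C e * w e) = 0" by simp
qed

text \<open>Dual to the deletion: a circuit of the contraction is a circuit of M, possibly with
  \<open>n\<close> removed, and inherits the signs of that circuit.\<close>

definition contraction_sign :: "nat \<Rightarrow> (nat set \<Rightarrow> bool) \<Rightarrow> (nat set \<Rightarrow> nat \<Rightarrow> 'a::field) \<Rightarrow> nat set \<Rightarrow> nat \<Rightarrow> 'a" where
  "contraction_sign n I \<sigma> C = (\<sigma> (if circuit {1..n} I C then C else insert n C))(n := 0)"

lemma circuit_orth_contraction:
  assumes M: "matroid {1..Suc m} I" and A: "is_basis {1..Suc m} I A" and e: "I {Suc m}"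
    and w: "w \<in> circuit_orth (Suc m) I \<sigma>" "w (Suc m) = 0"
  shows "w \<in> circuit_orth m (contraction {1..Suc m} I (Suc m)) (contraction_sign (Suc m) I \<sigma>)"
  unfolding circuit_orth_def
proof (intro CollectI allI impI)
  have E: "{1..m} = {1..Suc m} - {Suc m}" by auto
  fix C assume C: "circuit {1..m} (contraction {1..Suc m} I (Suc m)) C"
  define C' where "C' = (if circuit {1..Suc m} I C then C else insert (Suc m) C)"
  have "circuit {1..Suc m} I C'"
    using circuit_contractionD[OF M A e C[unfolded E]] by (auto simp: C'_def)
  then have "(\<Sum>e\<in>{1..Suc m}. \<sigma> C' e * w e) = 0" using w(1) unfolding circuit_orth_def by blast
  then have 0: "(\<Sum>e\<in>{1..m}. \<sigma> C' e * w e) = 0" using w(2) by simp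
  have "(\<Sum>e\<in>{1..m}. ((\<sigma> C')(Suc m := 0)) e * w e) = (\<Sum>e\<in>{1..m}. \<sigma> C' e * w e)"
    by (rule sum.cong) auto
  then show "(\<Sum>e\<in>{1..m}. contraction_sign (Suc m) I \<sigma> C e * w e) = 0"
    unfolding contraction_sign_def C'_def[symmetric] using 0 by simp
qed

lemma signing_contraction:
  assumes M: "matroid {1..Suc m} I" and A: "is_basis {1..Suc m} I A" and e: "I {Suc m}"
    and sign: "signing (Suc m) I \<sigma> \<tau>"
  shows "signing m (contraction {1..Suc m} I (Suc m)) (contraction_sign (Suc m) I \<sigma>) \<tau>"
proof -
  let ?I = "contraction {1..Suc m} I (Suc m)"
  have E: "{1..m} = {1..Suc m} - {Suc m}" by auto
  have coc: "Suc m \<notin> D \<and> cocircuit {1..Suc m} I D" if "cocircuit {1..m} ?I D" for D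
    using cocircuit_contractionD[OF M A e that[unfolded E]] by simp
  show ?thesis unfolding signing_def
  proof (intro conjI allI impI; (elim conjE)?)
    fix C f assume C: "circuit {1..m} ?I C"
    define C' where "C' = (if circuit {1..Suc m} I C then C else insert (Suc m) C)"
    have C': "circuit {1..Suc m} I C'" "C' - {Suc m} = C" "Suc m \<notin> C"
      using circuit_contractionD[OF M A e C[unfolded E]] by (auto simp: C'_def)
    have sg: "(f \<in> C' \<longrightarrow> \<sigma> C' f \<in> {1, -1}) \<and> (f \<notin> C' \<longrightarrow> \<sigma> C' f = 0)"
      using C'(1) sign unfolding signing_def by blast
    show "contraction_sign (Suc m) I \<sigma> C f \<in> {1, -1}" if "f \<in> C"
      unfolding contraction_sign_def C'_def[symmetric] using sg C'(2,3) that by auto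
    show "contraction_sign (Suc m) I \<sigma> C f = 0" if "f \<notin> C"
      unfolding contraction_sign_def C'_def[symmetric] using sg C'(2,3) that by auto
  next
    fix D f assume "cocircuit {1..m} ?I D"
    then show "f \<in> D \<Longrightarrow> \<tau> D f \<in> {1, -1}" "f \<notin> D \<Longrightarrow> \<tau> D f = 0"
      using coc sign unfolding signing_def by blast+
  next
    fix C D assume C: "circuit {1..m} ?I C" and D: "cocircuit {1..m} ?I D"
    have "\<tau> D \<in> circuit_orth (Suc m) I \<sigma>" "\<tau> D (Suc m) = 0"
      using coc[OF D] cocircuit_sign_orth[OF sign] cocircuit_sign_outside[OF sign] by auto
    from circuit_orth_contraction[OF M A e this] C
    show "(\<Sum>f\<in>{1..m}. contraction_sign (Suc m) I \<sigma> C f * \<tau> D f) = 0"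
      unfolding circuit_orth_def by blast
  qed
qed

subsection \<open>The monomials of a series pair\<close>

context
  fixes m s :: nat and I :: "nat set \<Rightarrow> bool"
  assumes M: "matroid {1..m} I" and B: "is_basis {1..m} I {m-s+1..m}"
begin

lemma mem_ci_initial:
  assumes "i \<in> {1..m-s}"
  shows "i \<in> ci {1..m} I {m-s+1..m} i" "circuit {1..m} I (ci {1..m} I {m-s+1..m} i)"
    "ci {1..m} I {m-s+1..m} i \<subseteq> insert i {m-s+1..m}"
proof -
  have i: "i \<in> {1..m}" "i \<notin> {m-s+1..m}" using assms by auto
  show "i \<in> ci {1..m} I {m-s+1..m} i" "circuit {1..m} I (ci {1..m} I {m-s+1..m} i)"
    "ci {1..m} I {m-s+1..m} i \<subseteq> insert i {m-s+1..m}"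
    using mem_ci_self[OF M B i] ci_circuit[OF M B i] .
qed

text \<open>The description in \<open>mC\<close> is unique because \<open>i\<close> is the only
  element of its fundamental circuit outside the basis.\<close>

lemma mC_fundamental:
  assumes i: "i \<in> {1..m-s}" "C = ci {1..m} I {m-s+1..m} i"
  shows "mC m s I C = Poly_Mapping.single i (card (bar C))"
proof -
  have "(THE i'. i' \<in> {1..m-s} \<and> C = ci {1..m} I {m-s+1..m} i') = i"
  proof (rule the_equality)
    show "i \<in> {1..m-s} \<and> C = ci {1..m} I {m-s+1..m} i" using i by simp
    fix i' assume i': "i' \<in> {1..m-s} \<and> C = ci {1..m} I {m-s+1..m} i'"
    then have "i' \<in> C" using mem_ci_initial(1)[of i'] by simp
    then have "i' \<in> insert i {m-s+1..m}" using mem_ci_initial(3)[OF i(1)] i(2) by blast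
    then show "i' = i" using i' by auto
  qed
  then show ?thesis unfolding mC_def using i by auto
qed

lemma mC_nonfundamental:
  "\<forall>i\<in>{1..m-s}. C \<noteq> ci {1..m} I {m-s+1..m} i \<Longrightarrow>
    mC m s I C = (\<Sum>j\<in>bar C. Poly_Mapping.single (d_idx m s I j) 1)"
  unfolding mC_def by simp

end

text \<open>The two minors are taken at \<open>e\<^sub>n\<close>, where \<open>n = a + q + 1\<close>; \<open>M\<close> has rank \<open>q + 1\<close>
  and \<open>e\<^sub>a\<close> is the element in series with \<open>e\<^sub>n\<close>.\<close>

locale series_pair =
  fixes a q n :: nat and I :: "nat set \<Rightarrow> bool" and \<sigma> \<tau> :: "nat set \<Rightarrow> nat \<Rightarrow> 'a::field"
  assumes a_pos: "1 \<le> a" and n_def: "n = Suc (a + q)"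
    and M: "matroid {1..n} I"
    and B: "is_basis {1..n} I {a+1..n}"
    and series: "cocircuit {1..n} I {n, a}"
    and sign: "signing n I \<sigma> \<tau>"
begin

abbreviation (input) "Idel \<equiv> deletion I n"
abbreviation (input) "Icon \<equiv> contraction {1..n} I n"

lemma E_eq: "{1..a+q} = {1..n} - {n}" and insert_E: "insert n {1..a+q} = {1..n}"
  and B_eq: "insert n {a+1..a+q} = {a+1..n}"
  and an: "a < n" "a \<in> {1..n}" "n \<in> {1..n}" "a \<notin> {a+1..n}" "n \<in> {a+1..n}"
  using a_pos by (auto simp: n_def)

lemma indep_n: "I {n}"
  using matroid_indep_mono[OF M basis_indep[OF B]] an(5) by blast

lemma series_circuit: "circuit {1..n} I C \<Longrightarrow> a \<in> C \<longleftrightarrow> n \<in> C"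
  using circuit_cocircuit_inter[OF sign _ series, of C a] circuit_cocircuit_inter[OF sign _ series, of C n] an(1)
  by auto

lemma coc_n: "coc {1..n} I {a+1..n} n = {n, a}"
  by (rule coc_eqI[OF M B an(5) series]) (use an in auto)

lemma basis_exchanged: "is_basis {1..n} I {a..a+q}"
proof -
  have "{a..a+q} = insert a ({a+1..n} - {n})" by (auto simp: n_def)
  moreover have "a \<in> coc {1..n} I {a+1..n} n" unfolding coc_n by blast
  then have "I (insert a ({a+1..n} - {n}))" using mem_coc_iff[OF M B an(5,2,4)] by blast
  ultimately show ?thesis using basis_exchange_card[OF M B an(5), of a] an(4) by simp
qed

lemma n_notin_exchanged: "n \<notin> {a..a+q}"
  by (simp add: n_def)

lemma matroid_del: "matroid {1..a+q} Idel"
  unfolding E_eq by (rule matroid_deletion[OF M])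

lemma basis_del: "is_basis {1..a+q} Idel {a..a+q}"
  unfolding E_eq basis_deletion_iff[OF M basis_exchanged n_notin_exchanged]
  using basis_exchanged n_notin_exchanged by blast

lemma matroid_con: "matroid {1..a+q} Icon"
  unfolding E_eq by (rule matroid_contraction[OF M B indep_n])

lemma basis_con: "is_basis {1..a+q} Icon {a+1..a+q}"
  unfolding E_eq basis_contraction_iff[OF M B] B_eq using B by (simp add: n_def)

lemma circuit_del: "circuit {1..a+q} Idel C \<longleftrightarrow> circuit {1..n} I C \<and> n \<notin> C"
  unfolding E_eq by (rule circuit_deletion_iff)

lemma circuit_con_obtain:
  assumes "circuit {1..a+q} Icon C"
  obtains C' where "circuit {1..n} I C'" "C = C' - {n}"
proof -
  have "n \<notin> C" "circuit {1..n} I C \<or> circuit {1..n} I (insert n C)"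
    using circuit_contractionD[OF M B indep_n] assms unfolding E_eq by blast+
  then show ?thesis using that[of C] that[of "insert n C"] by auto
qed

text \<open>For a general element, \<open>C - {n}\<close> only contains a circuit of the
  contraction. Here that circuit comes from a circuit \<open>K'\<close> of M, and if
  \<open>n\<close> is in \<open>K'\<close> then so is \<open>a\<close>; thus \<open>a\<close> and
  with it \<open>n\<close> are in \<open>C\<close>. Hence \<open>K'\<close> is contained in
  \<open>C\<close> and equals it.\<close>

lemma circuit_con:
  assumes C: "circuit {1..n} I C"
  shows "circuit {1..a+q} Icon (C - {n})"
proof -
  have "\<not> I (insert n (C - {n}))"
    by (rule circuit_subset_dep[OF M C]) blast
  then have "\<not> Icon (C - {n})" unfolding contraction_iff[OF M B] by blast
  moreover have sub: "C - {n} \<subseteq> {1..a+q}" using circuit_subset[OF C] unfolding E_eq by blast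
  ultimately obtain K where K: "K \<subseteq> C - {n}" "circuit {1..a+q} Icon K"
    using circuit_exists[OF matroid_con] by blast
  obtain K' where K': "circuit {1..n} I K'" "K = K' - {n}" using circuit_con_obtain[OF K(2)] .
  have "n \<in> C" if "n \<in> K'"
  proof -
    have "a \<in> K'" using series_circuit[OF K'(1)] that by blast
    then have "a \<in> C" using K(1) K'(2) an(1) by auto
    then show ?thesis using series_circuit[OF C] by blast
  qed
  then have "K' \<subseteq> C" using K(1) K'(2) by blast
  then have "K' = C" using circuit_antichain[OF M K'(1) C] by blast
  then show ?thesis using K(2) K'(2) by simp
qed

lemma ci_props:
  assumes i: "i \<in> {1..a}"
  shows "circuit {1..n} I (ci {1..n} I {a+1..n} i)" "ci {1..n} I {a+1..n} i \<subseteq> insert i {a+1..n}"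
    "i \<in> ci {1..n} I {a+1..n} i"
proof -
  have i': "i \<in> {1..n}" "i \<notin> {a+1..n}" using i an(1) by auto
  show "circuit {1..n} I (ci {1..n} I {a+1..n} i)" "ci {1..n} I {a+1..n} i \<subseteq> insert i {a+1..n}"
    "i \<in> ci {1..n} I {a+1..n} i"
    using ci_circuit[OF M B i'] mem_ci_self[OF M B i'] .
qed

lemma ci_avoids:
  assumes i: "i \<in> {1..a-1}"
  shows "a \<notin> ci {1..n} I {a+1..n} i" "n \<notin> ci {1..n} I {a+1..n} i"
proof -
  have i': "i \<in> {1..a}" "i \<noteq> a" using i by auto
  show "a \<notin> ci {1..n} I {a+1..n} i" using ci_props(2)[OF i'(1)] i'(2) an(4) by blast
  then show "n \<notin> ci {1..n} I {a+1..n} i" using series_circuit[OF ci_props(1)[OF i'(1)]] by blast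
qed

lemma ci_del:
  assumes i: "i \<in> {1..a-1}"
  shows "ci {1..a+q} Idel {a..a+q} i = ci {1..n} I {a+1..n} i"
proof (rule ci_eqI[OF matroid_del basis_del])
  have i': "i \<in> {1..a}" using i by auto
  show "i \<notin> {a..a+q}" using i by auto
  show "circuit {1..a+q} Idel (ci {1..n} I {a+1..n} i)"
    unfolding circuit_del using ci_props(1)[OF i'] ci_avoids(2)[OF i] by blast
  have "insert i {a+1..n} - {n} \<subseteq> insert i {a..a+q}" by (auto simp: n_def)
  then show "ci {1..n} I {a+1..n} i \<subseteq> insert i {a..a+q}"
    using ci_props(2)[OF i'] ci_avoids(2)[OF i] by blast
qed

lemma ci_con:
  assumes i: "i \<in> {1..a}"
  shows "ci {1..a+q} Icon {a+1..a+q} i = ci {1..n} I {a+1..n} i - {n}"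
proof (rule ci_eqI[OF matroid_con basis_con])
  show "i \<notin> {a+1..a+q}" using i by auto
  show "circuit {1..a+q} Icon (ci {1..n} I {a+1..n} i - {n})"
    by (rule circuit_con[OF ci_props(1)[OF i]])
  have "insert i {a+1..n} - {n} \<subseteq> insert i {a+1..a+q}" by (auto simp: n_def)
  then show "ci {1..n} I {a+1..n} i - {n} \<subseteq> insert i {a+1..a+q}"
    using ci_props(2)[OF i] by blast
qed

lemma coc_con:
  assumes j: "j \<in> {a+1..a+q}"
  shows "coc {1..a+q} Icon {a+1..a+q} j = coc {1..n} I {a+1..n} j"
proof -
  have j': "j \<in> {a+1..n}" and jn: "j \<noteq> n" using j by (auto simp: n_def)
  have eq: "{a+1..n} - {j} = insert n ({a+1..a+q} - {j})" using jn B_eq by blast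
  have n: "n \<notin> {a+1..a+q}" by (simp add: n_def)
  have Eq: "x \<in> {1..a+q} \<longleftrightarrow> x \<in> {1..n} \<and> x \<noteq> n" for x unfolding E_eq by blast
  show ?thesis
    unfolding coc_eq[OF matroid_con basis_con j] coc_eq[OF M B j']
    unfolding contraction_iff[OF M B] eq Eq
    using n by (auto simp only: insert_commute)
qed

text \<open>The basis of the deletion has \<open>a\<close> in place of \<open>n\<close>, so the two
  cocircuits are compared below \<open>a\<close> only. Membership of \<open>x\<close> in the
  cocircuit at \<open>j\<close> is the same as membership of \<open>j\<close> in the circuit at
  \<open>x\<close>, and for these \<open>x\<close> the fundamental circuits agree by
  \<open>ci_del\<close>.\<close>

lemma coc_del:
  assumes j: "j \<in> {a+1..a+q}" and x: "x \<in> {1..a-1}"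
  shows "x \<in> coc {1..a+q} Idel {a..a+q} j \<longleftrightarrow> x \<in> coc {1..n} I {a+1..n} j"
proof -
  have j': "j \<in> {a+1..n}" "j \<in> {a..a+q}" using j by (auto simp: n_def)
  have x': "x \<in> {1..n}" "x \<notin> {a+1..n}" "x \<in> {1..a+q}" "x \<notin> {a..a+q}" using x by (auto simp: n_def)
  have "x \<in> coc {1..a+q} Idel {a..a+q} j \<longleftrightarrow> j \<in> ci {1..a+q} Idel {a..a+q} x"
    unfolding mem_coc_iff[OF matroid_del basis_del j'(2) x'(3,4)]
      mem_ci_iff[OF matroid_del basis_del x'(3,4) j'(2)] ..
  also have "\<dots> \<longleftrightarrow> j \<in> ci {1..n} I {a+1..n} x" unfolding ci_del[OF x] ..
  also have "\<dots> \<longleftrightarrow> x \<in> coc {1..n} I {a+1..n} j"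
    unfolding mem_coc_iff[OF M B j'(1) x'(1,2)] mem_ci_iff[OF M B x'(1,2) j'(1)] ..
  finally show ?thesis .
qed

lemma ranks: "n - Suc q = a" "a + q - Suc q = a - 1" "a - 1 + 1 = a" "a + q - q = a"
  using a_pos by (simp_all add: n_def)

lemma d_idx_con:
  assumes "j \<in> {1..a+q}"
  shows "d_idx (a+q) q Icon j = d_idx n (Suc q) I j"
  using coc_con[of j] assms unfolding d_idx_def ranks by auto

lemma d_idx_n: "d_idx n (Suc q) I n = a"
  unfolding d_idx_def ranks coc_n using an(1) by simp

text \<open>The danger is a cocircuit of M whose minimum is \<open>a\<close>, for \<open>a\<close>
  has moved into the basis. But the cocircuit at \<open>j\<close> meets \<open>C\<close> in a second
  element, which is below \<open>a\<close> since \<open>a\<close> is not in \<open>C\<close>. So the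
  minimum is below \<open>a\<close>, where the cocircuits of M and of the deletion agree.\<close>

lemma d_idx_del:
  assumes C: "circuit {1..n} I C" "a \<notin> C" and j: "j \<in> C"
  shows "d_idx (a+q) (Suc q) Idel j = d_idx n (Suc q) I j \<and> d_idx n (Suc q) I j \<noteq> a"
proof -
  have nC: "n \<notin> C" using series_circuit C by blast
  have "j \<in> {1..n}" using circuit_subset[OF C(1)] j by blast
  moreover have "j \<noteq> a" "j \<noteq> n" using j C(2) nC by auto
  ultimately have "j \<le> a - 1 \<or> j \<in> {a+1..a+q}" unfolding n_def atLeastAtMost_iff by linarith
  then consider "j \<le> a - 1" | "j \<in> {a+1..a+q}" by blast
  then show ?thesis
  proof cases
    case 1
    then show ?thesis unfolding d_idx_def ranks using \<open>j \<noteq> a\<close> by auto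
  next
    case 2
    define D where "D = coc {1..n} I {a+1..n} j"
    define D' where "D' = coc {1..a+q} Idel {a..a+q} j"
    have jB: "j \<in> {a+1..n}" "j \<in> {a..a+q}" using 2 by (auto simp: n_def)
    note Dp = coc_cocircuit[OF M B jB(1), folded D_def]
    note D'p = coc_cocircuit[OF matroid_del basis_del jB(2), folded D'_def]
    have mem: "x \<in> D' \<longleftrightarrow> x \<in> D" if "x \<in> {1..a-1}" for x
      unfolding D_def D'_def by (rule coc_del[OF 2 that])
    have "D \<subseteq> insert j {1..a}" using Dp(2) by auto
    moreover have "C \<inter> D \<noteq> {j}" by (rule circuit_cocircuit_inter[OF sign C(1) Dp(1)])
    moreover have "j \<in> C \<inter> D" using j Dp(3) by blast
    ultimately obtain x where x: "x \<in> D" "x \<in> {1..a}" "x \<in> C" by blast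
    then have x': "x \<le> a - 1" using C(2) by (cases "x = a") auto
    have fin: "finite D" using cocircuit_subset[OF Dp(1)] finite_subset by blast
    have fin': "finite D'" using cocircuit_subset[OF D'p(1)] finite_subset by blast
    have min: "Min D \<in> D" "Min D \<le> x" using fin x(1) by (auto intro: Min_in)
    then have minD': "Min D \<in> D'" using mem[of "Min D"] x' cocircuit_subset[OF Dp(1)] by auto
    have "D' \<subseteq> D"
    proof
      fix y assume y: "y \<in> D'"
      then have "y = j \<or> y \<in> {1..a-1}" using D'p(2) by auto
      then show "y \<in> D" using mem[of y] y Dp(3) by blast
    qed
    then have "Min D' = Min D" using fin fin' minD' by (intro Min_eqI) auto
    moreover have "Min D \<noteq> a" using min(2) x' a_pos by linarith
    moreover have "\<not> j \<le> a" "\<not> j \<le> a - 1" using 2 by auto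
    ultimately show ?thesis
      unfolding d_idx_def ranks D_def[symmetric] D'_def[symmetric] by simp
  qed
qed

text \<open>Such a circuit is fundamental in M exactly when it is fundamental in each minor, so the
  same clause of \<open>mC\<close> applies three times. The third claim permits cancelling
  \<open>x_a\<close> in a divisibility.\<close>

lemma mC_avoiding:
  assumes C: "circuit {1..n} I C" "a \<notin> C"
  shows "mC (a+q) (Suc q) Idel C = mC n (Suc q) I C" "mC (a+q) q Icon C = mC n (Suc q) I C"
    "Poly_Mapping.lookup (mC n (Suc q) I C) a = 0"
proof -
  have nC: "n \<notin> C" using series_circuit C by blast
  note fund = mC_fundamental[where m = n and s = "Suc q" and I = I, unfolded ranks, OF M B]
    and fund_del = mC_fundamental[where m = "a+q" and s = "Suc q" and I = Idel, unfolded ranks, OF matroid_del basis_del]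
    and fund_con = mC_fundamental[where m = "a+q" and s = q and I = Icon, unfolded ranks, OF matroid_con basis_con]
  note nonf = mC_nonfundamental[where m = n and s = "Suc q" and I = I, unfolded ranks, OF M B]
    and nonf_del = mC_nonfundamental[where m = "a+q" and s = "Suc q" and I = Idel, unfolded ranks, OF matroid_del basis_del]
    and nonf_con = mC_nonfundamental[where m = "a+q" and s = q and I = Icon, unfolded ranks, OF matroid_con basis_con]
  have small: "i \<in> {1..a-1}" if "i \<in> {1..a}" "i \<in> C" for i
    using that C(2) by (cases "i = a") auto
  have *: "mC (a+q) (Suc q) Idel C = mC n (Suc q) I C \<and> mC (a+q) q Icon C = mC n (Suc q) I C
    \<and> Poly_Mapping.lookup (mC n (Suc q) I C) a = 0"
  proof (cases "\<exists>i\<in>{1..a}. C = ci {1..n} I {a+1..n} i")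
    case True
    then obtain i where i: "i \<in> {1..a}" "C = ci {1..n} I {a+1..n} i" by blast
    have i': "i \<in> {1..a-1}" using small[OF i(1)] ci_props(3)[OF i(1)] i(2) by simp
    have "mC n (Suc q) I C = Poly_Mapping.single i (card (bar C))" by (rule fund[OF i])
    moreover have "mC (a+q) (Suc q) Idel C = Poly_Mapping.single i (card (bar C))"
      by (rule fund_del[OF i']) (simp only: ci_del[OF i'] i(2))
    moreover have "mC (a+q) q Icon C = Poly_Mapping.single i (card (bar C))"
      by (rule fund_con[OF i(1)]) (use ci_con[OF i(1)] i(2) nC in simp)
    moreover have "i \<noteq> a" using i' by auto
    ultimately show ?thesis by (simp add: lookup_single)
  next
    case False
    then have N: "\<forall>i\<in>{1..a}. C \<noteq> ci {1..n} I {a+1..n} i" by blast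
    have N_del: "\<forall>i\<in>{1..a-1}. C \<noteq> ci {1..a+q} Idel {a..a+q} i"
    proof
      fix i assume i: "i \<in> {1..a-1}"
      then have "i \<in> {1..a}" by auto
      then show "C \<noteq> ci {1..a+q} Idel {a..a+q} i" unfolding ci_del[OF i] using N by blast
    qed
    have N_con: "\<forall>i\<in>{1..a}. C \<noteq> ci {1..a+q} Icon {a+1..a+q} i"
    proof
      fix i assume i: "i \<in> {1..a}"
      show "C \<noteq> ci {1..a+q} Icon {a+1..a+q} i"
      proof
        assume eq: "C = ci {1..a+q} Icon {a+1..a+q} i"
        have "i \<noteq> n" using i an(1) by auto
        then have "i \<in> C" using eq ci_props(3)[OF i] unfolding ci_con[OF i] by blast
        then have "n \<notin> ci {1..n} I {a+1..n} i" using ci_avoids(2) small[OF i] by blast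
        then have "C = ci {1..n} I {a+1..n} i" using eq unfolding ci_con[OF i] by blast
        then show False using N i by blast
      qed
    qed
    have inC: "j \<in> C" if "j \<in> bar C" for j using that bar_subset by blast
    have "mC (a+q) (Suc q) Idel C = mC n (Suc q) I C"
      unfolding nonf_del[OF N_del] nonf[OF N]
      using d_idx_del[OF C inC] by (intro sum.cong) simp_all
    moreover have "mC (a+q) q Icon C = mC n (Suc q) I C"
    proof -
      have "j \<in> {1..a+q}" if "j \<in> bar C" for j
        using inC[OF that] circuit_subset[OF C(1)] nC unfolding E_eq by blast
      then show ?thesis
        unfolding nonf_con[OF N_con] nonf[OF N] using d_idx_con by (intro sum.cong) simp_all
    qed
    moreover have "Poly_Mapping.lookup (mC n (Suc q) I C) a = 0"
      unfolding nonf[OF N] lookup_sum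
      using d_idx_del[OF C inC] by (intro sum.neutral) (simp add: lookup_single)
    ultimately show ?thesis by blast
  qed
  then show "mC (a+q) (Suc q) Idel C = mC n (Suc q) I C" "mC (a+q) q Icon C = mC n (Suc q) I C"
    "Poly_Mapping.lookup (mC n (Suc q) I C) a = 0" by blast+
qed

text \<open>As \<open>a\<close> is also in \<open>C\<close> and \<open>a < n\<close>, removing
  \<open>n\<close> does not change the minimum.\<close>

lemma bar_containing:
  assumes C: "circuit {1..n} I C" "n \<in> C"
  shows "bar C = insert n (bar (C - {n}))" "n \<notin> bar (C - {n})" "finite (bar (C - {n}))"
proof -
  have a: "a \<in> C" using series_circuit[OF C(1)] C(2) by blast
  have fin: "finite C" by (rule circuit_finite[OF M C(1)])
  have "Min C \<in> C" using fin a by (intro Min_in) auto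
  moreover have "Min C < n" using Min_le[OF fin a] an(1) by linarith
  ultimately have "Min (C - {n}) = Min C" using fin by (intro Min_eqI) auto
  then show "bar C = insert n (bar (C - {n}))" using \<open>Min C < n\<close> C(2) unfolding bar_def by auto
  show "n \<notin> bar (C - {n})" "finite (bar (C - {n}))" using fin unfolding bar_def by auto
qed

text \<open>The element \<open>n\<close> contributes the factor with index
  \<open>d_idx n (Suc q) I n = a\<close>. For the fundamental circuit of \<open>a\<close>, whose
  monomial is a power of \<open>x_a\<close>, it raises the exponent by one instead.\<close>

lemma mC_containing:
  assumes C: "circuit {1..n} I C" "a \<in> C"
  shows "mC n (Suc q) I C = Poly_Mapping.single a 1 + mC (a+q) q Icon (C - {n})"
proof -
  have nC: "n \<in> C" using series_circuit C by blast
  note fund = mC_fundamental[where m = n and s = "Suc q" and I = I, unfolded ranks, OF M B]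
    and fund_con = mC_fundamental[where m = "a+q" and s = q and I = Icon, unfolded ranks, OF matroid_con basis_con]
  note nonf = mC_nonfundamental[where m = n and s = "Suc q" and I = I, unfolded ranks, OF M B]
    and nonf_con = mC_nonfundamental[where m = "a+q" and s = q and I = Icon, unfolded ranks, OF matroid_con basis_con]
  have aa: "a \<in> {1..a}" using a_pos by simp
  show ?thesis
  proof (cases "C = ci {1..n} I {a+1..n} a")
    case True
    have "mC n (Suc q) I C = Poly_Mapping.single a (card (bar C))" by (rule fund[OF aa True])
    moreover have "mC (a+q) q Icon (C - {n}) = Poly_Mapping.single a (card (bar (C - {n})))"
      by (rule fund_con[OF aa]) (simp only: ci_con[OF aa] True)
    moreover have "card (bar C) = 1 + card (bar (C - {n}))"
      using bar_containing[OF C(1) nC] by simp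
    ultimately show ?thesis by (simp only: single_add)
  next
    case False
    have N: "\<forall>i\<in>{1..a}. C \<noteq> ci {1..n} I {a+1..n} i"
    proof
      fix i assume i: "i \<in> {1..a}"
      show "C \<noteq> ci {1..n} I {a+1..n} i"
      proof
        assume eq: "C = ci {1..n} I {a+1..n} i"
        then have "a \<in> insert i {a+1..n}" using ci_props(2)[OF i] C(2) by blast
        then have "i = a" using an(4) by blast
        then show False using eq False by simp
      qed
    qed
    have N_con: "\<forall>i\<in>{1..a}. C - {n} \<noteq> ci {1..a+q} Icon {a+1..a+q} i"
    proof
      fix i assume i: "i \<in> {1..a}"
      show "C - {n} \<noteq> ci {1..a+q} Icon {a+1..a+q} i"
      proof
        assume eq: "C - {n} = ci {1..a+q} Icon {a+1..a+q} i"
        then have "a \<in> ci {1..n} I {a+1..n} i"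
          unfolding ci_con[OF i] using C(2) an(1) by blast
        then have "n \<in> ci {1..n} I {a+1..n} i" using series_circuit[OF ci_props(1)[OF i]] by blast
        then have "C = ci {1..n} I {a+1..n} i" using eq nC unfolding ci_con[OF i] by blast
        then show False using N i by blast
      qed
    qed
    have "d_idx (a+q) q Icon j = d_idx n (Suc q) I j" if "j \<in> bar (C - {n})" for j
    proof -
      have "j \<in> C - {n}" using that bar_subset by blast
      then have "j \<in> {1..a+q}" using circuit_subset[OF C(1)] unfolding E_eq by blast
      then show ?thesis by (rule d_idx_con)
    qed
    then have "(\<Sum>j\<in>bar (C - {n}). Poly_Mapping.single (d_idx n (Suc q) I j) (1::nat))
        = (\<Sum>j\<in>bar (C - {n}). Poly_Mapping.single (d_idx (a+q) q Icon j) 1)"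
      by (intro sum.cong) simp_all
    then show ?thesis
      unfolding nonf[OF N] nonf_con[OF N_con] bar_containing(1)[OF C(1) nC]
      by (simp add: bar_containing(2,3)[OF C(1) nC] d_idx_n)
  qed
qed

text \<open>Split by whether \<open>x_a\<close> divides the monomial. If not, circuits through
  \<open>a\<close> impose nothing, as their monomials are divisible by \<open>x_a\<close>. If so,
  dividing by \<open>x_a\<close> turns the conditions for M into those for the contraction.\<close>

lemma LN_decomposition:
  "LN n (Suc q) I = LN (a+q) (Suc q) Idel \<union> (+) (Poly_Mapping.single a 1) ` LN (a+q) q Icon"
proof (intro equalityI subsetI)
  fix \<mu> assume \<mu>: "\<mu> \<in> LN n (Suc q) I"
  have keys: "Poly_Mapping.keys \<mu> \<subseteq> {1..a}" using LN_keys[OF \<mu>] unfolding ranks .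
  have nd: "\<not> mono_dvd (mC n (Suc q) I C) \<mu>" if "circuit {1..n} I C" for C
    using \<mu> that by (simp add: LN_def)
  show "\<mu> \<in> LN (a+q) (Suc q) Idel \<union> (+) (Poly_Mapping.single a 1) ` LN (a+q) q Icon"
  proof (cases "Poly_Mapping.lookup \<mu> a = 0")
    case True
    have "Poly_Mapping.keys \<mu> \<subseteq> {1..a-1}"
    proof
      fix i assume i: "i \<in> Poly_Mapping.keys \<mu>"
      then have "i \<noteq> a" using True by (auto simp: in_keys_iff)
      then show "i \<in> {1..a-1}" using keys i by fastforce
    qed
    moreover have "\<not> mono_dvd (mC (a+q) (Suc q) Idel C) \<mu>" if "circuit {1..a+q} Idel C" for C
    proof -
      have C: "circuit {1..n} I C" "a \<notin> C" using that series_circuit unfolding circuit_del by auto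
      show ?thesis unfolding mC_avoiding(1)[OF C] by (rule nd[OF C(1)])
    qed
    ultimately show ?thesis unfolding LN_def ranks by simp
  next
    case False
    let ?\<nu> = "\<mu> - Poly_Mapping.single a 1"
    have \<mu>_eq: "\<mu> = Poly_Mapping.single a 1 + ?\<nu>"
      using False by (intro poly_mapping_eqI) (auto simp: lookup_add lookup_minus lookup_single when_def)
    have "Poly_Mapping.keys ?\<nu> \<subseteq> Poly_Mapping.keys \<mu>" by (auto simp: in_keys_iff lookup_minus)
    then have "Poly_Mapping.keys ?\<nu> \<subseteq> {1..a}" using keys by blast
    moreover have "\<not> mono_dvd (mC (a+q) q Icon K) ?\<nu>" if K: "circuit {1..a+q} Icon K" for K
    proof
      assume dvd: "mono_dvd (mC (a+q) q Icon K) ?\<nu>"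
      obtain C where C: "circuit {1..n} I C" "K = C - {n}" using circuit_con_obtain[OF K] .
      have "mono_dvd (mC n (Suc q) I C) \<mu>"
      proof (cases "a \<in> C")
        case True
        show ?thesis using dvd
          by (subst \<mu>_eq) (simp add: mC_containing[OF C(1) True] C(2) mono_dvd_def lookup_add)
      next
        case False
        then have "K = C" using series_circuit[OF C(1)] C(2) by blast
        then show ?thesis using dvd mC_avoiding(2)[OF C(1) False]
          by (subst \<mu>_eq) (auto simp: mono_dvd_def lookup_add intro: trans_le_add2)
      qed
      then show False using nd[OF C(1)] by blast
    qed
    ultimately have "?\<nu> \<in> LN (a+q) q Icon" unfolding LN_def ranks by simp
    then show ?thesis using \<mu>_eq by blast
  qed
next
  fix \<mu> assume "\<mu> \<in> LN (a+q) (Suc q) Idel \<union> (+) (Poly_Mapping.single a 1) ` LN (a+q) q Icon"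
  then consider (del) "\<mu> \<in> LN (a+q) (Suc q) Idel"
    | (con) \<nu> where "\<nu> \<in> LN (a+q) q Icon" "\<mu> = Poly_Mapping.single a 1 + \<nu>" by blast
  then show "\<mu> \<in> LN n (Suc q) I"
  proof cases
    case del
    have keys: "Poly_Mapping.keys \<mu> \<subseteq> {1..a-1}" using LN_keys[OF del] unfolding ranks .
    then have "a \<notin> Poly_Mapping.keys \<mu>" using a_pos by auto
    then have 0: "Poly_Mapping.lookup \<mu> a = 0" by (simp add: in_keys_iff)
    have "\<not> mono_dvd (mC n (Suc q) I C) \<mu>" if C: "circuit {1..n} I C" for C
    proof (cases "a \<in> C")
      case True
      have "Poly_Mapping.lookup (mC n (Suc q) I C) a \<ge> 1"
        unfolding mC_containing[OF C True] by (simp add: lookup_add)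
      then show ?thesis using 0 unfolding mono_dvd_def by (metis le_zero_eq not_one_le_zero)
    next
      case False
      then have "circuit {1..a+q} Idel C" unfolding circuit_del using C series_circuit by blast
      then have "\<not> mono_dvd (mC (a+q) (Suc q) Idel C) \<mu>" using del unfolding LN_def by blast
      then show ?thesis unfolding mC_avoiding(1)[OF C False] .
    qed
    moreover have "{1..a-1} \<subseteq> {1..a}" by auto
    ultimately show ?thesis unfolding LN_def ranks using keys by blast
  next
    case con
    have keys: "Poly_Mapping.keys \<nu> \<subseteq> {1..a}" using LN_keys[OF con(1)] unfolding ranks .
    have nd: "\<not> mono_dvd (mC (a+q) q Icon (C - {n})) \<nu>" if "circuit {1..n} I C" for C
      using con(1) circuit_con[OF that] by (simp add: LN_def)
    have "\<not> mono_dvd (mC n (Suc q) I C) \<mu>" if C: "circuit {1..n} I C" for C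
    proof
      assume dvd: "mono_dvd (mC n (Suc q) I C) \<mu>"
      have "mono_dvd (mC (a+q) q Icon (C - {n})) \<nu>"
      proof (cases "a \<in> C")
        case True
        show ?thesis using dvd unfolding mC_containing[OF C True] con(2)
          by (simp add: mono_dvd_def lookup_add)
      next
        case False
        have "C - {n} = C" using series_circuit[OF C] False by blast
        then have eq: "mC (a+q) q Icon (C - {n}) = mC n (Suc q) I C" using mC_avoiding(2)[OF C False] by simp
        show ?thesis unfolding eq mono_dvd_def
        proof
          fix i
          show "Poly_Mapping.lookup (mC n (Suc q) I C) i \<le> Poly_Mapping.lookup \<nu> i"
          proof (cases "i = a")
            case True
            then show ?thesis using mC_avoiding(3)[OF C False] by simp
          next
            case False
            have "Poly_Mapping.lookup (mC n (Suc q) I C) i \<le> Poly_Mapping.lookup \<mu> i"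
              using dvd unfolding mono_dvd_def by blast
            then show ?thesis using False by (simp add: con(2) lookup_add lookup_single)
          qed
        qed
      qed
      then show False using nd[OF C] by blast
    qed
    moreover have "Poly_Mapping.keys \<mu> \<subseteq> {1..a}" unfolding con(2) keys_add_nat using keys a_pos by auto
    ultimately show ?thesis unfolding LN_def ranks by blast
  qed
qed


section \<open>The three quotients compared\<close>

abbreviation (input) "W \<equiv> circuit_orth n I \<sigma>"
text \<open>The matrices that the signings induced from M give for the minors. They are the
  instances at which the NBC hypotheses on the minors are applied.\<close>

abbreviation (input) "astar_del \<equiv>
  \<lambda>j i. ((\<tau> (if cocircuit {1..n} I (coc {1..a+q} Idel {a..a+q} j) then coc {1..a+q} Idel {a..a+q} j
    else insert n (coc {1..a+q} Idel {a..a+q} j)))(n := 0)) i"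
abbreviation (input) "astar_con \<equiv> \<lambda>j. \<tau> (coc {1..a+q} Icon {a+1..a+q} j)"

lemma sign_del: "signing (a+q) Idel \<sigma>
    (\<lambda>D. (\<tau> (if cocircuit {1..n} I D then D else insert n D))(n := 0))"
  unfolding n_def
  by (rule signing_deletion[OF M[unfolded n_def] basis_exchanged[unfolded n_def] _ sign[unfolded n_def]]) simp

lemma sign_con: "signing (a+q) Icon (contraction_sign n I \<sigma>) \<tau>"
  using signing_contraction[of "a+q" I "{a+1..n}" \<sigma> \<tau>, folded n_def, OF M B indep_n sign] .

lemma admissible_del: "admissible (a+q) (Suc q) Idel astar_del"
  unfolding admissible_iff ranks using sign_del by (intro exI conjI) auto

lemma admissible_con: "admissible (a+q) q Icon astar_con"
  unfolding admissible_iff ranks using sign_con by (intro exI conjI) auto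

lemma subspace_W: "fun_subspace W" "fun_subspace {w\<in>W. w n = 0}"
  using fun_subspace_circuit_orth[of n I \<sigma>] unfolding fun_subspace_def by auto

lemma W_indep: "I Y \<Longrightarrow> indep_on W Y"
  by (rule indep_on_circuit_orth[OF sign M B])

lemma linear_form_in_JN_del:
  assumes "w \<in> W"
  shows "linear_form {1..a+q} w \<in> JN (a+q) (Suc q) Idel astar_del"
proof (rule linear_form_in_JN[OF sign_del matroid_del])
  show "w \<in> circuit_orth (a+q) Idel \<sigma>"
    using circuit_orth_deletion[of "a+q" I \<sigma> \<tau> w, folded n_def, OF sign assms] .
qed (simp_all only: ranks basis_del)

lemma linear_form_in_JN_con:
  assumes "w \<in> W" "w n = 0"
  shows "linear_form {1..a+q} w \<in> JN (a+q) q Icon astar_con"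
proof (rule linear_form_in_JN[OF sign_con matroid_con])
  show "w \<in> circuit_orth (a+q) Icon (contraction_sign n I \<sigma>)"
    using circuit_orth_contraction[of "a+q" I "{a+1..n}" w \<sigma>, folded n_def, OF M B indep_n assms] .
qed (simp_all only: ranks basis_con)

lemma card_LN_le:
  assumes del: "NBC_basis_wrt (a+q) (Suc q) Idel astar_del" and con: "NBC_basis_wrt (a+q) q Icon astar_con"
  shows "finite (LN (a+q) (Suc q) Idel)" "finite (LN (a+q) q Icon)" "finite (LN n (Suc q) I)"
    "card (LN n (Suc q) I) \<le> card (nbc_bases {1..n} W)"
proof -
  have 1: "finite (LN (a+q) (Suc q) Idel) \<and> card (LN (a+q) (Suc q) Idel) \<le> card (nbc_bases {1..a+q} W)"
  proof (rule card_LN_le_nbc_bases[OF matroid_del subspace_W(1) _ linear_form_in_JN_del del])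
    show "Idel Y \<Longrightarrow> indep_on W Y" for Y using W_indep by (simp add: deletion_def)
  qed
  have 2: "finite (LN (a+q) q Icon) \<and> card (LN (a+q) q Icon) \<le> card (nbc_bases {1..a+q} {w\<in>W. w n = 0})"
  proof (rule card_LN_le_nbc_bases[OF matroid_con subspace_W(2) _ _ con])
    fix Y assume "Icon Y"
    then have Y: "n \<notin> Y" "I (insert n Y)" unfolding contraction_iff[OF M B] by auto
    then show "indep_on {w\<in>W. w n = 0} Y" by (intro indep_on_contract W_indep)
  qed (use linear_form_in_JN_con in blast)
  have "indep_on W {n}" by (rule W_indep[OF indep_n])
  then obtain w0 where w0: "w0 \<in> W" "w0 n = 1" unfolding indep_on_def by blast
  \<comment> \<open>The basis \<open>{a..a+q}\<close> avoids \<open>n\<close>, so \<open>n\<close>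
    is not a coloop.\<close>
  have "w n = 0" if w: "w \<in> W" "\<forall>x\<in>{1..a+q}. w x = 0" for w
    by (rule circuit_orth_zero_on_basis[OF sign M basis_exchanged w(1) _ an(3)]) (use w(2) a_pos in auto)
  then have "card (nbc_bases {1..a+q} W) + card (nbc_bases {1..a+q} {w\<in>W. w n = 0}) \<le> card (nbc_bases {1..n} W)"
    using card_nbc_bases_deletion_contraction[OF subspace_W(1) _ _ w0, of "{1..a+q}"]
    unfolding insert_E by (auto simp: n_def)
  moreover have "card (LN n (Suc q) I) \<le> card (LN (a+q) (Suc q) Idel) + card (LN (a+q) q Icon)"
    unfolding LN_decomposition
    using card_Un_le card_image_le[OF conjunct1[OF 2], of "(+) (Poly_Mapping.single a 1)"]
    by (meson add_left_mono le_trans)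
  ultimately show "card (LN n (Suc q) I) \<le> card (nbc_bases {1..n} W)" using 1 2 by linarith
  show "finite (LN (a+q) (Suc q) Idel)" "finite (LN (a+q) q Icon)" using 1 2 by auto
  then show "finite (LN n (Suc q) I)" unfolding LN_decomposition by simp
qed

theorem NBC_basis_series_pair:
  assumes astar: "\<And>j i. j \<in> {a+1..n} \<Longrightarrow> i \<in> {1..n} \<Longrightarrow> astar j i = \<tau> (coc {1..n} I {a+1..n} j) i"
    and del: "NBC_basis_wrt (a+q) (Suc q) Idel astar_del" and con: "NBC_basis_wrt (a+q) q Icon astar_con"
  shows "NBC_basis_wrt n (Suc q) I astar"
proof -
  let ?E = "{1..n}" and ?E' = "{1..a+q}"
  let ?J = "JN n (Suc q) I astar" and ?L = "LN n (Suc q) I"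
  note L = card_LN_le[OF del con]
  have JN: "ideal_in (insert n ?E') ?J" unfolding insert_E by (rule ideal_in_JN)
  note J = JN[unfolded insert_E]
  have nE': "n \<notin> ?E'" "finite ?E'" unfolding n_def by simp_all
  have lin: "linear_form ?E w \<in> ?J" if "w \<in> W" for w
    by (rule linear_form_in_JN[OF sign M _ _ that]) (simp_all only: ranks B astar)
  have lin_split: "linear_form ?E w = Poly_Mapping.single 0 (w n) * var n + linear_form ?E' w" for w :: "nat \<Rightarrow> 'a"
    unfolding insert_E[symmetric] by (rule linear_form_insert[OF nE'(2,1)])
  define t where "t = \<tau> {n, a}"
  \<comment> \<open>The cocircuit \<open>{n, a}\<close> gives the relation
    \<open>t n * x_n + t a * x_a\<close> in \<open>J\<close>. Multiplying by \<open>t n\<close>,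
    whose square is 1, turns it into x_n = c * x_a.\<close>
  define c where "c = - (t n * t a)"
  have tt: "t n * t n = 1" "t a * t a = 1"
    unfolding t_def using cocircuit_sign_square[OF sign series] by auto
  have cc: "c * c = 1" using tt by (simp add: c_def mult_ac)
  have xn: "var n - Poly_Mapping.single 0 c * var a \<in> ?J"
  proof -
    have "linear_form ?E t \<in> ?J"
      unfolding t_def by (rule lin[OF cocircuit_sign_orth[OF sign series]])
    moreover have "linear_form ?E t = Poly_Mapping.single 0 (t n) * var n + Poly_Mapping.single 0 (t a) * var a"
    proof -
      have "linear_form ?E t = (\<Sum>i\<in>{n, a}. Poly_Mapping.single (Poly_Mapping.single i 1) (t i))"
        unfolding linear_form_def t_def using an cocircuit_sign_outside[OF sign series]
        by (intro sum.mono_neutral_right) auto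
      then show ?thesis using an(1) by (simp only: single_single_eq) simp
    qed
    ultimately have "Poly_Mapping.single 0 (t n) * (Poly_Mapping.single 0 (t n) * var n + Poly_Mapping.single 0 (t a) * var a) \<in> ?J"
      using ideal_in_const_mult[OF J] by simp
    also have "Poly_Mapping.single 0 (t n) * (Poly_Mapping.single 0 (t n) * var n + Poly_Mapping.single 0 (t a) * var a)
        = Poly_Mapping.single 0 (t n * t n) * var n + Poly_Mapping.single 0 (t n * t a) * (var a :: 'a mpoly)"
      by (simp add: distrib_left mult.assoc[symmetric] mult_single)
    also have "\<dots> = var n - Poly_Mapping.single 0 c * var a"
      by (simp add: tt(1) c_def single_uminus)
    finally show ?thesis .
  qed
  \<comment> \<open>Since \<open>c * c = 1\<close>, the relation can be read backwards, x_a = c *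
    x_n modulo \<open>J\<close>.\<close>
  have xa_mult: "var a * p \<in> ?J" if "var n * p \<in> ?J" "pvars p \<subseteq> ?E" for p
  proof -
    have "Poly_Mapping.single 0 c * (var n * p - (var n - Poly_Mapping.single 0 c * var a) * p) \<in> ?J"
      by (intro ideal_in_const_mult[OF J] ideal_in_diff[OF J] that(1) ideal_in_mult_right[OF J xn that(2)])
    also have "Poly_Mapping.single 0 c * (var n * p - (var n - Poly_Mapping.single 0 c * var a) * p)
        = Poly_Mapping.single 0 c * Poly_Mapping.single 0 c * (var a * p)"
      by (simp add: algebra_simps)
    also have "Poly_Mapping.single 0 c * Poly_Mapping.single 0 c = (1 :: 'a mpoly)"
      by (simp add: mult_single cc)
    finally show ?thesis by simp
  qed
  have spans: "spans_mod (insert n ?E') (mono ` LN (a+q) (Suc q) Idel \<union> (*) (var a) ` mono ` LN (a+q) q Icon) ?J"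
  proof (rule spans_mod_extension[OF JN _ _ xn])
    show "pvars (var a :: 'a mpoly) \<subseteq> insert n ?E'" unfolding insert_E by (rule pvars_var[OF an(2)])
    show "pvars (Poly_Mapping.single 0 c * var a) \<subseteq> ?E'"
      using a_pos by (intro pvars_mult pvars_single pvars_var) auto
    show "finite (mono ` LN (a+q) (Suc q) Idel)" "finite (mono ` LN (a+q) q Icon)" using L by simp_all
    show "spans_mod ?E' (mono ` LN (a+q) (Suc q) Idel) (JN (a+q) (Suc q) Idel astar_del)"
      unfolding spans_mod_monomials_iff[OF L(1)] using del unfolding NBC_basis_wrt_def by blast
    show "spans_mod ?E' (mono ` LN (a+q) q Icon) (JN (a+q) q Icon astar_con)"
      unfolding spans_mod_monomials_iff[OF L(2)] using con unfolding NBC_basis_wrt_def by blast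
  next
    fix p :: "'a mpoly" assume p: "p \<in> JN (a+q) (Suc q) Idel astar_del"
    let ?J' = "{p. \<exists>h. pvars h \<subseteq> insert n ?E' \<and> p - var a * h \<in> ?J}"
    have J': "ideal_in ?E' ?J'"
      by (rule ideal_in_subset[OF ideal_in_plus_principal[OF JN]]) blast
    have "JN (a+q) (Suc q) Idel astar_del \<subseteq> ?J'"
      unfolding JN_def[of "a+q"] ranks
    proof (rule gen_ideal_least[OF J'], intro Un_least subsetI)
      fix g :: "'a mpoly" assume "g \<in> SR_gens (a+q) Idel"
      then obtain C where "circuit ?E' Idel C" "g = mono (squarefree_exp (bar C))" unfolding SR_gens_eq by blast
      then have "g \<in> ?J" using broken_circuit_in_JN unfolding circuit_del by blast
      then show "g \<in> ?J'" by (intro CollectI exI[of _ 0]) (simp add: pvars_zero)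
    next
      fix g assume "g \<in> theta (a+q) (Suc q) Idel astar_del ` {a..a+q}"
      then obtain j where j: "j \<in> {a..a+q}" "g = theta (a+q) (Suc q) Idel astar_del j" by blast
      let ?D = "coc ?E' Idel {a..a+q} j"
      let ?D' = "if cocircuit ?E I ?D then ?D else insert n ?D"
      have "cocircuit ?E' Idel ?D" by (rule coc_cocircuit[OF matroid_del basis_del j(1)])
      then have D': "cocircuit ?E I ?D'"
        using cocircuit_deletionD[OF M basis_exchanged n_notin_exchanged an(3)] unfolding E_eq by auto
      have "g = linear_form ?E' ((\<tau> ?D')(n := 0))"
        unfolding j(2)
        by (rule theta_eq_linear_form[OF sign_del matroid_del, of "Suc q", unfolded ranks, OF basis_del _ j(1)])
          (rule refl)
      also have "\<dots> = linear_form ?E' (\<tau> ?D')"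
        by (rule linear_form_cong) (auto simp: n_def)
      finally have g: "g = linear_form ?E' (\<tau> ?D')" .
      \<comment> \<open>The form \<open>g\<close> differs from the linear form of
        \<open>\<tau> ?D'\<close> on M by its term in x_n, which is a multiple of x_a modulo
        \<open>J\<close>. So \<open>g\<close> lies in J + (x_a).\<close>
      let ?h = "- Poly_Mapping.single 0 (\<tau> ?D' n) * Poly_Mapping.single 0 c :: 'a mpoly"
      have "linear_form ?E (\<tau> ?D') - Poly_Mapping.single 0 (\<tau> ?D' n) * (var n - Poly_Mapping.single 0 c * var a) \<in> ?J"
        by (intro ideal_in_diff[OF J] lin cocircuit_sign_orth[OF sign D'] ideal_in_const_mult[OF J xn])
      also have "linear_form ?E (\<tau> ?D') - Poly_Mapping.single 0 (\<tau> ?D' n) * (var n - Poly_Mapping.single 0 c * var a)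
          = g - var a * ?h"
        unfolding g lin_split by (simp add: algebra_simps)
      finally have "g - var a * ?h \<in> ?J" .
      moreover have "pvars ?h \<subseteq> insert n ?E'" by (intro pvars_mult pvars_uminus pvars_single) simp_all
      ultimately show "g \<in> ?J'" by blast
    qed
    then show "\<exists>h. pvars h \<subseteq> insert n ?E' \<and> p - var a * h \<in> ?J" using p by blast
  next
    fix p :: "'a mpoly" assume p: "p \<in> JN (a+q) q Icon astar_con"
    have J': "ideal_in ?E' {p. var a * p \<in> ?J}"
      by (rule ideal_in_subset[OF ideal_in_colon[OF JN]]) blast
    have "JN (a+q) q Icon astar_con \<subseteq> {p. var a * p \<in> ?J}"
      unfolding JN_def[of "a+q"] ranks
    proof (rule gen_ideal_least[OF J'], intro Un_least subsetI)
      fix g :: "'a mpoly" assume "g \<in> SR_gens (a+q) Icon"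
      then obtain K where K: "circuit ?E' Icon K" "g = mono (squarefree_exp (bar K))" unfolding SR_gens_eq by blast
      obtain C where C: "circuit ?E I C" "K = C - {n}" using circuit_con_obtain[OF K(1)] .
      show "g \<in> {p. var a * p \<in> ?J}"
      proof (cases "n \<in> C")
        case True
        \<comment> \<open>The generator of M for \<open>C\<close> is x_n times the generator for
          \<open>K\<close>; \<open>xa_mult\<close> then trades x_n for x_a.\<close>
        have "mono (squarefree_exp (bar C)) = var n * g"
          unfolding bar_containing(1)[OF C(1) True] K(2) C(2)
          by (rule mono_squarefree_insert[OF bar_containing(3,2)[OF C(1) True]])
        then have "var n * g \<in> ?J" using broken_circuit_in_JN[OF C(1), where s = "Suc q" and a = astar] by simp
        moreover have "pvars g \<subseteq> ?E"
          unfolding K(2) pvars_mono_iff C(2) keys_squarefree_exp[OF bar_containing(3)[OF C(1) True]]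
          using bar_subset circuit_subset[OF C(1)] by blast
        ultimately show ?thesis using xa_mult by blast
      next
        case False
        then have "K = C" using C(2) by blast
        then have "g \<in> ?J" using broken_circuit_in_JN[OF C(1)] K(2) by blast
        then show ?thesis using ideal_in_mult[OF J _ pvars_var[OF an(2)]] by blast
      qed
    next
      fix g assume "g \<in> theta (a+q) q Icon astar_con ` {a+1..a+q}"
      then obtain j where j: "j \<in> {a+1..a+q}" "g = theta (a+q) q Icon astar_con j" by blast
      let ?D = "coc ?E' Icon {a+1..a+q} j"
      have "cocircuit ?E' Icon ?D" by (rule coc_cocircuit[OF matroid_con basis_con j(1)])
      then have D: "n \<notin> ?D" "cocircuit ?E I ?D"
        using cocircuit_contractionD[OF M B indep_n] unfolding E_eq by blast+
      have "g = linear_form ?E' (\<tau> ?D)"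
        unfolding j(2)
        using theta_eq_linear_form[OF sign_con matroid_con, of q astar_con j, unfolded ranks, OF basis_con _ j(1)]
        by simp
      then have "g = linear_form ?E (\<tau> ?D)"
        unfolding lin_split using cocircuit_sign_outside[OF sign D(2,1)] by simp
      then have "g \<in> ?J" using lin[OF cocircuit_sign_orth[OF sign D(2)]] by simp
      then show "g \<in> {p. var a * p \<in> ?J}" using ideal_in_mult[OF J _ pvars_var[OF an(2)]] by blast
    qed
    then show "var a * p \<in> ?J" using p by blast
  qed
  have "mono ` LN (a+q) (Suc q) Idel \<union> (*) (var a) ` mono ` LN (a+q) q Icon = (mono ` ?L :: 'a mpoly set)"
    unfolding LN_decomposition image_Un image_image mono_add mono_single ..
  then have span: "\<forall>p::'a mpoly. pvars p \<subseteq> ?E \<longrightarrow> (\<exists>f. Poly_Mapping.keys f \<subseteq> ?L \<and> p - f \<in> ?J)"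
    using spans spans_mod_monomials_iff[OF L(3), of ?E ?J] unfolding insert_E by simp
  have lower: "card ?L \<le> card K"
    if K: "finite K" "\<forall>p::'a mpoly. pvars p \<subseteq> ?E \<longrightarrow> (\<exists>f. Poly_Mapping.keys f \<subseteq> K \<and> p - f \<in> ?J)" for K
  proof -
    have "card (nbc_bases ?E W) \<le> card K"
    proof (rule card_nbc_bases_le_spanning[OF _ subspace_W(1) K(1)])
      show "\<exists>f. Poly_Mapping.keys f \<subseteq> K \<and> p - f \<in> gen_ideal ?E (SR_gens n I \<union> theta n (Suc q) I astar ` {a+1..n})"
        if "pvars p \<subseteq> ?E" for p
        using K(2) that unfolding JN_def ranks by blast
      fix g :: "'a mpoly" assume "g \<in> SR_gens n I \<union> theta n (Suc q) I astar ` {a+1..n}"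
      then show "(\<exists>X. finite X \<and> g = mono (squarefree_exp X) \<and> (\<forall>Y\<in>nbc_bases ?E W. \<not> X \<subseteq> Y)) \<or>
          (\<exists>w\<in>W. g = linear_form ?E w)"
      proof
        assume "g \<in> SR_gens n I"
        then obtain C where C: "circuit ?E I C" "g = mono (squarefree_exp (bar C))" unfolding SR_gens_eq by blast
        have "finite (bar C)" using finite_subset[OF bar_subset circuit_finite[OF M C(1)]] .
        moreover have "\<forall>Y\<in>nbc_bases ?E W. \<not> bar C \<subseteq> Y"
          using broken_circuit_not_subset_nbc[OF M C(1) circuit_not_indep_on[OF sign M C(1)]] by blast
        ultimately show ?thesis using C(2) by blast
      next
        assume "g \<in> theta n (Suc q) I astar ` {a+1..n}"
        then obtain j where j: "j \<in> {a+1..n}" "g = theta n (Suc q) I astar j" by blast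
        have "g = linear_form ?E (\<tau> (coc ?E I {a+1..n} j))"
          unfolding j(2)
          using theta_eq_linear_form[OF sign M, of "Suc q" astar j, unfolded ranks, OF B astar j(1)] by simp
        moreover have "\<tau> (coc ?E I {a+1..n} j) \<in> W"
          by (rule cocircuit_sign_orth[OF sign coc_cocircuit(1)[OF M B j(1)]])
        ultimately show ?thesis by blast
      qed
    qed simp
    then show ?thesis using L(4) by simp
  qed
  \<comment> \<open>\<open>lower\<close> says that no set of monomials smaller than
    \<open>?L\<close> spans, so the exchange argument applies.\<close>
  have "f = 0" if "Poly_Mapping.keys f \<subseteq> ?L" "f \<in> ?J" for f :: "'a mpoly"
    using minimal_spanning_monomials_independent[OF J L(3) _ lower that] span by blast
  then show ?thesis unfolding NBC_basis_wrt_def using span by blast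
qed

end

theorem theorem4p6:
  fixes k :: "'a::field itself" and n r :: nat and indep :: "nat set \<Rightarrow> bool"
  assumes "regular_matroid n indep"
    and "r \<le> n"
    and "is_basis {1..n} indep {n-r+1..n}"
    and "cocircuit {1..n} indep {n, n-r}"
    and "has_NBC_basis k (n-1) r (deletion indep n)"
    and "has_NBC_basis k (n-1) (r-1) (contraction {1..n} indep n)"
  shows "has_NBC_basis k n r indep"
  unfolding has_NBC_basis_def
proof (intro allI impI)
  fix astar :: "nat \<Rightarrow> nat \<Rightarrow> 'a" assume "admissible n r indep astar"
  then obtain \<sigma> \<tau> where sign: "signing n indep \<sigma> \<tau>"
    and astar: "\<forall>j\<in>{n-r+1..n}. \<forall>i\<in>{1..n}. astar j i = \<tau> (coc {1..n} indep {n-r+1..n} j) i"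
    unfolding admissible_iff by blast
  have M: "matroid {1..n} indep" using assms(1) by (simp add: regular_matroid_def)
  have sub: "{n, n-r} \<subseteq> {1..n}" by (rule cocircuit_subset[OF assms(4)])
  \<comment> \<open>The cocircuit meets the basis, so the rank is positive and may be written as
    \<open>Suc q\<close>. That \<open>n-r\<close> belongs to the ground set gives
    \<open>1 \<le> a\<close>.\<close>
  have "{n, n-r} \<inter> {n-r+1..n} \<noteq> {}" by (rule cocircuit_meets[OF assms(4,3)])
  then have "r \<noteq> 0" by auto
  then obtain q where r: "r = Suc q" by (cases r) auto
  define a where "a = n - r"
  have n: "n = Suc (a + q)" and a: "1 \<le> a" using sub assms(2) by (auto simp: a_def r)
  interpret series_pair a q n indep \<sigma> \<tau>
    using assms(3,4) unfolding a_def[symmetric] by unfold_locales (rule a n M sign | assumption)+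
  have n_minus: "n - 1 = a + q" by (simp add: n)
  have del: "NBC_basis_wrt (a+q) (Suc q) (deletion indep n) astar_del"
    using assms(5)[unfolded has_NBC_basis_def r n_minus] admissible_del by blast
  have con: "NBC_basis_wrt (a+q) q (contraction {1..n} indep n) astar_con"
    using assms(6)[unfolded has_NBC_basis_def r n_minus diff_Suc_1] admissible_con by blast
  show "NBC_basis_wrt n r indep astar"
    unfolding r by (rule NBC_basis_series_pair[OF _ del con]) (use astar in \<open>simp only: a_def\<close>)
qed

end
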